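(* Let $\mathbb{K}$ be an algebraically closed field of characteristic $0$. Framed orthogonal instanton bundles of rank $2$ and charge $2$ on $\mathbb{P}^2$ over $\mathbb{K}$ do not exist. In other words, $\mathcal{M}^{o}_{\mathbb{P}^2}(2,2)=\emptyset$: there is no orthogonal instanton bundle of trivial splitting type of rank $2$ and charge $2$ on $\mathbb{P}^2$.
   Context: An instanton sheaf of charge $c>0$ and rank $r$ on $\mathbb{P}^n$ is a coherent sheaf that is the cohomology $\ker b/\operatorname{im} a$ of a monad $\mathcal{O}(-1)^{\oplus c}\xrightarrow{a}\mathcal{O}^{\oplus r+2c}\xrightarrow{b}\mathcal{O}(1)^{\oplus c}$ ($b\circ a=0$, $a$ injective and $b$ surjective as sheaf maps); it is an instanton bundle if it is locally free. $\mathcal{E}$ is of trivial splitting type if there is a line $l\subset\mathbb{P}^n$ with $\mathcal{E}|_l\cong\mathcal{O}_l^{\oplus r}$; a framing is a choice of isomorphism $\Phi\colon\mathcal{E}|_l\to\mathcal{O}_l^{\oplus r}$. An orthogonal instanton bundle is an instanton bundle $\mathcal{E}$ with an isomorphism $\varphi\colon\mathcal{E}\to\mathcal{E}^\vee$ satisfying $\varphi^\vee=\varphi$; it is framed if moreover a framing $\Phi$ is given (and $\varphi|_l$ corresponds, via $\Phi$ and $(\Phi^\vee)^{-1}$, to a constant linear isomorphism $\mathbb{K}^r\to(\mathbb{K}^r)^\vee$). $\mathcal{M}^{o}_{\mathbb{P}^n}(r,c)$ denotes the set of isomorphism classes of orthogonal instanton bundles of trivial splitting type on $\mathbb{P}^n$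 with rank $r$ and charge $c$. *)

theory Defs
  imports "HOL-Analysis.Analysis" "HOL-Algebra.Module"
    "HOL-Computational_Algebra.Polynomial"
begin

text \<open>
  Coherent sheaves on projective space over an algebraically closed field, in the language of
  classical varieties: \<open>P(K\<^sup>N)\<close> is the set of one-dimensional subspaces of \<^typ>\<open>'k^'n\<close> with the
  Zariski topology, so the projective plane is the case of index type \<^typ>\<open>3\<close>.
  Over an algebraically closed field passing to closed points is an equivalence between the
  sheaves of modules on the scheme and those on the variety (with the same regular functions).
\<close>

section \<open>Projective space, the Zariski topology, lines\<close>

definition proj_space :: "('k::field ^ 'n::finite) set set" where
  "proj_space = {vec.span {v} | v. v \<noteq> 0}"

text \<open>The punctured affine cone over a set of points.\<close>

definition punctured_cone :: "('k::field ^ 'n::finite) set set \<Rightarrow> ('k ^ 'n) set" where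
  "punctured_cone V = \<Union>V - {0}"

definition monomials :: "nat \<Rightarrow> ('n::finite \<Rightarrow> nat) set" where
  "monomials d = {m. (\<Sum>i\<in>UNIV. m i) = d}"

lemma finite_monomials: "finite (monomials d :: ('n::finite \<Rightarrow> nat) set)"
proof (rule finite_subset)
  show "monomials d \<subseteq> (UNIV :: 'n set) \<rightarrow>\<^sub>E {..d}"
    by (auto simp: monomials_def intro!: member_le_sum)
  show "finite ((UNIV :: 'n set) \<rightarrow>\<^sub>E {..d})"
    by (intro finite_PiE) auto
qed

text \<open>
  Forms are treated as functions; an algebraically closed field is infinite, so a polynomial
  is determined by its values.
\<close>

definition form :: "nat \<Rightarrow> ('k::field ^ 'n::finite \<Rightarrow> 'k) \<Rightarrow> bool" where
  "form d f \<longleftrightarrow> (\<exists>c. f = (\<lambda>v. \<Sum>m\<in>monomials d. c m * (\<Prod>i\<in>UNIV. v $ i ^ m i)))"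

definition zariski :: "('k::field ^ 'n::finite) set topology" where
  "zariski = topology_generated_by
     {{p \<in> proj_space. \<forall>v \<in> p - {0}. f v \<noteq> 0} | f. \<exists>d. form d f}"

abbreviation zar :: "('k::field ^ 'n::finite) set set \<Rightarrow> ('k ^ 'n) set topology" where
  "zar X \<equiv> subtopology zariski X"

definition lines :: "('k::field ^ 'n::finite) set set set" where
  "lines = {{p \<in> proj_space. p \<subseteq> W} | W. vec.subspace W \<and> vec.dim W = 2}"


section \<open>Sheaves of modules\<close>

text \<open>
  In everything below \<open>X\<close> is a closed subset of projective space, viewed as a reduced
  subvariety; it will be either projective space itself or a line.

  A section of \<open>O\<^sub>X(d)\<close> over an open \<open>V\<close> is a function on the cone over \<open>V\<close> that is locally a
  quotient of forms whose degrees differ by \<open>d\<close>; as a total function it vanishes off the cone.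
  For \<open>d = 0\<close> these are the regular functions on \<open>V\<close>.
\<close>

definition regular :: "('k::field ^ 'n::finite) set set \<Rightarrow> int \<Rightarrow> ('k ^ 'n) set set \<Rightarrow> ('k ^ 'n \<Rightarrow> 'k) set"
  where
  "regular X d V = {f. (\<forall>v. v \<notin> punctured_cone V \<longrightarrow> f v = 0) \<and>
     (\<forall>p\<in>V. \<exists>W a b g h. openin (zar X) W \<and> p \<in> W \<and> W \<subseteq> V \<and>
        form a g \<and> form b h \<and> int a - int b = d \<and>
        (\<forall>v\<in>punctured_cone W. h v \<noteq> 0 \<and> f v = g v / h v))}"

definition struct_ring :: "('k::field ^ 'n::finite) set set \<Rightarrow> ('k ^ 'n) set set \<Rightarrow> ('k ^ 'n \<Rightarrow> 'k) ring"
  where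
  "struct_ring X V = \<lparr>carrier = regular X 0 V, mult = (\<lambda>f g v. f v * g v),
     one = (\<lambda>v. if v \<in> punctured_cone V then 1 else 0), zero = (\<lambda>v. 0), add = (\<lambda>f g v. f v + g v)\<rparr>"

text \<open>
  The \<open>mult\<close> and \<open>one\<close> fields of the library's module records play no role and are set to
  \<^const>\<open>undefined\<close>.  The second field is restriction, \<open>res F U W\<close> going from \<open>F(U)\<close> to \<open>F(W)\<close>.
\<close>

record ('k, 'n, 'a) omodule =
  sec :: "('k ^ 'n) set set \<Rightarrow> ('k ^ 'n \<Rightarrow> 'k, 'a) module"
  res :: "('k ^ 'n) set set \<Rightarrow> ('k ^ 'n) set set \<Rightarrow> 'a \<Rightarrow> 'a"

type_synonym ('k, 'n, 'a, 'b) homs = "('k ^ 'n) set set \<Rightarrow> 'a \<Rightarrow> 'b"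

definition sheaf_of_modules ::
  "('k::field ^ 'n::finite) set set \<Rightarrow> ('k, 'n, 'a) omodule \<Rightarrow> bool" where
  "sheaf_of_modules X F \<longleftrightarrow>
     (\<forall>U. openin (zar X) U \<longrightarrow> Module.module (struct_ring X U) (sec F U)) \<and>
     (\<forall>U W. openin (zar X) U \<and> openin (zar X) W \<and> W \<subseteq> U \<longrightarrow>
        (\<forall>s\<in>carrier (sec F U). res F U W s \<in> carrier (sec F W) \<and>
           (\<forall>t\<in>carrier (sec F U).
              res F U W (s \<oplus>\<^bsub>sec F U\<^esub> t) = res F U W s \<oplus>\<^bsub>sec F W\<^esub> res F U W t) \<and>
           (\<forall>f\<in>carrier (struct_ring X U).
              res F U W (f \<odot>\<^bsub>sec F U\<^esub> s)
                = (\<lambda>v. if v \<in> punctured_cone W then f v else 0) \<odot>\<^bsub>sec F W\<^esub> res F U W s))) \<and>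
     (\<forall>U. openin (zar X) U \<longrightarrow> (\<forall>s\<in>carrier (sec F U). res F U U s = s)) \<and>
     (\<forall>U V W. openin (zar X) U \<and> openin (zar X) V \<and> openin (zar X) W \<and> W \<subseteq> V \<and> V \<subseteq> U \<longrightarrow>
        (\<forall>s\<in>carrier (sec F U). res F V W (res F U V s) = res F U W s)) \<and>
     (\<forall>C. (\<forall>W\<in>C. openin (zar X) W) \<longrightarrow>
        (\<forall>s\<in>carrier (sec F (\<Union>C)). \<forall>t\<in>carrier (sec F (\<Union>C)).
           (\<forall>W\<in>C. res F (\<Union>C) W s = res F (\<Union>C) W t) \<longrightarrow> s = t) \<and>
        (\<forall>u. (\<forall>W\<in>C. u W \<in> carrier (sec F W)) \<and>
             (\<forall>W\<in>C. \<forall>W'\<in>C. res F W (W \<inter> W') (u W) = res F W' (W \<inter> W') (u W')) \<longrightarrow>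
           (\<exists>s\<in>carrier (sec F (\<Union>C)). \<forall>W\<in>C. res F (\<Union>C) W s = u W)))"

definition twist :: "('k::field ^ 'n::finite) set set \<Rightarrow> int \<Rightarrow> ('k, 'n, 'k ^ 'n \<Rightarrow> 'k) omodule" where
  "twist X d = \<lparr>
     sec = (\<lambda>V. \<lparr>carrier = regular X d V, mult = undefined, one = undefined,
        zero = (\<lambda>v. 0), add = (\<lambda>f g v. f v + g v), smult = (\<lambda>f g v. f v * g v)\<rparr>),
     res = (\<lambda>U W f v. if v \<in> punctured_cone W then f v else 0)\<rparr>"

abbreviation struct_sheaf :: "('k::field ^ 'n::finite) set set \<Rightarrow> ('k, 'n, 'k ^ 'n \<Rightarrow> 'k) omodule" where
  "struct_sheaf X \<equiv> twist X 0"

text \<open>The direct sum of \<open>m\<close> copies of a sheaf.\<close>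

definition copies :: "nat \<Rightarrow> ('k::field, 'n::finite, 'a) omodule \<Rightarrow> ('k, 'n, nat \<Rightarrow> 'a) omodule" where
  "copies m F = \<lparr>
     sec = (\<lambda>V. \<lparr>carrier = {..<m} \<rightarrow>\<^sub>E carrier (sec F V), mult = undefined, one = undefined,
        zero = (\<lambda>i\<in>{..<m}. \<zero>\<^bsub>sec F V\<^esub>),
        add = (\<lambda>s t. \<lambda>i\<in>{..<m}. s i \<oplus>\<^bsub>sec F V\<^esub> t i),
        smult = (\<lambda>f s. \<lambda>i\<in>{..<m}. f \<odot>\<^bsub>sec F V\<^esub> s i)\<rparr>),
     res = (\<lambda>U W s. \<lambda>i\<in>{..<m}. res F U W (s i))\<rparr>"


section \<open>Morphisms\<close>

text \<open>Morphisms \<open>F|\<^sub>U \<rightarrow> G|\<^sub>U\<close> of sheaves of modules over an open subset \<open>U\<close> of \<open>X\<close>.\<close>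

definition sheaf_hom :: "('k::field ^ 'n::finite) set set \<Rightarrow> ('k ^ 'n) set set \<Rightarrow>
    ('k, 'n, 'a) omodule \<Rightarrow> ('k, 'n, 'b) omodule \<Rightarrow> ('k, 'n, 'a, 'b) homs \<Rightarrow> bool" where
  "sheaf_hom X U F G \<eta> \<longleftrightarrow>
     (\<forall>W. openin (zar X) W \<and> W \<subseteq> U \<longrightarrow>
        (\<forall>s\<in>carrier (sec F W). \<eta> W s \<in> carrier (sec G W) \<and>
           (\<forall>t\<in>carrier (sec F W). \<eta> W (s \<oplus>\<^bsub>sec F W\<^esub> t) = \<eta> W s \<oplus>\<^bsub>sec G W\<^esub> \<eta> W t) \<and>
           (\<forall>f\<in>carrier (struct_ring X W). \<eta> W (f \<odot>\<^bsub>sec F W\<^esub> s) = f \<odot>\<^bsub>sec G W\<^esub> \<eta> W s) \<and>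
           (\<forall>W'. openin (zar X) W' \<and> W' \<subseteq> W \<longrightarrow>
              \<eta> W' (res F W W' s) = res G W W' (\<eta> W s))))"

definition sheaf_iso :: "('k::field ^ 'n::finite) set set \<Rightarrow> ('k ^ 'n) set set \<Rightarrow>
    ('k, 'n, 'a) omodule \<Rightarrow> ('k, 'n, 'b) omodule \<Rightarrow> ('k, 'n, 'a, 'b) homs \<Rightarrow> bool" where
  "sheaf_iso X U F G \<eta> \<longleftrightarrow> sheaf_hom X U F G \<eta> \<and>
     (\<forall>W. openin (zar X) W \<and> W \<subseteq> U \<longrightarrow>
        bij_betw (\<eta> W) (carrier (sec F W)) (carrier (sec G W)))"

definition sheaf_ker ::
  "('k::field, 'n::finite, 'a) omodule \<Rightarrow> ('k, 'n, 'b) omodule \<Rightarrow> ('k, 'n, 'a, 'b) homs \<Rightarrow>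
    ('k ^ 'n) set set \<Rightarrow> 'a set" where
  "sheaf_ker F G \<eta> W = {s \<in> carrier (sec F W). \<eta> W s = \<zero>\<^bsub>sec G W\<^esub>}"

definition sheaf_im :: "('k::field ^ 'n::finite) set set \<Rightarrow>
    ('k, 'n, 'a) omodule \<Rightarrow> ('k, 'n, 'b) omodule \<Rightarrow> ('k, 'n, 'a, 'b) homs \<Rightarrow>
    ('k ^ 'n) set set \<Rightarrow> 'b set" where
  "sheaf_im X F G \<eta> W = {t \<in> carrier (sec G W).
     \<forall>p\<in>W. \<exists>W'. openin (zar X) W' \<and> p \<in> W' \<and> W' \<subseteq> W \<and>
        (\<exists>s\<in>carrier (sec F W'). \<eta> W' s = res G W W' t)}"

definition sheaf_injective :: "('k::field ^ 'n::finite) set set \<Rightarrow> ('k ^ 'n) set set \<Rightarrow>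
    ('k, 'n, 'a) omodule \<Rightarrow> ('k, 'n, 'a, 'b) homs \<Rightarrow> bool" where
  "sheaf_injective X U F \<eta> \<longleftrightarrow>
     (\<forall>W. openin (zar X) W \<and> W \<subseteq> U \<longrightarrow> inj_on (\<eta> W) (carrier (sec F W)))"

definition sheaf_surjective :: "('k::field ^ 'n::finite) set set \<Rightarrow> ('k ^ 'n) set set \<Rightarrow>
    ('k, 'n, 'a) omodule \<Rightarrow> ('k, 'n, 'b) omodule \<Rightarrow> ('k, 'n, 'a, 'b) homs \<Rightarrow> bool" where
  "sheaf_surjective X U F G \<eta> \<longleftrightarrow>
     (\<forall>W. openin (zar X) W \<and> W \<subseteq> U \<longrightarrow> sheaf_im X F G \<eta> W = carrier (sec G W))"

text \<open>Local finite presentation, which is coherence since the varieties are Noetherian.\<close>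

definition coherent :: "('k::field ^ 'n::finite) set set \<Rightarrow> ('k, 'n, 'a) omodule \<Rightarrow> bool" where
  "coherent X F \<longleftrightarrow> sheaf_of_modules X F \<and>
     (\<forall>p\<in>X. \<exists>U m k \<rho> \<pi>. openin (zar X) U \<and> p \<in> U \<and>
        sheaf_hom X U (copies m (struct_sheaf X)) (copies k (struct_sheaf X)) \<rho> \<and>
        sheaf_hom X U (copies k (struct_sheaf X)) F \<pi> \<and>
        sheaf_surjective X U (copies k (struct_sheaf X)) F \<pi> \<and>
        (\<forall>W. openin (zar X) W \<and> W \<subseteq> U \<longrightarrow>
           sheaf_ker (copies k (struct_sheaf X)) F \<pi> W
             = sheaf_im X (copies m (struct_sheaf X)) (copies k (struct_sheaf X)) \<rho> W))"

definition locally_free :: "('k::field ^ 'n::finite) set set \<Rightarrow> ('k, 'n, 'a) omodule \<Rightarrow> bool" where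
  "locally_free X F \<longleftrightarrow>
     (\<forall>p\<in>X. \<exists>U m \<eta>. openin (zar X) U \<and> p \<in> U \<and> sheaf_iso X U F (copies m (struct_sheaf X)) \<eta>)"


section \<open>Quotients, cohomology of complexes, and restriction to a subvariety\<close>

text \<open>
  Let \<open>F\<close> be a sheaf of modules on \<open>X\<close>, \<open>N\<close> a presheaf of submodules, and \<open>Y \<subseteq> X\<close> closed.
  \<open>germ X F N p U s\<close> is the germ at \<open>p\<close> of \<open>s \<in> F(U)\<close> modulo \<open>N\<close>, that is, an element of
  \<open>F\<^sub>p/N\<^sub>p\<close>, represented as the class of all pairs (neighbourhood, section) defining it.
  \<open>germ_sheaf X F N Y\<close> is the sheaf on \<open>Y\<close> with stalks \<open>F\<^sub>p/N\<^sub>p\<close>: its sections over \<open>V\<close> are the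
  families of such germs, indexed by the points of \<open>V\<close>, that locally come from sections of \<open>F\<close>.
  For \<open>Y = X\<close> this is the quotient sheaf \<open>F/N\<close>; in general it is the inverse image of \<open>F/N\<close>
  under the inclusion of \<open>Y\<close>, provided \<open>N\<close> contains all products of functions vanishing
  on \<open>Y\<close> with sections of \<open>F\<close>, so that scalars from \<open>O\<^sub>Y\<close> (lifted locally to \<open>O\<^sub>X\<close>) act.
\<close>

definition germ :: "('k::field ^ 'n::finite) set set \<Rightarrow> ('k, 'n, 'a) omodule \<Rightarrow>
    (('k ^ 'n) set set \<Rightarrow> 'a set) \<Rightarrow> ('k ^ 'n) set \<Rightarrow> ('k ^ 'n) set set \<Rightarrow> 'a \<Rightarrow>
    (('k ^ 'n) set set \<times> 'a) set" where
  "germ X F N p U s = {(U', s'). openin (zar X) U' \<and> p \<in> U' \<and> s' \<in> carrier (sec F U') \<and>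
     (\<exists>W. openin (zar X) W \<and> p \<in> W \<and> W \<subseteq> U \<inter> U' \<and>
        res F U W s \<ominus>\<^bsub>sec F W\<^esub> res F U' W s' \<in> N W)}"

definition germ_sheaf :: "('k::field ^ 'n::finite) set set \<Rightarrow> ('k, 'n, 'a) omodule \<Rightarrow>
    (('k ^ 'n) set set \<Rightarrow> 'a set) \<Rightarrow> ('k ^ 'n) set set \<Rightarrow>
    ('k, 'n, ('k ^ 'n) set \<Rightarrow> (('k ^ 'n) set set \<times> 'a) set) omodule" where
  "germ_sheaf X F N Y = \<lparr>
     sec = (\<lambda>V. \<lparr>
       carrier = {\<sigma> \<in> extensional V. \<forall>p\<in>V. \<exists>U s. openin (zar X) U \<and> p \<in> U \<and>
          s \<in> carrier (sec F U) \<and> (\<forall>q\<in>U \<inter> V. \<sigma> q = germ X F N q U s)},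
       mult = undefined, one = undefined,
       zero = (\<lambda>p\<in>V. germ X F N p X \<zero>\<^bsub>sec F X\<^esub>),
       add = (\<lambda>\<sigma> \<tau>. \<lambda>p\<in>V. \<Union>{germ X F N p U (s \<oplus>\<^bsub>sec F U\<^esub> t) | U s t.
          (U, s) \<in> \<sigma> p \<and> (U, t) \<in> \<tau> p}),
       smult = (\<lambda>g \<sigma>. \<lambda>p\<in>V. \<Union>{germ X F N p U (f \<odot>\<^bsub>sec F U\<^esub> s) | U f s.
          (U, s) \<in> \<sigma> p \<and> f \<in> carrier (struct_ring X U) \<and> (\<forall>v\<in>punctured_cone (U \<inter> V). f v = g v)})\<rparr>),
     res = (\<lambda>V V' \<sigma>. restrict \<sigma> V')\<rparr>"

definition subsheaf ::
  "('k::field, 'n::finite, 'a) omodule \<Rightarrow> (('k ^ 'n) set set \<Rightarrow> 'a set) \<Rightarrow> ('k, 'n, 'a) omodule" where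
  "subsheaf F S = \<lparr>sec = (\<lambda>W. (sec F W)\<lparr>carrier := S W\<rparr>), res = res F\<rparr>"

text \<open>\<open>ker b / im a\<close> for \<open>a : F \<rightarrow> G\<close> and \<open>b : G \<rightarrow> H\<close>.\<close>

definition cohomology :: "('k::field ^ 'n::finite) set set \<Rightarrow>
    ('k, 'n, 'a) omodule \<Rightarrow> ('k, 'n, 'b) omodule \<Rightarrow> ('k, 'n, 'c) omodule \<Rightarrow>
    ('k, 'n, 'a, 'b) homs \<Rightarrow> ('k, 'n, 'b, 'c) homs \<Rightarrow>
    ('k, 'n, ('k ^ 'n) set \<Rightarrow> (('k ^ 'n) set set \<times> 'b) set) omodule" where
  "cohomology X F G H a b = germ_sheaf X (subsheaf G (sheaf_ker G H b)) (sheaf_im X F G a) X"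

text \<open>\<open>I\<^sub>Y F\<close>, where \<open>I\<^sub>Y\<close> is the ideal sheaf of \<open>Y\<close>.\<close>

definition ideal_mult :: "('k::field ^ 'n::finite) set set \<Rightarrow> ('k, 'n, 'a) omodule \<Rightarrow>
    ('k ^ 'n) set set \<Rightarrow> ('k ^ 'n) set set \<Rightarrow> 'a set" where
  "ideal_mult X F Y W = {\<Oplus>\<^bsub>sec F W\<^esub>i\<in>{..<m}. f i \<odot>\<^bsub>sec F W\<^esub> s i | (m::nat) f s.
     (\<forall>i<m. f i \<in> carrier (struct_ring X W) \<and> (\<forall>v\<in>punctured_cone (W \<inter> Y). f i v = 0) \<and>
            s i \<in> carrier (sec F W))}"

text \<open>
  The restriction \<open>F|\<^sub>Y\<close>, i.e. the pullback \<open>i\<^sup>*F\<close> along the inclusion \<open>i\<close> of \<open>Y\<close> in \<open>X\<close>; its stalks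
  are \<open>F\<^sub>p \<otimes> O\<^sub>Y\<^sub>,\<^sub>p = F\<^sub>p / I\<^sub>Y\<^sub>,\<^sub>p F\<^sub>p\<close>.  The second definition is the canonical map
  \<open>F(U) \<rightarrow> F|\<^sub>Y(U \<inter> Y)\<close>.
\<close>

definition restrict_sheaf :: "('k::field ^ 'n::finite) set set \<Rightarrow> ('k, 'n, 'a) omodule \<Rightarrow>
    ('k ^ 'n) set set \<Rightarrow> ('k, 'n, ('k ^ 'n) set \<Rightarrow> (('k ^ 'n) set set \<times> 'a) set) omodule" where
  "restrict_sheaf X F Y = germ_sheaf X F (ideal_mult X F Y) Y"

definition restrict_section :: "('k::field ^ 'n::finite) set set \<Rightarrow> ('k, 'n, 'a) omodule \<Rightarrow>
    ('k ^ 'n) set set \<Rightarrow> ('k ^ 'n) set set \<Rightarrow> 'a \<Rightarrow> ('k ^ 'n) set \<Rightarrow> (('k ^ 'n) set set \<times> 'a) set"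
  where
  "restrict_section X F Y U s = (\<lambda>p\<in>U \<inter> Y. germ X F (ideal_mult X F Y) p U s)"


section \<open>The dual sheaf\<close>

definition hom_ext :: "('k::field ^ 'n::finite) set set \<Rightarrow> ('k ^ 'n) set set \<Rightarrow>
    ('k, 'n, 'a) omodule \<Rightarrow> ('k, 'n, 'a, 'b) homs \<Rightarrow> ('k, 'n, 'a, 'b) homs" where
  "hom_ext X U F \<eta> = (\<lambda>W s. if openin (zar X) W \<and> W \<subseteq> U \<and> s \<in> carrier (sec F W)
     then \<eta> W s else undefined)"

text \<open>
  \<open>F\<^sup>\<or> = Hom(F, O\<^sub>X)\<close>.  A section over \<open>U\<close> is a morphism \<open>F|\<^sub>U \<rightarrow> O\<^sub>U\<close>, normalised by
  \<^const>\<open>hom_ext\<close> to be \<^const>\<open>undefined\<close> outside its domain so that equality is equality of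
  morphisms.
\<close>

definition dual :: "('k::field ^ 'n::finite) set set \<Rightarrow> ('k, 'n, 'a) omodule \<Rightarrow>
    ('k, 'n, ('k, 'n, 'a, 'k ^ 'n \<Rightarrow> 'k) homs) omodule" where
  "dual X F = \<lparr>
     sec = (\<lambda>U. \<lparr>
       carrier = {\<eta>. sheaf_hom X U F (struct_sheaf X) \<eta> \<and> hom_ext X U F \<eta> = \<eta>},
       mult = undefined, one = undefined,
       zero = hom_ext X U F (\<lambda>W s v. 0),
       add = (\<lambda>\<eta> \<theta>. hom_ext X U F (\<lambda>W s v. \<eta> W s v + \<theta> W s v)),
       smult = (\<lambda>f \<eta>. hom_ext X U F (\<lambda>W s v. f v * \<eta> W s v))\<rparr>),
     res = (\<lambda>U U' \<eta>. hom_ext X U' F \<eta>)\<rparr>"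

text \<open>The transpose \<open>G\<^sup>\<or> \<rightarrow> F\<^sup>\<or>\<close> of \<open>\<psi> : F \<rightarrow> G\<close>, and the canonical morphism \<open>F \<rightarrow> F\<^sup>\<or>\<^sup>\<or>\<close>.\<close>

definition transpose_hom :: "('k::field ^ 'n::finite) set set \<Rightarrow> ('k, 'n, 'a) omodule \<Rightarrow>
    ('k, 'n, 'a, 'b) homs \<Rightarrow>
    ('k, 'n, ('k, 'n, 'b, 'k ^ 'n \<Rightarrow> 'k) homs, ('k, 'n, 'a, 'k ^ 'n \<Rightarrow> 'k) homs) homs" where
  "transpose_hom X F \<psi> = (\<lambda>U \<theta>. hom_ext X U F (\<lambda>W s. \<theta> W (\<psi> W s)))"

definition bidual_map :: "('k::field ^ 'n::finite) set set \<Rightarrow> ('k, 'n, 'a) omodule \<Rightarrow>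
    ('k, 'n, 'a, ('k, 'n, ('k, 'n, 'a, 'k ^ 'n \<Rightarrow> 'k) homs, 'k ^ 'n \<Rightarrow> 'k) homs) homs" where
  "bidual_map X F = (\<lambda>U s. hom_ext X U (dual X F) (\<lambda>W \<theta>. \<theta> W (res F U W s)))"


section \<open>Instanton sheaves and orthogonal instanton bundles\<close>

text \<open>
  From here on the base is the whole projective space on the index type \<^typ>\<open>'n\<close>.
\<close>

definition monad :: "nat \<Rightarrow> nat \<Rightarrow>
    ('k::field, 'n::finite, nat \<Rightarrow> 'k ^ 'n \<Rightarrow> 'k, nat \<Rightarrow> 'k ^ 'n \<Rightarrow> 'k) homs \<Rightarrow>
    ('k, 'n, nat \<Rightarrow> 'k ^ 'n \<Rightarrow> 'k, nat \<Rightarrow> 'k ^ 'n \<Rightarrow> 'k) homs \<Rightarrow> bool" where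
  "monad r c a b \<longleftrightarrow>
     (let X = proj_space; A = copies c (twist X (-1));
          B = copies (r + 2 * c) (struct_sheaf X); C = copies c (twist X 1)
      in sheaf_hom X X A B a \<and> sheaf_hom X X B C b \<and>
         (\<forall>W. openin (zar X) W \<longrightarrow>
            (\<forall>s\<in>carrier (sec A W). b W (a W s) = \<zero>\<^bsub>sec C W\<^esub>)) \<and>
         sheaf_injective X X A a \<and> sheaf_surjective X X B C b)"

definition instanton_sheaf :: "nat \<Rightarrow> nat \<Rightarrow> ('k::field, 'n::finite, 'a) omodule \<Rightarrow> bool" where
  "instanton_sheaf r c E \<longleftrightarrow> c > 0 \<and> coherent proj_space E \<and>
     (\<exists>a b \<eta>. monad r c a b \<and>
        sheaf_iso proj_space proj_space E
          (cohomology proj_space (copies c (twist proj_space (-1)))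
             (copies (r + 2 * c) (struct_sheaf proj_space)) (copies c (twist proj_space 1)) a b) \<eta>)"

definition instanton_bundle :: "nat \<Rightarrow> nat \<Rightarrow> ('k::field, 'n::finite, 'a) omodule \<Rightarrow> bool" where
  "instanton_bundle r c E \<longleftrightarrow> instanton_sheaf r c E \<and> locally_free proj_space E"

definition framing :: "nat \<Rightarrow> ('k::field, 'n::finite, 'a) omodule \<Rightarrow> ('k ^ 'n) set set \<Rightarrow>
    ('k, 'n, ('k ^ 'n) set \<Rightarrow> (('k ^ 'n) set set \<times> 'a) set, nat \<Rightarrow> 'k ^ 'n \<Rightarrow> 'k) homs \<Rightarrow> bool" where
  "framing r E l \<Phi> \<longleftrightarrow> l \<in> lines \<and>
     sheaf_iso l l (restrict_sheaf proj_space E l) (copies r (struct_sheaf l)) \<Phi>"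

definition trivial_splitting_type :: "nat \<Rightarrow> ('k::field, 'n::finite, 'a) omodule \<Rightarrow> bool" where
  "trivial_splitting_type r E \<longleftrightarrow> (\<exists>l \<Phi>. framing r E l \<Phi>)"

definition orthogonal_instanton_bundle :: "nat \<Rightarrow> nat \<Rightarrow> ('k::field, 'n::finite, 'a) omodule \<Rightarrow>
    ('k, 'n, 'a, ('k, 'n, 'a, 'k ^ 'n \<Rightarrow> 'k) homs) homs \<Rightarrow> bool" where
  "orthogonal_instanton_bundle r c E \<phi> \<longleftrightarrow> instanton_bundle r c E \<and>
     sheaf_iso proj_space proj_space E (dual proj_space E) \<phi> \<and>
     (\<forall>U. openin (zar proj_space) U \<longrightarrow> (\<forall>s\<in>carrier (sec E U).
        transpose_hom proj_space E \<phi> U (bidual_map proj_space E U s) = \<phi> U s))"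

text \<open>
  The last condition says that the framing \<open>\<Phi>\<close> carries \<open>\<phi>|\<^sub>l\<close> to a constant linear isomorphism
  \<open>K\<^sup>r \<rightarrow> (K\<^sup>r)\<^sup>\<or>\<close> with matrix \<open>S\<close>, i.e. \<open>\<langle>\<phi> s, t\<rangle>|\<^sub>l = \<langle>S \<Phi>(s|\<^sub>l), \<Phi>(t|\<^sub>l)\<rangle>\<close>; this determines
  \<open>\<phi>|\<^sub>l\<close> because \<open>E|\<^sub>l\<close> is generated by restrictions of local sections of \<open>E\<close>.
\<close>

definition framed_orthogonal_instanton_bundle :: "nat \<Rightarrow> nat \<Rightarrow>
    ('k::field, 'n::finite, 'a) omodule \<Rightarrow>
    ('k, 'n, 'a, ('k, 'n, 'a, 'k ^ 'n \<Rightarrow> 'k) homs) homs \<Rightarrow> ('k ^ 'n) set set \<Rightarrow>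
    ('k, 'n, ('k ^ 'n) set \<Rightarrow> (('k ^ 'n) set set \<times> 'a) set, nat \<Rightarrow> 'k ^ 'n \<Rightarrow> 'k) homs \<Rightarrow> bool" where
  "framed_orthogonal_instanton_bundle r c E \<phi> l \<Phi> \<longleftrightarrow>
     orthogonal_instanton_bundle r c E \<phi> \<and> framing r E l \<Phi> \<and>
     (\<exists>S T :: nat \<Rightarrow> nat \<Rightarrow> 'k.
        (\<forall>i<r. \<forall>j<r. (\<Sum>k<r. S i k * T k j) = (if i = j then 1 else 0) \<and>
                     (\<Sum>k<r. T i k * S k j) = (if i = j then 1 else 0)) \<and>
        (\<forall>U. openin (zar proj_space) U \<longrightarrow>
           (\<forall>s\<in>carrier (sec E U). \<forall>t\<in>carrier (sec E U). \<forall>v\<in>punctured_cone (U \<inter> l).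
              \<phi> U s U t v = (\<Sum>i<r. \<Sum>j<r. S i j *
                 \<Phi> (U \<inter> l) (restrict_section proj_space E l U s) i v *
                 \<Phi> (U \<inter> l) (restrict_section proj_space E l U t) j v))))"

text \<open>
  Isomorphisms of orthogonal bundles are required to respect the forms: \<open>g\<^sup>\<or> \<circ> \<phi>' \<circ> g = \<phi>\<close>.
\<close>

definition orthogonal_iso_rel ::
  "((('k::field, 'n::finite, 'a) omodule \<times> ('k, 'n, 'a, ('k, 'n, 'a, 'k ^ 'n \<Rightarrow> 'k) homs) homs) \<times>
    (('k, 'n, 'a) omodule \<times> ('k, 'n, 'a, ('k, 'n, 'a, 'k ^ 'n \<Rightarrow> 'k) homs) homs)) set" where
  "orthogonal_iso_rel = {((E, \<phi>), (E', \<phi>')).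
     \<exists>g. sheaf_iso proj_space proj_space E E' g \<and>
       (\<forall>U. openin (zar proj_space) U \<longrightarrow> (\<forall>s\<in>carrier (sec E U).
          transpose_hom proj_space E g U (\<phi>' U (g U s)) = \<phi> U s))}"

text \<open>
  The set \<open>M\<^sup>o(r, c)\<close> of isomorphism classes.  As sets of HOL live in a type, the classes are
  formed among sheaves with sections in a type \<^typ>\<open>'a\<close>; statements are meant for all \<^typ>\<open>'a\<close>.
\<close>

definition orthogonal_moduli :: "nat \<Rightarrow> nat \<Rightarrow>
    (('k::field, 'n::finite, 'a) omodule \<times>
      ('k, 'n, 'a, ('k, 'n, 'a, 'k ^ 'n \<Rightarrow> 'k) homs) homs) set set" where
  "orthogonal_moduli r c =
     (let S = {(E, \<phi>). orthogonal_instanton_bundle r c E \<phi> \<and> trivial_splitting_type r E}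
      in S // (orthogonal_iso_rel \<inter> S \<times> S))"

end

theory Submission
  imports Defs
begin

text \<open>
  The monad is a pair of matrices \<open>A\<close>, \<open>B\<close> of linear forms, the fibre of \<open>E\<close> at \<open>v\<close> is
  \<open>ker B v / im A v\<close>, and \<open>\<phi>\<close> is a symmetric form \<open>q v\<close> on \<open>ker B v\<close> with radical \<open>im A v\<close>.  A vector
  lying in \<open>ker B v\<close> and \<open>ker B w\<close> lies in \<open>ker B x\<close> for all \<open>x\<close> on the line through \<open>v\<close> and \<open>w\<close>, and \<open>q\<close>
  is constant along this line because global regular functions on a line are constant.

  If \<open>B v A w\<close> were singular for all \<open>v\<close>, \<open>w\<close>, the cubic determinant of a pencil of \<open>3 \<times> 3\<close> matrices
  would have no root.  So there is a line on which \<open>E\<close> is trivial with fibre \<open>U = ker B v1 \<inter> ker B v2\<close>,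
  and relative to it the monad is given by ADHM data: \<open>2 \<times> 2\<close> matrices with \<open>I J = R P - P R\<close>.
  Carrying \<open>U\<close> to a point \<open>(x, y)\<close> along the horizontal and along the vertical line through it, one
  finds that \<open>1 + J (y + R)\<^sup>-\<^sup>1 (x + P)\<^sup>-\<^sup>1 I\<close> preserves a nondegenerate quadratic form in two variables.  In
  an isotropic basis it is diagonal with entries \<open>\<chi>\<close>, \<open>1 / \<chi>\<close>; the denominators separate the variables,
  so \<open>\<chi>\<close> does too, and its value \<open>1\<close> at infinity makes it constant.  Hence \<open>J I = J P I = J R I = 0\<close>, which
  produces a common eigenvector of \<open>P\<close> and \<open>R\<close> killed by \<open>J\<close> or \<open>I\<close>, a point where \<open>A\<close> is not injective
  or \<open>B\<close> is not surjective.
\<close>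

section \<open>Orthogonal ADHM data\<close>

text \<open>The definitions speak of sheaf maps, germs and a dual sheaf, the contradiction of
  matrices, and two gaps between them need an argument. Injectivity of \<open>a\<close> as a sheaf
  map gives injectivity of \<open>A v\<close> only for generic \<open>v\<close>. At every point it
  follows from local freeness: if \<open>A\<close> lost rank at a point, the fibre dimension of
  \<open>E\<close> would jump there. Also, \<open>q v\<close> has to be defined on vectors, while
  \<open>\<phi>\<close> pairs sections of a quotient sheaf. A vector of \<open>ker B v\<close> is
  therefore extended to a local section of the kernel by a projection whose entries are quotients of
  quadratic forms, and the value of the pairing at \<open>v\<close> is shown to depend only on the
  values of the sections at \<open>v\<close> modulo \<open>im A v\<close>. In the matrix argument
  the inverses of \<open>x + P\<close> and \<open>y + R\<close> are replaced by adjugates. For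
  charge 2 these are again linear in \<open>x\<close> and \<open>y\<close>. Multiplied by
  \<open>det (x + P) * det (y + R)\<close>, the deviation of the transport from the identity has
  degree at most one in each variable, while the factor itself has degree two in each; comparison of
  coefficients rests on this gap.\<close>

lemma det_zero_kernel:
  fixes M :: "'k::field^'n^'n"
  assumes "det M = 0"
  shows "\<exists>u. u \<noteq> 0 \<and> M *v u = 0"
  using assms matrix_left_invertible_ker[of M] invertible_det_nz[of M] invertible_left_inverse[of M]
  by blast

text \<open>If \<open>N\<close> is invertible, the determinant of \<open>M + X N\<close> is a cubic
  polynomial in \<open>X\<close> with leading coefficient \<open>det N\<close>, so it has a
  root.\<close>

lemma exists_singular_combination:
  fixes M N :: "'k::alg_closed_field^3^3"
  shows "\<exists>s t. (s \<noteq> 0 \<or> t \<noteq> 0) \<and> det (\<chi> i j. s * M$i$j + t * N$i$j) = 0"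
proof (cases "det N = 0")
  case True
  then show ?thesis by (intro exI[of _ 0] exI[of _ 1]) simp
next
  case False
  define D where "D = det (\<chi> i j. [:M$i$j, N$i$j:])"
  have "coeff D 3 = det N"
    unfolding D_def det_3 by (simp add: numeral_3_eq_3 mult_ac)
  then have "degree D > 0"
    using False coeff_eq_0[of D 3] by (cases "degree D = 0") auto
  then obtain t where "poly D t = 0"
    using alg_closed_imp_poly_has_root by blast
  moreover have "det (\<chi> i j. M$i$j + t * N$i$j) = poly D t"
    unfolding D_def det_3
    by (simp only: vec_lambda_beta poly_add poly_diff poly_mult poly_pCons poly_0 mult_zero_right add_0_right)
  ultimately show ?thesis by (intro exI[of _ 1] exI[of _ t]) simp
qed

lemma eigenvector_exists:
  fixes P :: "'k::alg_closed_field^2^2"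
  shows "\<exists>l u. u \<noteq> 0 \<and> P *v u = l *s u"
proof -
  let ?p = "[:P$1$1 * P$2$2 - P$1$2 * P$2$1, - (P$1$1 + P$2$2), 1:]"
  have "degree ?p > 0" by simp
  then obtain x where x: "poly ?p x = 0" using alg_closed_imp_poly_has_root by blast
  have "det (P - mat x) = 0"
    using x by (simp add: det_2 mat_def algebra_simps)
  then obtain u where u: "u \<noteq> 0" "(P - mat x) *v u = 0" using det_zero_kernel by blast
  have "mat x *v u = x *s u"
    by (simp add: vec_eq_iff matrix_vector_mult_def mat_def if_distrib if_distribR sum.delta cong: if_cong)
  then have "P *v u = x *s u" using u(2) by (simp add: matrix_vector_mult_diff_rdistrib)
  then show ?thesis using u by blast
qed

lemma two_dim_multiple:
  fixes x w :: "'k::field^2"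
  assumes "w \<noteq> 0" "w$1 * x$2 = w$2 * x$1"
  shows "\<exists>c. x = c *s w"
proof (cases "w$1 = 0")
  case True
  then have "w$2 \<noteq> 0" using assms(1) by (auto simp: vec_eq_iff forall_2)
  then show ?thesis using assms True
    by (intro exI[of _ "x$2 / w$2"]) (auto simp: vec_eq_iff forall_2)
next
  case False
  have "x$2 = x$1 / w$1 * w$2"
    using False assms(2) by (simp add: nonzero_eq_divide_eq mult.commute)
  then show ?thesis using False
    by (intro exI[of _ "x$1 / w$1"]) (simp add: vec_eq_iff forall_2)
qed

text \<open>By Cramer's rule each entry of \<open>J\<close> times the determinant of
  \<open>w\<close> and \<open>x\<close> is a combination of the equations \<open>J *v w = 0\<close>
  and \<open>J *v x = 0\<close>; as \<open>J\<close> is nonzero, this determinant vanishes.\<close>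

lemma kernel_line:
  fixes J :: "'k::field^2^2"
  assumes "J \<noteq> 0" "w \<noteq> 0" "J *v w = 0" "J *v x = 0"
  shows "\<exists>c. x = c *s w"
proof (rule two_dim_multiple[OF assms(2)])
  obtain i k where ik: "J$i$k \<noteq> 0" using assms(1) by (auto simp: vec_eq_iff)
  have "(J *v w)$i = 0" "(J *v x)$i = 0" using assms(3,4) by auto
  then have *: "J$i$1 * w$1 + J$i$2 * w$2 = 0" "J$i$1 * x$1 + J$i$2 * x$2 = 0"
    by (simp_all add: matrix_vector_mult_def sum_2)
  have "J$i$1 * (w$1 * x$2 - w$2 * x$1)
      = x$2 * (J$i$1 * w$1 + J$i$2 * w$2) - w$2 * (J$i$1 * x$1 + J$i$2 * x$2)"
    "J$i$2 * (w$1 * x$2 - w$2 * x$1)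
      = w$1 * (J$i$1 * x$1 + J$i$2 * x$2) - x$1 * (J$i$1 * w$1 + J$i$2 * w$2)"
    by (simp_all add: algebra_simps)
  then show "w$1 * x$2 = w$2 * x$1" using ik exhaust_2[of k] by (auto simp: *)
qed

text \<open>If \<open>P\<close> is scalar, any eigenvector of \<open>R\<close> works. Otherwise an
  eigenspace of \<open>P\<close> is a line, and \<open>R\<close> preserves it because it commutes
  with \<open>P\<close>.\<close>

lemma common_eigenvector:
  fixes P R :: "'k::alg_closed_field^2^2"
  assumes "P ** R = R ** P"
  shows "\<exists>u l m. u \<noteq> 0 \<and> P *v u = l *s u \<and> R *v u = m *s u"
proof -
  obtain l u where u: "u \<noteq> 0" "P *v u = l *s u" using eigenvector_exists by blast
  have lu: "(P - mat l) *v x = P *v x - l *s x" for x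
    by (simp add: matrix_vector_mult_diff_rdistrib)
      (simp add: vec_eq_iff matrix_vector_mult_def mat_def if_distrib if_distribR sum.delta cong: if_cong)
  show ?thesis
  proof (cases "P = mat l")
    case True
    obtain m w where "w \<noteq> 0" "R *v w = m *s w" using eigenvector_exists by blast
    moreover have "P *v w = l *s w" using lu[of w] True by simp
    ultimately show ?thesis by blast
  next
    case False
    have "P *v (R *v u) = R *v (P *v u)" using assms by (simp add: matrix_vector_mul_assoc)
    also have "\<dots> = l *s (R *v u)" using u by (simp add: vec.scale)
    finally have "(P - mat l) *v (R *v u) = 0" "(P - mat l) *v u = 0" using lu u by simp_all
    then obtain m where "R *v u = m *s u" using kernel_line[of "P - mat l" u "R *v u"] False u by auto
    then show ?thesis using u by blast
  qed
qed

text \<open>Convention for polynomials in two variables: the outer variable is \<open>y\<close>,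
  evaluated at the constant polynomial \<open>[:y:]\<close>, and the inner one is \<open>x\<close>.
  The infinitely many constants would all be roots of a nonzero \<open>F\<close>.\<close>

lemma poly_poly_all_0:
  fixes F :: "'k::{field_char_0} poly poly"
  assumes "\<And>x y. poly (poly F [:y:]) x = 0"
  shows "F = 0"
proof (rule ccontr)
  assume "F \<noteq> 0"
  have "poly F [:y:] = 0" for y using assms by (simp add: poly_all_0_iff_0[symmetric])
  then have "range (\<lambda>y. [:y:]) \<subseteq> {p. poly F p = 0}" by auto
  moreover have "infinite (range (\<lambda>y::'k. [:y:]))"
    using infinite_UNIV_char_0 by (auto dest!: finite_imageD simp: inj_on_def)
  ultimately show False using poly_roots_finite[OF \<open>F \<noteq> 0\<close>] finite_subset by blast
qed

text \<open>
  A bidegree count: \<open>S (A + B) = - A B\<close> forces \<open>A + B\<close> to be a constant \<open>s\<close>, and then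
  \<open>A (A - s) = s S\<close> forces \<open>s = 0\<close>.
\<close>

lemma factors_of_square_trivial:
  fixes a b c d a' b' c' d' p0 p1 r0 r1 :: "'k::field_char_0"
  defines "S \<equiv> [:Polynomial.smult r0 [:p0, p1, 1:], Polynomial.smult r1 [:p0, p1, 1:], [:p0, p1, 1:]:]"
    and "A \<equiv> [:[:d, b:], [:c, a:]:]" and "B \<equiv> [:[:d', b':], [:c', a':]:]"
  assumes "(S + A) * (S + B) = S * S"
  shows "a = 0 \<and> b = 0 \<and> c = 0 \<and> a' = 0 \<and> b' = 0 \<and> c' = 0"
proof -
  have "S * (A + B) + A * B = 0" using assms(4) by (simp add: algebra_simps)
  \<comment> \<open>\<open>e i j\<close> is the coefficient of \<open>y^i * x^j\<close>. The
    bidegrees (3,3), (2,3) and (3,2) lie above that of \<open>A * B\<close> and give the three sign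
    relations.\<close>
  then have e: "Polynomial.coeff (Polynomial.coeff (S * (A + B) + A * B) i) j = 0" for i j by simp
  have a': "a' = - a" using e[of 3 3] by (simp add: S_def A_def B_def numeral_eq_Suc add_eq_0_iff)
  have b': "b' = - b" using e[of 2 3] by (simp add: S_def A_def B_def numeral_eq_Suc add_eq_0_iff a')
  have c': "c' = - c" using e[of 3 2] by (simp add: S_def A_def B_def numeral_eq_Suc add_eq_0_iff a')
  let ?s = "d + d'"
  have 1: "?s = a * a" using e[of 2 2] 
    by (simp add: S_def A_def B_def numeral_eq_Suc a' b' c')
  have eqs: "a = 0 \<or> p1 * a = 2 * c" "a = 0 \<or> r1 * a = 2 * b"
      "p0 * (a * a) = c * c" "r0 * (a * a) = b * b"
      "r1 * p1 * (a * a) + (a * d' - d * a - 2 * (b * c)) = 0" "r0 * p0 * (a * a) + d * d' = 0"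
    using e[of 2 1] e[of 1 2] e[of 2 0] e[of 0 2] e[of 1 1] e[of 0 0] 1
    by (simp_all add: S_def A_def B_def numeral_eq_Suc a' b' c')
  have "a = 0"
  proof (rule ccontr)
    assume "a \<noteq> 0"
    \<comment> \<open>The product \<open>b * c\<close> is computed in two ways, from the mixed
      coefficient and from the squares \<open>b * b\<close> and \<open>c * c\<close>. Comparison
      gives \<open>(d + d') * (d + d') = 0\<close>, against \<open>d + d' = a * a\<close>.\<close>
    have "r1 * p1 * (a * a) = (p1 * a) * (r1 * a)" by simp
    also have "\<dots> = 4 * (b * c)" using eqs(1,2) \<open>a \<noteq> 0\<close> by simp
    finally have bc: "2 * (b * c) = a * (d - d')" using eqs(5) by (simp add: algebra_simps)
    have "4 * ((b * b) * (c * c)) = (2 * (b * c)) * (2 * (b * c))" by simp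
    then have "4 * ((b * b) * (c * c)) = (a * (d - d')) * (a * (d - d'))" by (simp only: bc)
    moreover have "(b * b) * (c * c) = (a * a) * (r0 * p0 * (a * a))"
      using eqs(3,4) by (metis mult.assoc mult.commute)
    moreover have "r0 * p0 * (a * a) = - (d * d')" using eqs(6) by (simp add: add_eq_0_iff)
    ultimately have "(a * (d - d')) * (a * (d - d')) = - (4 * ((a * a) * (d * d')))" by simp
    moreover have "(a * a) * ((d + d') * (d + d'))
        = (a * (d - d')) * (a * (d - d')) + 4 * ((a * a) * (d * d'))" by (simp add: algebra_simps)
    ultimately have "(a * a) * ((d + d') * (d + d')) = 0" by simp
    then show False using \<open>a \<noteq> 0\<close> 1 by simp
  qed
  then show ?thesis using eqs a' b' c' by auto
qed

section \<open>Transport of the quadratic form in ADHM coordinates\<close>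

definition adj2 :: "'k::comm_ring_1^2^2 \<Rightarrow> 'k^2^2" where
  "adj2 M = vector [vector [M$2$2, - M$1$2], vector [- M$2$1, M$1$1]]"

lemma adj2_mult_vec: "M *v (adj2 M *v z) = det M *s z"
  by (simp add: vec_eq_iff forall_2 matrix_vector_mult_def sum_2 adj2_def det_2 algebra_simps)

text \<open>For \<open>2 x 2\<close> matrices the adjugate is linear, so the adjugate of
  \<open>x + P\<close> is \<open>x + adj2 P\<close>; the scalar is
  \<open>det (x + P)\<close>.\<close>

lemma adj2_shift: "x *s (x *s z + adj2 P *v z) + P *v (x *s z + adj2 P *v z)
    = (x * x + (P$1$1 + P$2$2) * x + det P) *s z"
  by (simp add: vec_eq_iff forall_2 matrix_vector_mult_def sum_2 adj2_def det_2 algebra_simps)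

lemma matrix_2_eqI:
  fixes M N :: "'k^2^2"
  assumes "M$1$1 = N$1$1" "M$1$2 = N$1$2" "M$2$1 = N$2$1" "M$2$2 = N$2$2"
  shows "M = N"
  using assms by (simp add: vec_eq_iff forall_2)

text \<open>The hypothesis says that \<open>1 + J (y + R)^-1 (x + P)^-1 I\<close> preserves the form
  \<open>n$1 * n$2\<close>. It is phrased by solutions \<open>z\<close>, \<open>w\<close> of linear
  equations, so it makes sense where the inverses do not exist, and after clearing denominators it
  becomes a polynomial identity in \<open>x\<close> and \<open>y\<close>.\<close>

lemma isometric_transport_trivial:
  fixes P R I J :: "'k::field_char_0^2^2"
  assumes iso: "\<And>x y n z w. x *s z + P *v z = I *v n \<Longrightarrow> y *s w + R *v w = z \<Longrightarrow>
    (n + J *v w)$1 * (n + J *v w)$2 = n$1 * n$2"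
  shows "J ** I = 0" "J ** P ** I = 0" "J ** R ** I = 0"
proof -
  define \<pi> where "\<pi> = [:det P, P$1$1 + P$2$2, 1:]"
  define \<rho>1 where "\<rho>1 = R$1$1 + R$2$2"
  \<comment> \<open>\<open>S\<close> is \<open>det (x + P) * det (y + R)\<close>. The matrix
    \<open>G\<close> below is \<open>J adj(y + R) adj(x + P) I\<close>, expanded as
    \<open>D + B x + C y + A x y\<close>.\<close>
  define S where "S = [:Polynomial.smult (det R) \<pi>, Polynomial.smult \<rho>1 \<pi>, \<pi>:]"
  define D where "D = J ** adj2 R ** adj2 P ** I"
  define B where "B = J ** adj2 R ** I"
  define C where "C = J ** adj2 P ** I"
  define A where "A = J ** I"
  define G where "G k l = [:[:D$k$l, B$k$l:], [:C$k$l, A$k$l:]:]" for k l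
  \<comment> \<open>The hypothesis is applied to \<open>s *s n\<close>: with this right-hand side
    the adjugates solve both equations for all \<open>x\<close> and \<open>y\<close>.\<close>
  have ev: "(s *s n + J *v w)$1 * (s *s n + J *v w)$2 = s * s * (n$1 * n$2)"
    if s: "s = poly (poly S [:y:]) x" 
      and w: "w = y *s (x *s (I *v n) + adj2 P *v (I *v n)) + adj2 R *v (x *s (I *v n) + adj2 P *v (I *v n))"
    for s x y n w
  proof -
    let ?r = "y * y + \<rho>1 * y + det R" and ?p = "x * x + (P$1$1 + P$2$2) * x + det P"
    let ?z = "x *s (I *v n) + adj2 P *v (I *v n)"
    have sr: "s = ?r * ?p" unfolding s S_def \<pi>_def by (simp add: algebra_simps)
    have "y *s w + R *v w = ?r *s ?z" unfolding w \<rho>1_def by (rule adj2_shift)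
    moreover have "x *s (r *s z) + P *v (r *s z) = r *s (x *s z + P *v z)" for r z
      by (simp only: vec.scale) (simp add: vec_eq_iff algebra_simps)
    then have "x *s (?r *s ?z) + P *v (?r *s ?z) = ?r *s (?p *s (I *v n))"
      by (simp only: adj2_shift)
    then have "x *s (?r *s ?z) + P *v (?r *s ?z) = I *v (s *s n)"
      by (simp only: sr vec.scale vector_smult_assoc)
    ultimately have "(s *s n + J *v w)$1 * (s *s n + J *v w)$2 = (s *s n)$1 * (s *s n)$2"
      by (intro iso[where z="?r *s ?z"])
    then show ?thesis by (simp add: algebra_simps)
  qed
  have Jw: "(J *v (y *s (x *s (I *v n) + adj2 P *v (I *v n)) + adj2 R *v (x *s (I *v n) + adj2 P *v (I *v n))))$k
     = poly (poly (G k 1) [:y:]) x * n$1 + poly (poly (G k 2) [:y:]) x * n$2" for x y n k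
  proof -
    have "J *v (y *s (x *s (I *v n) + adj2 P *v (I *v n)) + adj2 R *v (x *s (I *v n) + adj2 P *v (I *v n)))
      = (x * y) *s (A *v n) + y *s (C *v n) + x *s (B *v n) + D *v n"
      unfolding A_def B_def C_def D_def
      by (simp add: matrix_vector_mul_assoc[symmetric] matrix_vector_right_distrib vec.scale
        vector_add_ldistrib vector_smult_assoc algebra_simps)
    then show ?thesis unfolding G_def by (simp add: matrix_vector_mult_def sum_2 algebra_simps)
  qed
  note ev' = ev[OF refl refl, unfolded vector_add_component vector_smult_component Jw]
  \<comment> \<open>Basis vectors are isotropic, hence so are their images. As
    \<open>S + G k k\<close> has coefficient 1 at \<open>y^2 * x^2\<close>, it is nonzero, and the
    off-diagonal entries of \<open>G\<close> must vanish.\<close>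
  have e1: "(S + G 1 1) * G 2 1 = 0" 
  proof (rule poly_poly_all_0)
    fix x y show "poly (poly ((S + G 1 1) * G 2 1) [:y:]) x = 0"
      using ev'[of y x "vector [1, 0]"] by simp
  qed
  have e2: "G 1 2 * (S + G 2 2) = 0" 
  proof (rule poly_poly_all_0)
    fix x y show "poly (poly (G 1 2 * (S + G 2 2)) [:y:]) x = 0"
      using ev'[of y x "vector [0, 1]"] by simp
  qed
  have nz: "S + G k k \<noteq> 0" for k
  proof
    assume "S + G k k = 0"
    then have "Polynomial.coeff (Polynomial.coeff (S + G k k) 2) 2 = 0" by simp
    then show False by (simp add: S_def G_def \<pi>_def numeral_eq_Suc)
  qed
  have g: "G 2 1 = 0" "G 1 2 = 0" using e1 e2 nz by auto
  have "(S + G 1 1) * (S + G 2 2) - S * S = 0"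
  proof (rule poly_poly_all_0)
    fix x y show "poly (poly ((S + G 1 1) * (S + G 2 2) - S * S) [:y:]) x = 0"
      using ev'[of y x "vector [1, 1]"] by (simp add: g)
  qed
  then have "(S + G 1 1) * (S + G 2 2) = S * S" by simp
  from factors_of_square_trivial[OF this[unfolded S_def \<pi>_def G_def]]
  have 0: "A = 0" "B = 0" "C = 0"
    using g by (simp_all add: G_def vec_eq_iff forall_2)
  then show JI: "J ** I = 0" by (simp add: A_def)
  have adj: "J ** M ** I = 0" if "J ** adj2 M ** I = 0" for M
  proof -
    \<comment> \<open>\<open>M + adj2 M\<close> is the scalar matrix of the trace of
      \<open>M\<close>.\<close>
    have "J ** M ** I = (\<chi> k l. (M$1$1 + M$2$2) * (J ** I)$k$l) - J ** adj2 M ** I"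
      by (rule matrix_2_eqI) (simp_all add: matrix_matrix_mult_def sum_2 adj2_def algebra_simps)
    then show ?thesis using that JI by (simp add: vec_eq_iff)
  qed
  show "J ** P ** I = 0" "J ** R ** I = 0" using 0 adj by (simp_all add: B_def C_def)
qed

text \<open>If \<open>J\<close> or \<open>I\<close> is zero, \<open>comm\<close> makes
  \<open>P\<close> and \<open>R\<close> commute, and a common eigenvector, of the transposes when
  \<open>I\<close> is zero, contradicts \<open>costab\<close> or \<open>stab\<close>. Otherwise the
  kernel of \<open>J\<close> is a line spanned by some \<open>I *v e\<close>. It also contains the
  images of this vector under \<open>P\<close> and \<open>R\<close>, so the vector is a common
  eigenvector killed by \<open>J\<close>.\<close>

lemma no_orthogonal_adhm:
  fixes P R I J :: "'k::{alg_closed_field,field_char_0}^2^2"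
  assumes comm: "I ** J = R ** P - P ** R"
    and costab: "\<And>u l m. u \<noteq> 0 \<Longrightarrow> P *v u = l *s u \<Longrightarrow> R *v u = m *s u \<Longrightarrow> J *v u \<noteq> 0"
    and stab: "\<And>u l m. u \<noteq> 0 \<Longrightarrow> u v* P = l *s u \<Longrightarrow> u v* R = m *s u \<Longrightarrow> u v* I \<noteq> 0"
    and iso: "\<And>x y n z w. x *s z + P *v z = I *v n \<Longrightarrow> y *s w + R *v w = z \<Longrightarrow>
      (n + J *v w)$1 * (n + J *v w)$2 = n$1 * n$2"
  shows False
proof -
  note triv = isometric_transport_trivial[of P I R J]
  have J0: "J ** I = 0" "J ** P ** I = 0" "J ** R ** I = 0"
    using triv iso by blast+
  have "J \<noteq> 0"
  proof
    assume "J = 0"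
    then have "P ** R = R ** P" using comm by simp
    from common_eigenvector[OF this] show False using costab \<open>J = 0\<close> by fastforce
  qed
  have "I \<noteq> 0"
  proof
    assume "I = 0"
    then have "P ** R = R ** P" using comm by simp
    then have "transpose P ** transpose R = transpose R ** transpose P"
      by (metis matrix_transpose_mul)
    from common_eigenvector[OF this] obtain u l m
      where "u \<noteq> 0" "u v* P = l *s u" "u v* R = m *s u" by auto
    then show False using stab[of u l m] \<open>I = 0\<close> by (simp add: vector_matrix_mult_def zero_vec_def)
  qed
  then obtain e where e: "I *v e \<noteq> 0"
    by (metis matrix_eq matrix_vector_mult_0)
  have "J *v (I *v e) = 0" "J *v (P *v (I *v e)) = 0" "J *v (R *v (I *v e)) = 0"
    using J0 by (simp_all add: matrix_vector_mul_assoc matrix_mul_assoc)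
  then obtain l m where "P *v (I *v e) = l *s (I *v e)" "R *v (I *v e) = m *s (I *v e)"
    using kernel_line[OF \<open>J \<noteq> 0\<close> e] by metis
  then show False using costab[OF e] \<open>J *v (I *v e) = 0\<close> by blast
qed

text \<open>Let \<open>X\<close> be a nonzero element with right kernel \<open>k\<close> and left
  kernel \<open>e\<close>. If neither alternative holds, some \<open>W\<close> has
  \<open>W k\<close> and \<open>e W\<close> both nonzero. Vanishing of the determinant on
  \<open>X + W\<close> then forces \<open>e W k = 0\<close>, and since \<open>W\<close> has rank one
  this gives \<open>e W = 0\<close>.\<close>

lemma singular_space_2x2:
  fixes H :: "('k::field^2^2) set"
  assumes add: "\<And>X Y. X \<in> H \<Longrightarrow> Y \<in> H \<Longrightarrow> X + Y \<in> H"
    and sing: "\<And>X. X \<in> H \<Longrightarrow> det X = 0"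
  shows "(\<exists>u. u \<noteq> 0 \<and> (\<forall>X\<in>H. X *v u = 0)) \<or> (\<exists>u. u \<noteq> 0 \<and> (\<forall>X\<in>H. u v* X = 0))"
proof (cases "\<forall>X\<in>H. X = 0")
  case True
  have "(vector [1, 0] :: 'k^2) \<noteq> 0" by (simp add: vec_eq_iff forall_2)
  then show ?thesis using True by (intro disjI1 exI[of _ "vector [1, 0]"]) auto
next
  case False
  then obtain X where X: "X \<in> H" "X \<noteq> 0" by blast
  obtain k where k: "k \<noteq> 0" "X *v k = 0" using det_zero_kernel sing X by blast
  obtain e where e: "e \<noteq> 0" "e v* X = 0"
    using det_zero_kernel[of "transpose X"] sing[OF X(1)] by auto
  show ?thesis
  proof (rule ccontr)
    assume "\<not> ?thesis"
    then obtain Y Z where Y: "Y \<in> H" "Y *v k \<noteq> 0" and Z: "Z \<in> H" "e v* Z \<noteq> 0"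
      using k e by blast
    \<comment> \<open>One of \<open>Y\<close>, \<open>Z\<close> and \<open>Y + Z\<close>
      serves.\<close>
    obtain W where W: "W \<in> H" "W *v k \<noteq> 0" "e v* W \<noteq> 0"
    proof (cases "e v* Y = 0 \<and> Z *v k = 0")
      case True
      moreover have "e v* (Y + Z) = e v* Y + e v* Z"
        by (simp add: vector_matrix_mult_def vec_eq_iff sum_2 algebra_simps)
      ultimately have "(Y + Z) *v k \<noteq> 0" "e v* (Y + Z) \<noteq> 0"
        using Y Z by (simp_all add: matrix_vector_mult_add_rdistrib)
      then show ?thesis using that add[OF Y(1) Z(1)] by blast
    qed (use Y Z that in blast)
    have dX: "X$1$1 * X$2$2 = X$1$2 * X$2$1" using sing[OF X(1)] by (simp add: det_2)
    have dW: "W$1$1 * W$2$2 = W$1$2 * W$2$1" using sing[OF W(1)] by (simp add: det_2)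
    \<comment> \<open>The polarised determinant of \<open>X\<close> and \<open>W\<close>
      vanishes.\<close>
    have dXW: "X$1$1 * W$2$2 + W$1$1 * X$2$2 = X$1$2 * W$2$1 + W$1$2 * X$2$1"
      using sing[OF add[OF X(1) W(1)]] dX dW by (simp add: det_2 algebra_simps)
    have kX: "X$i$1 * k$1 + X$i$2 * k$2 = 0" for i
      using k(2) by (simp add: vec_eq_iff matrix_vector_mult_def sum_2)
    have eX: "e$1 * X$1$i + e$2 * X$2$i = 0" for i
      using e(2) by (simp add: vec_eq_iff vector_matrix_mult_def sum_2 mult.commute)
    have "\<exists>c. k = c *s vector [X$i$2, - X$i$1]" if "X$i \<noteq> 0" for i
      using that kX[of i] 
      by (intro two_dim_multiple) (auto simp: vec_eq_iff forall_2 algebra_simps eq_neg_iff_add_eq_0)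
    moreover obtain i where i: "X$i \<noteq> 0" using X(2) by (auto simp: vec_eq_iff)
    ultimately obtain c where c: "k = c *s vector [X$i$2, - X$i$1]" by blast
    have "\<exists>c. e = c *s vector [X$2$j, - X$1$j]" if "X$1$j \<noteq> 0 \<or> X$2$j \<noteq> 0" for j
      using that eX[of j] 
      by (intro two_dim_multiple) (auto simp: vec_eq_iff forall_2 algebra_simps eq_neg_iff_add_eq_0)
    moreover obtain j where j: "X$1$j \<noteq> 0 \<or> X$2$j \<noteq> 0"
      using X(2) by (auto simp: vec_eq_iff forall_2)
    ultimately obtain d where d: "e = d *s vector [X$2$j, - X$1$j]" by blast
    \<comment> \<open>The matrix with entries \<open>k$p * e$q\<close> is a multiple of the adjugate
      of \<open>X\<close>, and pairing \<open>W\<close> with that adjugate gives the polarised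
      determinant.\<close>
    have "e$1 * (W$1$1 * k$1 + W$1$2 * k$2) + e$2 * (W$2$1 * k$1 + W$2$2 * k$2)
      = c * d * (X$2$j * X$i$2 * W$1$1 - X$2$j * X$i$1 * W$1$2 - X$1$j * X$i$2 * W$2$1 + X$1$j * X$i$1 * W$2$2)"
      by (simp add: c d algebra_simps)
    also have "\<dots> = c * d * X$i$j * (X$1$1 * W$2$2 + W$1$1 * X$2$2 - (X$1$2 * W$2$1 + W$1$2 * X$2$1))"
      using exhaust_2[of i] exhaust_2[of j] dX by (auto simp: algebra_simps)
    also have "\<dots> = 0" by (simp only: dXW) simp
    finally have eWk: "e$1 * (W *v k)$1 + e$2 * (W *v k)$2 = 0"
      by (simp add: matrix_vector_mult_def sum_2)
    have rk: "(W *v k)$1 * W$2$l = (W *v k)$2 * W$1$l" for l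
      using dW exhaust_2[of l] by (auto simp: matrix_vector_mult_def sum_2 algebra_simps)
    \<comment> \<open>Each column of \<open>W\<close> is a multiple of \<open>W *v k\<close>, on
      which \<open>e\<close> vanishes.\<close>
    have "(e v* W)$l = 0" for l
    proof -
      obtain m where m: "(\<chi> i. W$i$l) = m *s (W *v k)"
        using two_dim_multiple[OF W(2), of "\<chi> i. W$i$l"] rk by auto
      then have "W$1$l = m * (W *v k)$1" "W$2$l = m * (W *v k)$2"
        by (simp_all add: vec_eq_iff)
      then have "(e v* W)$l = m * (e$1 * (W *v k)$1 + e$2 * (W *v k)$2)"
        by (simp add: vector_matrix_mult_def sum_2 algebra_simps)
      then show ?thesis using eWk by simp
    qed
    then have "e v* W = 0" by (intro iffD2[OF vec_eq_iff]) (simp only: zero_index, blast)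
    then show False using W(3) by blast
  qed
qed

lemma vec_dim_range:
  fixes M :: "'k::field^'n^'m"
  assumes "\<And>u. M *v u = 0 \<Longrightarrow> u = 0"
  shows "vec.dim (range ((*v) M)) = CARD('n)"
proof -
  have "inj ((*v) M)"
  proof (rule injI)
    fix x y assume "M *v x = M *v y"
    then have "M *v (x - y) = 0" by (simp add: matrix_vector_mult_diff_distrib)
    then show "x = y" using assms by force
  qed
  then show ?thesis by (subst vec.dim_image_eq) (auto simp: vec_dim_card card_cart_basis)
qed

section \<open>Monads of linear matrices on the plane\<close>

text \<open>The sizes are \<open>c = 2\<close> and \<open>r + 2 * c = 6\<close>.
  \<open>A_inj\<close> is injectivity on every fibre, which is stronger than injectivity of a map of
  sheaves.\<close>

locale linear_monad =
  fixes A :: "'k::field^3 \<Rightarrow> 'k^2^6" and B :: "'k^3 \<Rightarrow> 'k^6^2"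
  assumes A_add: "A (v + w) *v u = A v *v u + A w *v u"
    and A_scale: "A (c *s v) *v u = c *s (A v *v u)"
    and B_add: "B (v + w) *v n = B v *v n + B w *v n"
    and B_scale: "B (c *s v) *v n = c *s (B v *v n)"
    and BA: "B v *v (A v *v u) = 0"
    and B_surj: "v \<noteq> 0 \<Longrightarrow> \<exists>n. B v *v n = y"
    and A_inj: "v \<noteq> 0 \<Longrightarrow> A v *v u = 0 \<Longrightarrow> u = 0"
begin

text \<open>Polarisation of \<open>BA\<close>. It makes \<open>B v *v (A w *v u)\<close> alternating
  in \<open>v\<close> and \<open>w\<close>, so that it depends only on their exterior
  product.\<close>

lemma BA_swap: "B v *v (A w *v u) = - (B w *v (A v *v u))"
proof -
  have "0 = B (v + w) *v (A (v + w) *v u)" by (simp add: BA)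
  also have "\<dots> = B v *v (A w *v u) + B w *v (A v *v u)"
    by (simp add: A_add B_add matrix_vector_right_distrib BA)
  finally show ?thesis by (simp add: eq_neg_iff_add_eq_0)
qed

text \<open>The vectors \<open>A w *v u\<close> fill a three-dimensional space that every
  \<open>B v\<close> kills. Hence \<open>B v\<close> lives on a three-dimensional quotient, where
  its two rows give a pencil of \<open>3 x 3\<close> matrices in the coordinates of
  \<open>v\<close>. A singular member of the pencil is a functional \<open>(s, t)\<close> that
  vanishes on the image of some \<open>B v\<close>, against surjectivity.\<close>

lemma no_common_kernel:
  fixes u :: "'k^2"
  assumes "u \<noteq> 0" and ker: "\<And>v w. B v *v (A w *v u) = 0"
    and ac: "\<And>M N :: 'k^3^3. \<exists>s t. (s \<noteq> 0 \<or> t \<noteq> 0) \<and> det (\<chi> i j. s * M$i$j + t * N$i$j) = 0"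
  shows False
proof -
  define T where "T = matrix (\<lambda>w. A w *v u)"
  have T: "T *v w = A w *v u" for w
    unfolding T_def
    by (rule matrix_works) (unfold_locales, simp_all add: A_add A_scale)
  have "T *v w = 0 \<Longrightarrow> w = 0" for w using A_inj \<open>u \<noteq> 0\<close> T by metis
  then have dT: "vec.dim (range ((*v) T)) = 3" by (simp add: vec_dim_range)
  obtain b where b: "b \<subseteq> range ((*v) T)" "vec.independent b" "card b = 3"
    using vec.basis_exists[of "range ((*v) T)"] dT by metis
  let ?b = "vec.extend_basis b"
  have e: "vec.independent ?b" "vec.span ?b = UNIV" "b \<subseteq> ?b"
    using vec.independent_extend_basis[OF b(2)] vec.span_extend_basis[OF b(2)]
      vec.extend_basis_superset[OF b(2)] by simp_all
  have "finite ?b" using e(1) vec.independent_bound_general by blast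
  moreover have "card ?b = 6"
    using vec.indep_card_eq_dim_span[OF e(1)] e(2) by (simp add: card_cart_basis)
  ultimately have "card (?b - b) = 3" using e(3) b(3) by (simp add: card_Diff_subset finite_subset)
  then obtain f1 f2 f3 where f: "?b - b = {f1, f2, f3}" by (auto simp: card_3_iff)
  define f where "f = (\<lambda>i::3. if i = 1 then f1 else if i = 2 then f2 else f3)"
  \<comment> \<open>Row \<open>i\<close> runs over the complementary basis vectors and column
    \<open>j\<close> over the coordinates of \<open>v\<close>. Thus \<open>s * M 1 + t * M 2\<close>
    applied to \<open>v\<close> lists the values of \<open>(s, t)\<close> on the vectors
    \<open>B v *v f i\<close>.\<close>
  define M where "M r = (\<chi> i j. (B (axis j 1) *v f i) $ r)" for r :: 2
  obtain s t where st: "s \<noteq> 0 \<or> t \<noteq> 0" "det (\<chi> i j. s * M 1$i$j + t * M 2$i$j) = 0"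
    using ac by blast
  then obtain v where v: "v \<noteq> 0" "(\<chi> i j. s * M 1$i$j + t * M 2$i$j) *v v = 0"
    using det_zero_kernel by blast
  have Bv: "B v *v n = (\<Sum>j\<in>UNIV. v$j *s (B (axis j 1) *v n))" for n
  proof -
    have "v = v$1 *s axis 1 1 + v$2 *s axis 2 1 + v$3 *s axis 3 1"
      by (simp add: vec_eq_iff forall_3 axis_def)
    then have "B v *v n = B (v$1 *s axis 1 1 + v$2 *s axis 2 1 + v$3 *s axis 3 1) *v n" by simp
    then show ?thesis by (simp add: B_add B_scale sum_3)
  qed
  have "s * (B v *v f i)$1 + t * (B v *v f i)$2 = 0" for i
  proof -
    have "((\<chi> i j. s * M 1$i$j + t * M 2$i$j) *v v)$i
        = (\<Sum>j\<in>UNIV. (s * M 1$i$j + t * M 2$i$j) * v$j)"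
      by (simp add: matrix_vector_mult_def)
    then have "(\<Sum>j\<in>UNIV. (s * M 1$i$j + t * M 2$i$j) * v$j) = 0" using v by simp
    then show ?thesis by (simp add: Bv M_def sum_3 algebra_simps)
  qed
  from this[of 1] this[of 2] this[of 3]
  have ff: "s * (B v *v x)$1 + t * (B v *v x)$2 = 0" if "x \<in> ?b - b" for x
    using that unfolding f by (auto simp: f_def)
  have "B v *v x = 0" if "x \<in> b" for x using b(1) that ker T by auto
  then have bb: "s * (B v *v x)$1 + t * (B v *v x)$2 = 0" if "x \<in> ?b" for x
    using ff that by (cases "x \<in> b") auto
  let ?g = "\<lambda>x. s * (B v *v x)$1 + t * (B v *v x)$2"
  have g: "?g (x + y) = ?g x + ?g y" "?g (c *s x) = c * ?g x" for x y c
    by (simp_all add: matrix_vector_right_distrib vec.scale algebra_simps)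
  have sub: "vec.subspace {x. ?g x = 0}" (is "vec.subspace ?S")
    by (rule vec.subspaceI) (simp_all add: g)
  have "vec.span ?b \<subseteq> ?S" by (rule vec.span_minimal[OF _ sub]) (use bb in auto)
  then have all: "s * (B v *v x)$1 + t * (B v *v x)$2 = 0" for x using e(2) by auto
  obtain x y where "B v *v x = vector [1, 0]" "B v *v y = vector [0, 1]"
    using B_surj[OF v(1)] by meson
  then show False using all[of x] all[of y] st(1) by simp
qed

end

section \<open>Existence of a line on which the monad is trivial\<close>

context linear_monad begin

text \<open>With \<open>B v *v (A w *v u)\<close> read as an exterior product of \<open>v\<close>
  and \<open>w\<close>, the right-hand side is \<open>x\<close> times q with r plus \<open>y\<close>
  times r with p plus \<open>z\<close> times p with q. Division by a nonzero coefficient factors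
  it.\<close>

lemma BA_pencil:
  assumes "z \<noteq> 0"
  shows "B (p + (- (x / z)) *s r) *v (A (z *s q + (- y) *s r) *v u)
    = x *s (B q *v (A r *v u)) + y *s (B r *v (A p *v u)) + z *s (B p *v (A q *v u))"
proof -
  have "B (p + (- (x / z)) *s r) *v (A (z *s q + (- y) *s r) *v u)
    = z *s (B p *v (A q *v u)) + (- y) *s (B p *v (A r *v u)) + (- (x / z) * z) *s (B r *v (A q *v u))"
    by (simp only: A_add A_scale B_add B_scale matrix_vector_right_distrib vec.scale BA
        vector_add_ldistrib vector_smult_assoc mult_zero_right vec.scale_zero_right add_0_right) (simp add: ac_simps)
  also have "\<dots> = z *s (B p *v (A q *v u)) + (- y) *s (- (B r *v (A p *v u))) + (- x) *s (- (B q *v (A r *v u)))"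
    using assms BA_swap[of p r u] BA_swap[of r q u] by simp
  finally show ?thesis by (simp add: vec_eq_iff algebra_simps)
qed

text \<open>Every element of the second exterior power of a three-dimensional space is decomposable.\<close>

lemma BA_decomposable:
  obtains v w where "\<And>u. B v *v (A w *v u) = x *s (B (axis 2 1) *v (A (axis 3 1) *v u))
    + y *s (B (axis 3 1) *v (A (axis 1 1) *v u)) + z *s (B (axis 1 1) *v (A (axis 2 1) *v u))"
proof (cases "z \<noteq> 0 \<or> y \<noteq> 0 \<or> x \<noteq> 0")
  case True
  then show ?thesis
  proof (elim disjE)
    assume "z \<noteq> 0"
    from that[OF BA_pencil[OF this]] show ?thesis .
  next
    assume "y \<noteq> 0"
    show ?thesis by (rule that) (subst BA_pencil[OF \<open>y \<noteq> 0\<close>, of "axis 3 1" z "axis 2 1" "axis 1 1" x], simp)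
  next
    assume "x \<noteq> 0"
    show ?thesis by (rule that) (subst BA_pencil[OF \<open>x \<noteq> 0\<close>, of "axis 2 1" y "axis 1 1" "axis 3 1" z], simp)
  qed
next
  case False
  show ?thesis by (rule that[of 0 0]) (use False in \<open>simp add: BA\<close>)
qed

lemma BA_coordinates:
  "B v *v (A w *v u) = (v$2 * w$3 - v$3 * w$2) *s (B (axis 2 1) *v (A (axis 3 1) *v u))
    + (v$3 * w$1 - v$1 * w$3) *s (B (axis 3 1) *v (A (axis 1 1) *v u))
    + (v$1 * w$2 - v$2 * w$1) *s (B (axis 1 1) *v (A (axis 2 1) *v u))"
proof -
  have e: "v = v$1 *s axis 1 1 + v$2 *s axis 2 1 + v$3 *s axis 3 1" for v :: "'k^3"
    by (simp add: vec_eq_iff forall_3 axis_def)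
  have "B v *v (A w *v u) = B (v$1 *s axis 1 1 + v$2 *s axis 2 1 + v$3 *s axis 3 1) *v
      (A (w$1 *s axis 1 1 + w$2 *s axis 2 1 + w$3 *s axis 3 1) *v u)" using e by metis
  also have "\<dots> = (v$2 * w$3 - v$3 * w$2) *s (B (axis 2 1) *v (A (axis 3 1) *v u))
    + (v$3 * w$1 - v$1 * w$3) *s (B (axis 3 1) *v (A (axis 1 1) *v u))
    + (v$1 * w$2 - v$2 * w$1) *s (B (axis 1 1) *v (A (axis 2 1) *v u))"
    unfolding A_add A_scale B_add B_scale matrix_vector_right_distrib vec.scale BA
      BA_swap[of "axis 2 1" "axis 1 1"] BA_swap[of "axis 3 1" "axis 2 1"] BA_swap[of "axis 1 1" "axis 3 1"]
    by (simp add: vec_eq_iff algebra_simps)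
  finally show ?thesis .
qed

text \<open>The dual monad: transposition exchanges injectivity and surjectivity through one-sided
  inverses. It turns statements about common right kernels into statements about common left
  kernels.\<close>

lemma transposed: "linear_monad (\<lambda>v. transpose (B v)) (\<lambda>v. transpose (A v))"
proof -
  have mv: "transpose M *v u = u v* M" for M :: "'k^'n^'m" and u by simp
  have ext: "M = N" if "\<And>n. M *v n = N *v n" for M N :: "'k^'n::finite^'m::finite"
    using that matrix_eq by blast
  have sc: "mat c ** M = (\<chi> i j. c * M$i$j)" for c and M :: "'k^'n::finite^'m::finite"
    by (simp add: vec_eq_iff matrix_matrix_mult_def mat_def if_distrib if_distribR sum.delta' cong: if_cong)
  have A1: "A (v + w) = A v + A w" and B1: "B (v + w) = B v + B w" for v w
    by (rule ext, simp add: A_add B_add matrix_vector_mult_add_rdistrib)+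
  have s: "(\<chi> i j. c * M$i$j) *v n = c *s (M *v n)" for c and M :: "'k^'n::finite^'m::finite" and n
    by (simp add: vec_eq_iff matrix_vector_mult_def sum_distrib_left mult.assoc)
  have A2: "A (c *s v) = (\<chi> i j. c * A v$i$j)" and B2: "B (c *s v) = (\<chi> i j. c * B v$i$j)" for c v
    by (rule ext, simp add: A_scale B_scale s)+
  show ?thesis
  proof
    fix v w :: "'k^3" and u :: "'k^2" and n :: "'k^6" and c :: 'k and y :: "'k^2"
    have tadd: "transpose (M + N) = transpose M + transpose N" for M N :: "'k^'n::finite^'m::finite"
      by (simp add: transpose_def vec_eq_iff)
    show "transpose (B (v + w)) *v u = transpose (B v) *v u + transpose (B w) *v u"
      unfolding B1 tadd by (rule matrix_vector_mult_add_rdistrib)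
    show "transpose (A (v + w)) *v n = transpose (A v) *v n + transpose (A w) *v n"
      unfolding A1 tadd by (rule matrix_vector_mult_add_rdistrib)
    have ts: "transpose (\<chi> i j. c * M$i$j) = (\<chi> i j. c * transpose M$i$j)" for M :: "'k^'n::finite^'m::finite"
      by (simp add: transpose_def vec_eq_iff)
    show "transpose (B (c *s v)) *v u = c *s (transpose (B v) *v u)"
      unfolding B2 ts s ..
    show "transpose (A (c *s v)) *v n = c *s (transpose (A v) *v n)"
      unfolding A2 ts s ..
    have "B v ** A v = 0" by (rule ext) (simp add: BA flip: matrix_vector_mul_assoc)
    then have "transpose (A v) ** transpose (B v) = 0"
      by (simp flip: matrix_transpose_mul) (simp add: transpose_def vec_eq_iff)
    then show "transpose (A v) *v (transpose (B v) *v u) = 0"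
      by (simp only: matrix_vector_mul_assoc matrix_vector_mult_0)
    show "\<exists>n. transpose (A v) *v n = y" if "v \<noteq> 0"
    proof -
      have "\<exists>L. L ** A v = mat 1" using A_inj[OF that] matrix_left_invertible_ker[of "A v"] by blast
      then obtain L where "L ** A v = mat 1" by blast
      then have "transpose (A v) ** transpose L = mat 1"
        by (metis matrix_transpose_mul transpose_mat)
      then have "transpose (A v) *v (transpose L *v y) = y"
        by (simp only: matrix_vector_mul_assoc matrix_vector_mul_lid)
      then show ?thesis by blast
    qed
    show "u = 0" if "v \<noteq> 0" "transpose (B v) *v u = 0"
    proof -
      have "\<exists>R. B v ** R = mat 1"
        using B_surj[OF that(1)] matrix_right_invertible_surjective[of "B v"] by (metis surjI surj_def)
      then obtain R where "B v ** R = mat 1" by blast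
      then have "transpose R ** transpose (B v) = mat 1"
        by (metis matrix_transpose_mul transpose_mat)
      then have "transpose R *v (transpose (B v) *v u) = u"
        by (simp only: matrix_vector_mul_assoc matrix_vector_mul_lid)
      then show ?thesis using that by simp
    qed
  qed
qed

text \<open>By decomposability the matrices \<open>B v ** A w\<close> form a set \<open>H\<close>
  closed under addition. Were all of them singular, \<open>H\<close> would have a common right or
  left kernel vector, which \<open>no_common_kernel\<close> excludes for the monad and for its
  transpose.\<close>

lemma exists_nonjumping_line:
  assumes ac: "\<And>M N :: 'k^3^3. \<exists>s t. (s \<noteq> 0 \<or> t \<noteq> 0) \<and> det (\<chi> i j. s * M$i$j + t * N$i$j) = 0"
  obtains v w where "det (B v ** A w) \<noteq> 0"
proof (rule ccontr)
  assume "\<not> thesis"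
  then have sing: "det (B v ** A w) = 0" for v w using that by blast
  define h where "h x u = x$1 *s (B (axis 2 1) *v (A (axis 3 1) *v u))
    + x$2 *s (B (axis 3 1) *v (A (axis 1 1) *v u)) + x$3 *s (B (axis 1 1) *v (A (axis 2 1) *v u))" for x :: "'k^3" and u
  define H where "H = {X. \<exists>x. \<forall>u. X *v u = h x u}"
  have BAH: "B v ** A w \<in> H" for v w
    unfolding H_def h_def
    by (intro CollectI allI
        exI[of _ "vector [v$2 * w$3 - v$3 * w$2, v$3 * w$1 - v$1 * w$3, v$1 * w$2 - v$2 * w$1]"])
      (simp only: vector_3 matrix_vector_mul_assoc[symmetric], rule BA_coordinates)
  have HBA: "\<exists>v w. X = B v ** A w" if "X \<in> H" for X
  proof -
    obtain x where x: "\<And>u. X *v u = h x u" using \<open>X \<in> H\<close> unfolding H_def by blast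
    obtain v w where "\<And>u. B v *v (A w *v u) = h x u"
      unfolding h_def using BA_decomposable by blast
    then have "X *v u = (B v ** A w) *v u" for u by (simp add: x flip: matrix_vector_mul_assoc)
    then show ?thesis using matrix_eq by blast
  qed
  have "(\<exists>u. u \<noteq> 0 \<and> (\<forall>X\<in>H. X *v u = 0)) \<or> (\<exists>u. u \<noteq> 0 \<and> (\<forall>X\<in>H. u v* X = 0))"
  proof (rule singular_space_2x2)
    show "det X = 0" if "X \<in> H" for X using HBA[OF that] sing by auto
    fix X Y assume "X \<in> H" "Y \<in> H"
    then obtain x y where "\<And>u. X *v u = h x u" "\<And>u. Y *v u = h y u" unfolding H_def by blast
    then have "(X + Y) *v u = h (x + y) u" for u
      by (simp add: matrix_vector_mult_add_rdistrib) (simp add: h_def vec_eq_iff algebra_simps)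
    then show "X + Y \<in> H" unfolding H_def by blast
  qed
  then show False
  proof
    assume "\<exists>u. u \<noteq> 0 \<and> (\<forall>X\<in>H. X *v u = 0)"
    then obtain u where "u \<noteq> 0" "\<And>v w. B v *v (A w *v u) = 0"
      using BAH by (metis matrix_vector_mul_assoc)
    then show False using no_common_kernel ac by blast
  next
    assume "\<exists>u. u \<noteq> 0 \<and> (\<forall>X\<in>H. u v* X = 0)"
    then obtain u where u: "u \<noteq> 0" "\<And>v w. u v* (B v ** A w) = 0" using BAH by blast
    interpret t: linear_monad "\<lambda>v. transpose (B v)" "\<lambda>v. transpose (A v)" by (rule transposed)
    have "transpose (A w) *v (transpose (B v) *v u) = 0" for v w
    proof -
      have "transpose (A w) *v (transpose (B v) *v u) = transpose (B v ** A w) *v u"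
        by (simp only: matrix_vector_mul_assoc matrix_transpose_mul)
      then show ?thesis using u(2)[of v w] by simp
    qed
    then show False using t.no_common_kernel[OF u(1)] ac by blast
  qed
qed

end

section \<open>From an orthogonal monad to ADHM data\<close>

locale orthogonal_monad = linear_monad A B
  for A :: "'k::{alg_closed_field,field_char_0}^3 \<Rightarrow> 'k^2^6" and B :: "'k^3 \<Rightarrow> 'k^6^2" +
  fixes q :: "'k^3 \<Rightarrow> 'k^6 \<Rightarrow> 'k^6 \<Rightarrow> 'k"
  assumes q_add: "v \<noteq> 0 \<Longrightarrow> B v *v m = 0 \<Longrightarrow> B v *v n = 0 \<Longrightarrow> B v *v k = 0 \<Longrightarrow> q v (m + n) k = q v m k + q v n k"
    and q_scale: "v \<noteq> 0 \<Longrightarrow> B v *v m = 0 \<Longrightarrow> B v *v k = 0 \<Longrightarrow> q v (c *s m) k = c * q v m k"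
    and q_sym: "v \<noteq> 0 \<Longrightarrow> B v *v m = 0 \<Longrightarrow> B v *v n = 0 \<Longrightarrow> q v m n = q v n m"
    and q_A: "v \<noteq> 0 \<Longrightarrow> B v *v n = 0 \<Longrightarrow> q v (A v *v u) n = 0"
    and q_nondeg: "v \<noteq> 0 \<Longrightarrow> B v *v m = 0 \<Longrightarrow> (\<And>n. B v *v n = 0 \<Longrightarrow> q v m n = 0) \<Longrightarrow> m \<in> range ((*v) (A v))"
    and q_const: "v \<noteq> 0 \<Longrightarrow> w \<noteq> 0 \<Longrightarrow> B v *v m = 0 \<Longrightarrow> B w *v m = 0 \<Longrightarrow> B v *v n = 0 \<Longrightarrow> B w *v n = 0 \<Longrightarrow>
      q v m n = q w m n"
begin

lemma q_mod:
  assumes "v \<noteq> 0" "B v *v m = 0"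
  shows "q v (m + A v *v u) (m + A v *v u) = q v m m"
  using assms
  by (simp add: q_add q_A BA q_sym[of v _ "_ + _"] matrix_vector_right_distrib q_sym[of v m "A v *v u"])

lemma no_orthogonal_monad: False
proof -
  obtain v1 v2 where det: "det (B v1 ** A v2) \<noteq> 0"
    using exists_nonjumping_line exists_singular_combination by blast
  then obtain Hi where Hi: "Hi ** (B v1 ** A v2) = mat 1" "(B v1 ** A v2) ** Hi = mat 1"
    unfolding invertible_det_nz[symmetric] invertible_def by blast
  \<comment> \<open>Composition with the inverse of \<open>B v1 ** A v2\<close> normalises the
    monad: \<open>b v1\<close> inverts \<open>A v2\<close>, and \<open>b v2\<close> inverts
    \<open>A v1\<close> up to sign.\<close>
  define b where "b v n = Hi *v (B v *v n)" for v n
  have b_add: "b (v + w) n = b v n + b w n" "b v (n + m) = b v n + b v m" for v w n m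
    by (simp_all add: b_def B_add matrix_vector_right_distrib)
  have b_scale: "b (c *s v) n = c *s b v n" "b v (c *s n) = c *s b v n" for c v n
    by (simp_all add: b_def B_scale vec.scale)
  have b_diff: "b v (n - m) = b v n - b v m" for v n m
    by (simp add: b_def matrix_vector_mult_diff_distrib)
  have bA[simp]: "b v (A v *v u) = 0" for v u by (simp add: b_def BA)
  have b_swap: "b v (A w *v u) = - b w (A v *v u)" for v w u
    unfolding b_def by (subst BA_swap) (simp add: vec.neg)
  have b_0: "b v n = 0 \<longleftrightarrow> B v *v n = 0" for v n
  proof
    assume "b v n = 0"
    then have "((B v1 ** A v2) ** Hi) *v (B v *v n) = 0"
      unfolding b_def by (simp flip: matrix_vector_mul_assoc)
    then show "B v *v n = 0" using Hi by simp
  qed (simp add: b_def)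
  have b12[simp]: "b v1 (A v2 *v u) = u" for u
    using Hi(1) by (simp add: b_def matrix_vector_mul_assoc matrix_mul_assoc)
  have b21[simp]: "b v2 (A v1 *v u) = - u" for u
    using b_swap[of v2 v1 u] by simp
  have v12: "v1 \<noteq> 0" "v2 \<noteq> 0"
    using b12[of "axis 1 1"] b21[of "axis 1 1"] b_scale(1)[of 0 0] A_scale[of 0 0 "axis 1 1"]
    by (auto simp: axis_eq_0_iff b_def)
  have "vec.dim (UNIV :: ('k^3) set) = 3" by (simp add: vec_dim_card card_cart_basis)
  moreover have "vec.dim (vec.span {v1, v2}) \<le> 2"
    using vec.dim_le_card'[of "{v1, v2}"] card_insert_le_m1[of 2 "{v2}" v1]
    by (simp add: vec.dim_span)
  moreover have "\<not> 3 \<le> (2 :: nat)" by simp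
  ultimately have "vec.span {v1, v2} \<noteq> UNIV" by metis
  then obtain v3 where v3: "v3 \<notin> vec.span {v1, v2}" by blast
  \<comment> \<open>These vectors represent the points off the line through \<open>v1\<close> and
    \<open>v2\<close>, with affine coordinates \<open>(x, y)\<close>.\<close>
  have pt: "v3 + x *s v1 + y *s v2 \<noteq> 0" for x y
  proof
    assume "v3 + x *s v1 + y *s v2 = 0"
    moreover have "v3 = (- x) *s v1 + (- y) *s v2 + (v3 + x *s v1 + y *s v2)"
      by (simp add: vec_eq_iff)
    ultimately have "v3 = (- x) *s v1 + (- y) *s v2" by simp
    moreover have "(- x) *s v1 + (- y) *s v2 \<in> vec.span {v1, v2}"
      by (intro vec.span_add vec.span_scale vec.span_base) auto
    ultimately show False using v3 by simp
  qed

  define U where "U = {n. b v1 n = 0 \<and> b v2 n = 0}"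
  have UB: "B v1 *v n = 0" "B v2 *v n = 0" if "n \<in> U" for n using that by (simp_all add: U_def b_0)
  have subU: "vec.subspace U"
    by (rule vec.subspaceI) (simp_all add: U_def b_add b_scale, simp add: b_def)
  \<comment> \<open>The images of \<open>A v1\<close> and \<open>A v2\<close> have a direct sum of
    dimension four, and \<open>U\<close> is a complement of it in the six-dimensional space.\<close>
  have dimU: "vec.dim U = 2"
  proof -
    let ?R1 = "range ((*v) (A v1))" and ?R2 = "range ((*v) (A v2))"
    have d: "vec.dim ?R1 = 2" "vec.dim ?R2 = 2"
      using vec_dim_range[of "A v1"] vec_dim_range[of "A v2"] A_inj v12 by simp_all
    have s: "vec.subspace ?R1" "vec.subspace ?R2"
      by (simp_all add: vec.subspace_image)
    let ?R = "{x + y | x y. x \<in> ?R1 \<and> y \<in> ?R2}"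
    have "?R1 \<inter> ?R2 \<subseteq> {0}"
    proof
      fix x assume "x \<in> ?R1 \<inter> ?R2"
      then obtain p r where pr: "x = A v1 *v p" "x = A v2 *v r" by (metis IntE rangeE)
      have "b v1 x = 0" by (simp only: pr(1) bA)
      moreover have "b v1 x = r" by (simp only: pr(2) b12)
      ultimately have "r = 0" by simp
      then show "x \<in> {0}" using pr by simp
    qed
    then have "vec.dim (?R1 \<inter> ?R2) = 0" by (simp add: vec.dim_eq_0)
    then have dR: "vec.dim ?R = 4" using vec.dim_sums_Int[OF s] d by linarith
    have "?R \<inter> U \<subseteq> {0}"
    proof
      fix x assume "x \<in> ?R \<inter> U"
      then obtain p r where pr: "x = A v1 *v p + A v2 *v r" "b v1 x = 0" "b v2 x = 0"
        by (auto simp: U_def)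
      then have "r = 0" "p = 0" by (auto simp: b_add)
      then show "x \<in> {0}" using pr by simp
    qed
    then have dRU: "vec.dim (?R \<inter> U) = 0" by (simp add: vec.dim_eq_0)
    have "{x + y | x y. x \<in> ?R \<and> y \<in> U} = UNIV"
    proof (intro equalityI subsetI)
      fix k :: "'k^6" assume "k \<in> UNIV"
      let ?r = "A v1 *v (- b v2 k) + A v2 *v (b v1 k)"
      have "k - ?r \<in> U" by (simp add: U_def b_add b_diff)
      moreover have "?r \<in> ?R" by blast
      moreover have "k = ?r + (k - ?r)" by simp
      ultimately show "k \<in> {x + y | x y. x \<in> ?R \<and> y \<in> U}" by blast
    qed simp
    then show ?thesis
      using vec.dim_sums_Int[OF vec.subspace_sums[OF s] subU] dR dRU
      by (simp add: vec_dim_card card_cart_basis)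
  qed

  let ?Q = "q v1"
  have U_add: "m + n \<in> U" if "m \<in> U" "n \<in> U" for m n
    using subU that by (auto simp: vec.subspace_def)
  have U_scale: "c *s m \<in> U" if "m \<in> U" for m c
    using subU that by (auto simp: vec.subspace_def)
  have Q_sym: "?Q m n = ?Q n m" if "m \<in> U" "n \<in> U" for m n
    using that UB q_sym[OF v12(1)] by simp
  have Q_add: "?Q (m + n) k = ?Q m k + ?Q n k" if "m \<in> U" "n \<in> U" "k \<in> U" for m n k
    using that UB by (simp add: q_add[OF v12(1)])
  have Q_scale: "?Q (c *s m) k = c * ?Q m k" if "m \<in> U" "k \<in> U" for m k c
    using that UB by (simp add: q_scale[OF v12(1)])
  have Q_add2: "?Q k (m + n) = ?Q k m + ?Q k n" if "m \<in> U" "n \<in> U" "k \<in> U" for m n k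
    using that by (simp add: Q_sym[of k] U_add Q_add)
  have Q_scale2: "?Q k (c *s m) = c * ?Q k m" if "m \<in> U" "k \<in> U" for m k c
    using that by (simp add: Q_sym[of k] U_scale Q_scale)
  have Q_nondeg: "m = 0" if "m \<in> U" "\<And>n. n \<in> U \<Longrightarrow> ?Q m n = 0" for m
  proof -
    have "?Q m n = 0" if n: "B v1 *v n = 0" for n
    proof -
      \<comment> \<open>Since \<open>b v2 (A v1 *v u) = - u\<close>, this correction moves
        \<open>n\<close> into \<open>U\<close>, and it lies in the radical of
        \<open>?Q\<close>.\<close>
      have "n + A v1 *v (b v2 n) \<in> U" using n by (simp add: U_def b_add b_0[symmetric])
      then have "?Q (n + A v1 *v (b v2 n)) m = 0" using that Q_sym \<open>m \<in> U\<close>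
        \<open>\<And>n. n \<in> U \<Longrightarrow> ?Q m n = 0\<close> by metis
      then show ?thesis
        using q_add[OF v12(1) n, of "A v1 *v (b v2 n)" m] q_A[OF v12(1), of m] BA UB[OF \<open>m \<in> U\<close>]
          q_sym[OF v12(1) n, of m] by simp
    qed
    then obtain u where "m = A v1 *v u" using q_nondeg[OF v12(1)] UB \<open>m \<in> U\<close> by blast
    moreover have "b v2 m = 0" using \<open>m \<in> U\<close> by (simp add: U_def)
    ultimately show "m = 0" by simp
  qed

  obtain fs where fs: "fs \<subseteq> U" "vec.independent fs" "card fs = 2"
    using vec.basis_exists[of U] dimU by metis
  then obtain f1 f2 where f12: "fs = {f1, f2}" "f1 \<noteq> f2" by (auto simp: card_2_iff)
  have fU: "f1 \<in> U" "f2 \<in> U" using fs f12 by auto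
  obtain e1 where e1: "e1 \<in> U" "e1 \<noteq> 0" "?Q e1 e1 = 0"
  proof (cases "?Q f1 f1 = 0")
    case True
    moreover have "f1 \<noteq> 0" using fs f12 vec.dependent_zero by blast
    ultimately show ?thesis using that fU by blast
  next
    case False
    \<comment> \<open>The quadratic polynomial is the value of the form on
      \<open>t *s f1 + f2\<close>.\<close>
    then have "degree [:?Q f2 f2, 2 * ?Q f1 f2, ?Q f1 f1:] > 0" by simp
    then obtain t where "poly [:?Q f2 f2, 2 * ?Q f1 f2, ?Q f1 f1:] t = 0"
      using alg_closed_imp_poly_has_root by blast
    then have "?Q (t *s f1 + f2) (t *s f1 + f2) = 0"
      using fU Q_sym[of f1 f2]
      by (simp add: Q_add Q_add2 Q_scale Q_scale2 U_add U_scale algebra_simps)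
    moreover have "t *s f1 + f2 \<noteq> 0"
    proof
      assume "t *s f1 + f2 = 0"
      then have "f2 = (- t) *s f1" by (simp add: add_eq_0_iff)
      then have "f2 \<in> vec.span {f1}" by (metis vec.span_base vec.span_scale insertI1)
      moreover have "fs - {f2} = {f1}" using f12 by auto
      ultimately show False using fs(2) f12 unfolding vec.dependent_def by auto
    qed
    ultimately show ?thesis using that fU U_add U_scale by blast
  qed
  obtain g where g: "g \<in> U" "?Q e1 g \<noteq> 0" using Q_nondeg e1 by blast
  define g' where "g' = (1 / ?Q e1 g) *s g"
  have g': "g' \<in> U" "?Q e1 g' = 1" using g e1 by (simp_all add: g'_def U_scale Q_scale2)
  \<comment> \<open>This constant makes \<open>g' + c *s e1\<close> isotropic without changing its
    pairing with \<open>e1\<close>, so \<open>e1\<close>, \<open>e2\<close> become a hyperbolic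
    pair.\<close>
  define c where "c = - (?Q g' g' / 2)"
  define e2 where "e2 = g' + c *s e1"
  have e2: "e2 \<in> U" using g' e1 by (simp add: e2_def U_add U_scale)
  have e12: "?Q e1 e2 = 1" "?Q e2 e1 = 1" "?Q e2 e2 = 0"
    using g' e1 Q_sym[of g' e1]
    by (simp_all add: e2_def c_def[symmetric] Q_add Q_add2 Q_scale Q_scale2 U_add U_scale) (simp add: c_def)
  have Uexp: "n = ?Q n e2 *s e1 + ?Q n e1 *s e2" if n: "n \<in> U" for n
  proof -
    have "e2 \<notin> vec.span {e1}"
    proof
      assume "e2 \<in> vec.span {e1}"
      then obtain c where "e2 = c *s e1" by (auto simp: vec.span_singleton)
      then show False using e12 e1 by (simp add: Q_scale2)
    qed
    then have "vec.independent {e2, e1}"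
      using e1(2) by (intro vec.independent_insertI) (auto simp: vec.independent_insert vec.independent_empty)
    moreover have "e2 \<noteq> e1"
    proof
      assume "e2 = e1"
      then show False using e12(1) e1(3) by simp
    qed
    then have "card {e2, e1} = 2" by simp
    ultimately have "U \<subseteq> vec.span {e2, e1}"
      using dimU e1 e2 by (intro vec.card_ge_dim_independent) auto
    then have "n \<in> vec.span {e2, e1}" using n by blast
    then obtain c where "n - c *s e2 \<in> vec.span {e1}" by (auto simp: vec.span_insert)
    then obtain d where "n - c *s e2 = d *s e1" by (auto simp: vec.span_singleton)
    then have nn: "n = d *s e1 + c *s e2" by (simp add: algebra_simps)
    have "?Q n e2 = d" "?Q n e1 = c"
      unfolding nn using e1 e2 e12 by (simp_all add: Q_add Q_scale U_scale)
    then show ?thesis using nn by simp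
  qed

  define emb where "emb n = n$1 *s e1 + n$2 *s e2" for n :: "'k^2"
  have embU: "emb n \<in> U" for n by (simp add: emb_def e1 e2 U_add U_scale)
  have embQ: "?Q (emb n) (emb n) = 2 * (n$1 * n$2)" for n
    unfolding emb_def using e1 e2 e12
    by (simp add: Q_add Q_add2 Q_scale Q_scale2 U_add U_scale)
  \<comment> \<open>The ADHM data are the blocks of \<open>b v3\<close> and \<open>A v3\<close> for
    the decomposition into the images of \<open>A v1\<close> and \<open>A v2\<close> and the space
    \<open>U\<close>. On these three summands \<open>b v3\<close> is \<open>- R\<close>,
    \<open>P\<close> and \<open>I\<close>, and the components of \<open>A v3\<close> are
    \<open>P\<close>, \<open>R\<close> and \<open>j\<close>, where \<open>J\<close> is
    \<open>j\<close> in the basis \<open>e1\<close>, \<open>e2\<close>.\<close>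
  define P where "P = matrix (\<lambda>u. b v3 (A v2 *v u))"
  define R where "R = matrix (\<lambda>u. b v1 (A v3 *v u))"
  have P: "P *v u = b v3 (A v2 *v u)" and R: "R *v u = b v1 (A v3 *v u)" for u
    unfolding P_def R_def
    by (rule matrix_works, unfold_locales, simp_all add: b_add b_scale matrix_vector_right_distrib vec.scale)+
  have b31: "b v3 (A v1 *v u) = - (R *v u)" and b23: "b v2 (A v3 *v u) = - (P *v u)" for u
    using b_swap[of v3 v1 u] b_swap[of v2 v3 u] by (simp_all add: P R)
  define j where "j u = A v3 *v u - A v1 *v (P *v u) - A v2 *v (R *v u)" for u
  have jU: "j u \<in> U" for u
    by (simp add: j_def U_def b_diff b23 R[symmetric])
  have j_lin: "j (u + w) = j u + j w" "j (c *s u) = c *s j u" for u w c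
    by (simp_all add: j_def matrix_vector_right_distrib vec.scale vec_eq_iff algebra_simps)
  define J where "J = matrix (\<lambda>u. vector [?Q (j u) e2, ?Q (j u) e1] :: 'k^2)"
  have J: "J *v u = vector [?Q (j u) e2, ?Q (j u) e1]" for u
    unfolding J_def
    by (rule matrix_works, unfold_locales)
      (simp_all add: j_lin Q_add Q_scale jU e1 e2 vec_eq_iff forall_2)
  have embJ: "emb (J *v u) = j u" for u
    using Uexp[OF jU[of u]] by (simp add: emb_def J)
  define I where "I = matrix (\<lambda>n. b v3 (emb n))"
  have I: "I *v n = b v3 (emb n)" for n
    unfolding I_def
    by (rule matrix_works, unfold_locales)
      (simp_all add: emb_def b_add b_scale vec_eq_iff algebra_simps)

  show False
  proof (rule no_orthogonal_adhm[of I J R P])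
    show "I ** J = R ** P - P ** R"
    proof (rule iffD2[OF matrix_eq], rule allI)
      fix u
      have "(I ** J) *v u = b v3 (j u)" by (simp add: I embJ flip: matrix_vector_mul_assoc)
      also have "\<dots> = R *v (P *v u) - P *v (R *v u)"
        by (simp add: j_def b_diff b31 P)
      finally show "(I ** J) *v u = (R ** P - P ** R) *v u"
        by (simp add: matrix_vector_mult_diff_rdistrib flip: matrix_vector_mul_assoc)
    qed
  next
    fix u l m assume u: "u \<noteq> 0" "P *v u = l *s u" "R *v u = m *s u"
    show "J *v u \<noteq> 0"
    proof
      assume "J *v u = 0"
      then have "j u = 0" using embJ[of u] by (simp add: emb_def)
      \<comment> \<open>The eigenvalues are the coordinates of the point at which \<open>A\<close>
        kills \<open>u\<close>.\<close>
      then have "A (v3 + (- l) *s v1 + (- m) *s v2) *v u = 0"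
        unfolding j_def A_add A_scale u vec.scale by (simp add: vec_eq_iff algebra_simps)
      then show False using A_inj[OF pt] u(1) by blast
    qed
  next
    fix u l m assume u: "u \<noteq> 0" "u v* P = l *s u" "u v* R = m *s u"
    show "u v* I \<noteq> 0"
    proof
      assume uI: "u v* I = 0"
      define d where "d x = u$1 * x$1 + u$2 * x$2" for x :: "'k^2"
      have d_lin: "d (x + y) = d x + d y" "d (x - y) = d x - d y" "d (- x) = - d x" "d (c *s x) = c * d x" for x y c
        by (simp_all add: d_def algebra_simps)
      have dM: "d (M *v x) = (u v* M)$1 * x$1 + (u v* M)$2 * x$2" for M :: "'k^2^2" and x
        by (simp add: d_def matrix_vector_mult_def vector_matrix_mult_def sum_2 algebra_simps)
      have dP: "d (P *v x) = l * d x" and dR: "d (R *v x) = m * d x" for x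
        unfolding dM u(2,3) by (simp_all add: d_def algebra_simps)
      have dI: "d (I *v x) = 0" for x unfolding dM uI by simp
      let ?v = "v3 + (- l) *s v1 + (- m) *s v2"
      \<comment> \<open>The functional \<open>d\<close> given by \<open>u\<close> kills the image of
        \<open>b ?v\<close>. On the three summands of the decomposition this uses \<open>dR\<close>,
        \<open>dP\<close> and \<open>dI\<close>.\<close>
      have "d (b ?v k) = 0" for k
      proof -
        let ?p = "- b v2 k" and ?r = "b v1 k"
        define n where "n = k - (A v1 *v ?p + A v2 *v ?r)"
        have nU: "n \<in> U" by (simp add: n_def U_def b_add b_diff)
        have "n = emb (vector [?Q n e2, ?Q n e1])" using Uexp[OF nU] by (simp add: emb_def)
        then have "d (b v3 n) = 0" using dI I by metis
        moreover have "k = n + (A v1 *v ?p + A v2 *v ?r)" by (simp add: n_def)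
        then have "b v3 k = b v3 n + (b v3 (A v1 *v ?p) + b v3 (A v2 *v ?r))"
          by (metis b_add(2))
        ultimately have "d (b v3 k) = d (b v3 (A v1 *v ?p)) + d (b v3 (A v2 *v ?r))"
          by (simp add: d_lin)
        then have "d (b v3 k) = - (m * d ?p) + l * d ?r"
          by (simp only: b31 P[symmetric] d_lin dP dR)
        then show ?thesis unfolding b_add b_scale d_lin by simp
      qed
      moreover have "\<exists>k. b ?v k = y" for y
      proof -
        obtain k where k: "B ?v *v k = (B v1 ** A v2) *v y" using B_surj[OF pt] by blast
        have "b ?v k = Hi *v ((B v1 ** A v2) *v y)" by (simp only: b_def k)
        also have "\<dots> = y" by (simp only: matrix_vector_mul_assoc Hi(1) matrix_vector_mul_lid)
        finally show ?thesis by blast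
      qed
      ultimately have "d y = 0" for y by metis
      from this[of "vector [1, 0]"] this[of "vector [0, 1]"] show False
        using u(1) by (simp add: d_def vec_eq_iff forall_2)
    qed
  next
    fix x y n z w assume z: "x *s z + P *v z = I *v n" and w: "y *s w + R *v w = z"
    let ?v = "v3 + x *s v1 + y *s v2"
    \<comment> \<open>\<open>?n\<close> differs from \<open>emb n\<close> by an element of the image
      of \<open>A v2\<close> and lies in the kernels at \<open>v2\<close> and \<open>?v\<close>, so
      it carries \<open>emb n\<close> along that line. In the same way \<open>?m\<close> carries
      \<open>?n'\<close> along the line from \<open>v1\<close> to \<open>?v\<close>. At
      \<open>?v\<close> the two differ by \<open>A ?v *v w\<close>, which is in the radical.\<close>
    let ?n = "emb n - A v2 *v z" and ?n' = "emb (n + J *v w)"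
    let ?m = "?n' + A v1 *v (x *s w + P *v w)"
    have bn: "b ?v ?n = 0"
      using embU[of n] z
      by (simp add: b_add b_scale b_diff I[symmetric] P[symmetric] U_def b_0[symmetric])
        (simp add: algebra_simps)
    have emb_add: "?n' = emb n + j w" unfolding embJ[symmetric] by (simp add: emb_def vec_eq_iff algebra_simps)
    have m: "?m = ?n + A ?v *v w"
      unfolding emb_add j_def A_add A_scale w[symmetric] matrix_vector_right_distrib vec.scale
      by (simp add: algebra_simps)
    have "2 * (n$1 * n$2) = q v2 (emb n) (emb n)"
      using embQ q_const[OF v12, of "emb n" "emb n"] UB[OF embU[of n]] by simp
    also have "\<dots> = q v2 ?n ?n"
      using q_mod[OF v12(2), of "emb n" "- z"] UB[OF embU[of n]] by (simp add: vec.neg)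
    also have "\<dots> = q ?v ?n ?n"
      using bn UB[OF embU[of n]] v12(2) pt
      by (intro q_const) (simp_all add: b_0 matrix_vector_mult_diff_distrib BA)
    also have "\<dots> = q ?v ?m ?m"
      unfolding m using q_mod[OF pt, of x y ?n w] bn by (simp add: b_0)
    also have "\<dots> = q v1 ?m ?m"
    proof -
      have "B ?v *v ?m = 0" unfolding m using bn by (simp add: b_0 matrix_vector_right_distrib BA)
      moreover have "B v1 *v ?m = 0" using UB[OF embU] by (simp add: matrix_vector_right_distrib BA)
      ultimately show ?thesis using v12 pt by (intro q_const)
    qed
    also have "\<dots> = q v1 ?n' ?n'"
      using q_mod[OF v12(1)] UB[OF embU] by blast
    finally show "(n + J *v w)$1 * (n + J *v w)$2 = n$1 * n$2"
      unfolding embQ by simp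
  qed
qed

end

section \<open>Rational functions on a line\<close>

definition rational_at :: "('k::field \<Rightarrow> 'k) \<Rightarrow> 'k \<Rightarrow> bool" where
  "rational_at F t0 \<longleftrightarrow> (\<exists>G H. poly H t0 \<noteq> 0 \<and> (\<forall>t. F t * poly H t = poly G t))"

text \<open>The denominators of \<open>F\<close> form an ideal without common zero.\<close>

lemma rational_everywhere_polynomial:
  fixes F :: "'k::alg_closed_field \<Rightarrow> 'k"
  assumes "\<And>t. rational_at F t"
  shows "\<exists>p. \<forall>t. F t = poly p t"
proof -
  define D where "D H \<longleftrightarrow> (\<exists>G. \<forall>t. F t * poly H t = poly G t)" for H
  have D_comb: "D (H - K * L)" if DHL: "D H" "D L" for H K L
  proof -
    obtain G G' where GG: "\<And>t. F t * poly H t = poly G t" "\<And>t. F t * poly L t = poly G' t"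
      using DHL unfolding D_def by metis
    have "F t * poly (H - K * L) t = poly (G - K * G') t" for t
    proof -
      have "F t * poly (H - K * L) t = F t * poly H t - poly K t * (F t * poly L t)"
        by (simp add: algebra_simps)
      then show ?thesis by (simp only: GG) simp
    qed
    then show ?thesis unfolding D_def by (intro exI allI)
  qed
  have Dt: "\<exists>H. D H \<and> poly H t \<noteq> 0" for t using assms[of t] by (auto simp: rational_at_def D_def)
  then have "\<exists>H. D H \<and> H \<noteq> 0" by (metis poly_0)
  then obtain H where H: "D H" "H \<noteq> 0" "\<And>L. D L \<Longrightarrow> L \<noteq> 0 \<Longrightarrow> degree H \<le> degree L"
    using ex_has_least_nat[of "\<lambda>H. D H \<and> H \<noteq> 0" _ degree] by blast
  have "degree H = 0"
  proof (rule ccontr)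
    assume "degree H \<noteq> 0"
    then obtain t where t: "poly H t = 0" using alg_closed_imp_poly_has_root by blast
    obtain L where L: "D L" "poly L t \<noteq> 0" using Dt by blast
    have "L mod H = L - (L div H) * H" by (simp add: minus_div_mult_eq_mod)
    then have "D (L mod H)" using D_comb[OF L(1) H(1)] by simp
    \<comment> \<open>\<open>H\<close> vanishes at \<open>t\<close> and \<open>L\<close> does not,
      so \<open>H\<close> does not divide \<open>L\<close>; the remainder is a nonzero denominator
      of smaller degree.\<close>
    moreover have "L mod H \<noteq> 0" using t L(2) by (metis mod_eq_0_iff_dvd poly_eq_0_iff_dvd dvd_trans)
    ultimately have "degree H \<le> degree (L mod H)" using H(3) by blast
    then show False using degree_mod_less'[OF H(2) \<open>L mod H \<noteq> 0\<close>] by simp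
  qed
  then obtain c where c: "H = [:c:]" by (metis degree_eq_zeroE)
  then obtain G where "\<forall>t. F t * c = poly G t" using H(1) by (auto simp: D_def)
  then have "\<forall>t. F t = poly (Polynomial.smult (1 / c) G) t" using H(2) c by (simp add: field_simps)
  then show ?thesis by blast
qed

text \<open>In the two affine charts of the line, \<open>F\<close> is given by polynomials
  \<open>p\<close> and \<open>r\<close>. Homogeneity glues them by
  \<open>p t = t^d * r (1 / t)\<close>, which bounds the degree of \<open>p\<close> and identifies
  its coefficient at \<open>d\<close> with the value of \<open>r\<close> at zero.\<close>

lemma homogeneous_on_line:
  fixes F :: "'k::{alg_closed_field,field_char_0}^'n \<Rightarrow> 'k"
  assumes hom: "\<And>s c. c \<noteq> 0 \<Longrightarrow> F (c *s (s *s v + w)) = c ^ d * F (s *s v + w)"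
    and r1: "\<And>t. rational_at (\<lambda>t. F (v + t *s w)) t"
    and r2: "\<And>t. rational_at (\<lambda>t. F (t *s v + w)) t"
  obtains p where "degree p \<le> d" "\<And>t. F (v + t *s w) = poly p t" "F w = Polynomial.coeff p d"
proof -
  obtain p where p: "\<And>t. F (v + t *s w) = poly p t" using rational_everywhere_polynomial[OF r1] by blast
  obtain r where r: "\<And>t. F (t *s v + w) = poly r t" using rational_everywhere_polynomial[OF r2] by blast
  let ?N = "degree r"
  \<comment> \<open>The gluing relation with denominators cleared; both sides then agree as
    polynomials, having infinitely many common values.\<close>
  have eq: "t ^ ?N * poly p t = t ^ d * poly (reflect_poly r) t" if "t \<noteq> 0" for t
  proof -
    have "v + t *s w = t *s ((1 / t) *s v + w)" using that by (simp add: vec_eq_iff field_simps)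
    then have "poly p t = t ^ d * poly r (1 / t)" using hom[OF that, of "1 / t"] p r by metis
    then show ?thesis using that by (simp add: poly_reflect_poly_nz inverse_eq_divide)
  qed
  have "monom 1 ?N * p = monom 1 d * reflect_poly r"
  proof (rule ccontr)
    assume "\<not> ?thesis"
    then have "finite {t. poly (monom 1 ?N * p - monom 1 d * reflect_poly r) t = 0}"
      by (intro poly_roots_finite) simp
    moreover have "UNIV - {0} \<subseteq> {t. poly (monom 1 ?N * p - monom 1 d * reflect_poly r) t = 0}"
      using eq by (auto simp: poly_monom)
    ultimately have "finite (UNIV - {0 :: 'k})" using finite_subset by blast
    then show False using infinite_UNIV_char_0[where 'a='k] by simp
  qed
  then have c: "Polynomial.coeff (monom 1 ?N * p) k = Polynomial.coeff (monom 1 d * reflect_poly r) k" for k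
    by simp
  have "degree p \<le> d"
  proof (rule degree_le, intro allI impI)
    fix i assume "d < i"
    then show "Polynomial.coeff p i = 0"
      using c[of "i + ?N"] by (simp add: coeff_monom_mult coeff_reflect_poly)
  qed
  moreover have "F w = Polynomial.coeff p d"
    using c[of "d + ?N"] r[of 0] by (simp add: coeff_monom_mult coeff_reflect_poly poly_0_coeff_0)
  ultimately show ?thesis using that p by blast
qed

section \<open>Forms\<close>

lemma form_const: "form 0 (\<lambda>v :: 'k::field^'n::finite. c)"
proof -
  have "monomials 0 = {(\<lambda>i. 0) :: 'n \<Rightarrow> nat}" by (auto simp: monomials_def)
  then show ?thesis unfolding form_def by (intro exI[of _ "\<lambda>_. c"]) simp
qed

lemma form_coord: "form 1 (\<lambda>v :: 'k::field^'n::finite. v $ i)"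
proof -
  let ?m = "\<lambda>j. if j = i then 1 else 0 :: nat"
  have m: "?m \<in> monomials 1" by (simp add: monomials_def)
  have "(\<Sum>m\<in>monomials 1. (if m = ?m then 1 else 0) * (\<Prod>j\<in>UNIV. v $ j ^ m j)) = v $ i" for v :: "'k^'n"
  proof -
    have "(\<Sum>m\<in>monomials 1. (if m = ?m then 1 else 0) * (\<Prod>j\<in>UNIV. v $ j ^ m j))
      = (\<Sum>m\<in>monomials 1. if m = ?m then (\<Prod>j\<in>UNIV. v $ j ^ m j) else 0)"
      by (intro sum.cong) auto
    also have "\<dots> = (\<Prod>j\<in>UNIV. v $ j ^ ?m j)"
      using m by (subst sum.delta) (simp_all add: finite_monomials)
    also have "\<dots> = (\<Prod>j\<in>UNIV. if j = i then v $ j else 1)" by (intro prod.cong) auto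
    finally show ?thesis by simp
  qed
  then show ?thesis unfolding form_def by (intro exI[of _ "\<lambda>m. if m = ?m then 1 else 0"]) simp
qed

lemma form_add:
  assumes "form d f" "form d g"
  shows "form d (\<lambda>v. f v + g v)"
proof -
  obtain c e where c: "f = (\<lambda>v. \<Sum>m\<in>monomials d. c m * (\<Prod>i\<in>UNIV. v $ i ^ m i))"
    and e: "g = (\<lambda>v. \<Sum>m\<in>monomials d. e m * (\<Prod>i\<in>UNIV. v $ i ^ m i))"
    using assms unfolding form_def by blast
  show ?thesis unfolding form_def
    by (intro exI[of _ "\<lambda>m. c m + e m"] ext) (simp add: c e distrib_right sum.distrib)
qed

lemma form_mult:
  fixes f g :: "'k::field^'n::finite \<Rightarrow> 'k"
  assumes "form d f" "form e g"
  shows "form (d + e) (\<lambda>v. f v * g v)"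
proof -
  obtain a where a: "f = (\<lambda>v. \<Sum>m\<in>monomials d. a m * (\<Prod>i\<in>UNIV. v $ i ^ m i))"
    using assms unfolding form_def by blast
  obtain b where b: "g = (\<lambda>v. \<Sum>m\<in>monomials e. b m * (\<Prod>i\<in>UNIV. v $ i ^ m i))"
    using assms unfolding form_def by blast
  let ?S = "(monomials d :: ('n \<Rightarrow> nat) set) \<times> (monomials e :: ('n \<Rightarrow> nat) set)"
  let ?s = "\<lambda>(m, n). \<lambda>i :: 'n. m i + n i :: nat"
  define c where "c l = (\<Sum>(m, n)\<in>{x \<in> ?S. ?s x = l}. a m * b n)" for l
  show ?thesis unfolding form_def
  proof (intro exI[of _ c] ext)
    fix v :: "'k^'n"
    let ?h = "\<lambda>(m, n). a m * b n * (\<Prod>i\<in>UNIV. v $ i ^ (m i + n i))"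
    have "f v * g v = (\<Sum>x\<in>?S. ?h x)"
      by (simp add: a b sum_product sum.cartesian_product power_add prod.distrib mult_ac)
    also have "\<dots> = (\<Sum>l\<in>monomials (d + e). \<Sum>x\<in>{x \<in> ?S. ?s x = l}. ?h x)"
      by (rule sum.group[symmetric, OF _ finite_monomials])
        ((intro finite_cartesian_product finite_monomials)[1], auto simp: monomials_def sum.distrib)
    also have "\<dots> = (\<Sum>l\<in>monomials (d + e). c l * (\<Prod>i\<in>UNIV. v $ i ^ l i))"
      unfolding c_def sum_distrib_right by (intro sum.cong refl) auto
    finally show "f v * g v = (\<Sum>l\<in>monomials (d + e). c l * (\<Prod>i\<in>UNIV. v $ i ^ l i))" .
  qed
qed

lemma form_cmult: "form d f \<Longrightarrow> form d (\<lambda>v. c * f v)"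
  using form_mult[OF form_const, of d f c] by simp

lemma form_zero: "form d (\<lambda>v :: 'k::field^'n::finite. 0)"
  unfolding form_def by (intro exI[of _ "\<lambda>_. 0"]) simp

lemma form_sum:
  assumes "\<And>i. i \<in> S \<Longrightarrow> form d (f i)"
  shows "form d (\<lambda>v. \<Sum>i\<in>S. f i v)"
  using assms by (induction S rule: infinite_finite_induct) (auto intro: form_add form_zero)

lemma form_coord_power: "form n (\<lambda>v :: 'k::field^'n::finite. v $ i ^ n)"
proof (induction n)
  case 0 show ?case using form_const[of 1] by simp
next
  case (Suc n) then show ?case using form_mult[OF form_coord, of n "\<lambda>v. v $ i ^ n" i] by simp
qed

lemma form_homogeneous:
  fixes f :: "'k::field^'n::finite \<Rightarrow> 'k"
  assumes "form d f"
  shows "f (c *s v) = c ^ d * f v"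
proof -
  obtain a where a: "f = (\<lambda>v. \<Sum>m\<in>monomials d. a m * (\<Prod>i\<in>UNIV. v $ i ^ m i))"
    using assms unfolding form_def by blast
  have "(\<Prod>i\<in>UNIV. (c *s v) $ i ^ m i) = c ^ d * (\<Prod>i\<in>UNIV. v $ i ^ m i)"
    if "m \<in> monomials d" for m
    using that by (simp add: monomials_def power_mult_distrib prod.distrib flip: power_sum)
  then show ?thesis
    unfolding a sum_distrib_left by (intro sum.cong) (auto simp: mult_ac)
qed

lemma form_along_line:
  fixes f :: "'k::field^'n::finite \<Rightarrow> 'k"
  assumes "form d f"
  shows "\<exists>p. \<forall>t. f (v + t *s w) = poly p t"
proof -
  obtain a where a: "f = (\<lambda>v. \<Sum>m\<in>monomials d. a m * (\<Prod>i\<in>UNIV. v $ i ^ m i))"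
    using assms unfolding form_def by blast
  show ?thesis
    by (intro exI[of _ "\<Sum>m\<in>monomials d. Polynomial.smult (a m) (\<Prod>i\<in>UNIV. [:v $ i, w $ i:] ^ m i)"])
      (simp add: a poly_sum poly_prod)
qed

section \<open>The Zariski topology\<close>

abbreviation zopen :: "('k::field^'n::finite) set set \<Rightarrow> bool" where
  "zopen \<equiv> openin (zar proj_space)"

abbreviation cone :: "('k::field^'n::finite) set set \<Rightarrow> ('k^'n) set" where
  "cone \<equiv> punctured_cone"

definition basic_open :: "('k::field^'n::finite \<Rightarrow> 'k) \<Rightarrow> ('k^'n) set set" where
  "basic_open f = {p \<in> proj_space. \<forall>v \<in> p - {0}. f v \<noteq> 0}"

lemma openin_basic_open:
  assumes "form d f"
  shows "zopen (basic_open f)"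
proof -
  have "openin zariski (basic_open f)"
    unfolding zariski_def basic_open_def by (rule topology_generated_by_Basis) (use assms in blast)
  moreover have "basic_open f \<subseteq> proj_space" by (auto simp: basic_open_def)
  ultimately show ?thesis by (auto simp: openin_subtopology)
qed

lemma span_singleton_scale:
  fixes v :: "'k::field^'n"
  assumes "c \<noteq> 0"
  shows "vec.span {c *s v} = vec.span {v}"
proof (intro equalityI; rule vec.span_minimal[OF _ vec.subspace_span])
  show "{c *s v} \<subseteq> vec.span {v}" by (auto intro: vec.span_scale vec.span_base)
  have "v = (1 / c) *s (c *s v)" using assms by (simp add: vec_eq_iff)
  then show "{v} \<subseteq> vec.span {c *s v}" by (metis empty_subsetI insert_subset vec.span_base vec.span_scale insertI1)
qed

lemma mem_proj_point:
  fixes v :: "'k::field^'n"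
  assumes "p \<in> proj_space" "v \<in> p" "v \<noteq> 0"
  shows "p = vec.span {v}"
proof -
  obtain u where "p = vec.span {u}" using assms(1) by (auto simp: proj_space_def)
  then obtain c where "v = c *s u" using assms(2) by (auto simp: vec.span_singleton)
  then show ?thesis using assms(3) span_singleton_scale[of c u] \<open>p = vec.span {u}\<close> by fastforce
qed

lemma punctured_cone_iff:
  assumes "V \<subseteq> proj_space"
  shows "v \<in> cone V \<longleftrightarrow> v \<noteq> 0 \<and> vec.span {v} \<in> V"
  using assms mem_proj_point[of _ v] vec.span_base[of v "{v}"] unfolding punctured_cone_def by fastforce

lemma scale_punctured_cone:
  assumes "V \<subseteq> proj_space" "c \<noteq> 0"
  shows "c *s v \<in> cone V \<longleftrightarrow> v \<in> cone V"
  using assms by (simp add: punctured_cone_iff span_singleton_scale)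

lemma span_in_proj_space: "v \<noteq> 0 \<Longrightarrow> vec.span {v} \<in> proj_space"
  by (auto simp: proj_space_def)

lemma zar_subset: "openin (zar X) W \<Longrightarrow> W \<subseteq> X"
  using openin_subset by fastforce

lemma basic_open_cone:
  assumes "form d f"
  shows "v \<in> cone (basic_open f) \<longleftrightarrow> v \<noteq> 0 \<and> f v \<noteq> 0"
proof -
  have "vec.span {v} \<in> basic_open f \<longleftrightarrow> f v \<noteq> 0" if "v \<noteq> 0"
    using that form_homogeneous[OF assms] vec.span_base[of v "{v}"] span_in_proj_space[OF that]
    by (auto simp: basic_open_def vec.span_singleton)
  moreover have "basic_open f \<subseteq> proj_space" by (auto simp: basic_open_def)
  ultimately show ?thesis by (auto simp: punctured_cone_iff)
qed

text \<open>Complements of hypersurfaces are a basis and not merely a subbasis, since intersections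
  correspond to products of forms. In terms of the cone this reads as a form that is nonzero at
  \<open>v\<close> and vanishes at every nonzero vector off the cone.\<close>

lemma zar_basis:
  fixes v :: "'k::field^'n::finite"
  assumes "zopen W" "v \<in> cone W"
  shows "\<exists>d f. form d f \<and> f v \<noteq> 0 \<and> (\<forall>u. u \<noteq> 0 \<longrightarrow> f u \<noteq> 0 \<longrightarrow> u \<in> cone W)"
proof -
  let ?\<S> = "{{p \<in> proj_space. \<forall>v \<in> p - {0}. f v \<noteq> 0} | f :: 'k^'n \<Rightarrow> 'k. \<exists>d. form d f}"
  have W: "W \<subseteq> proj_space" using zar_subset assms(1) by blast
  obtain T where T: "openin zariski T" "W = T \<inter> proj_space"
    using assms(1) by (auto simp: openin_subtopology)
  then have "generate_topology_on ?\<S> T" unfolding zariski_def by (simp add: openin_topology_generated_by_iff)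
  then have "vec.span {v} \<in> T \<Longrightarrow> v \<noteq> 0 \<Longrightarrow>
    \<exists>d f. form d f \<and> f v \<noteq> 0 \<and> (\<forall>u. u \<noteq> 0 \<longrightarrow> f u \<noteq> 0 \<longrightarrow> vec.span {u} \<in> T)"
  proof (induction rule: generate_topology_on.induct)
    case (Int a b)
    from Int.prems have va: "vec.span {v} \<in> a" and vb: "vec.span {v} \<in> b" by simp_all
    obtain d f where f: "form d f" "f v \<noteq> 0" "\<forall>u. u \<noteq> 0 \<longrightarrow> f u \<noteq> 0 \<longrightarrow> vec.span {u} \<in> a"
      using Int.IH(1)[OF va Int.prems(2)] by blast
    obtain e g where g: "form e g" "g v \<noteq> 0" "\<forall>u. u \<noteq> 0 \<longrightarrow> g u \<noteq> 0 \<longrightarrow> vec.span {u} \<in> b"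
      using Int.IH(2)[OF vb Int.prems(2)] by blast
    show ?case
      by (intro exI[of _ "d + e"] exI[of _ "\<lambda>v. f v * g v"] conjI form_mult f g) (use f g in simp_all)
  next
    case (UN K)
    from UN.prems obtain k where k: "k \<in> K" "vec.span {v} \<in> k" by blast
    show ?case using UN.IH[OF k UN.prems(2)] k(1) by blast
  next
    case (Basis s)
    then obtain f d where f: "s = basic_open f" "form d f" by (auto simp: basic_open_def)
    have "vec.span {u} \<in> s \<longleftrightarrow> f u \<noteq> 0" if "u \<noteq> 0" for u
      using basic_open_cone[OF f(2), of u] that f(1)
      by (simp add: punctured_cone_iff basic_open_def)
    then show ?case using Basis.prems f(2) by blast
  qed simp
  moreover have "vec.span {v} \<in> T" "v \<noteq> 0" using assms(2) T W by (auto simp: punctured_cone_iff)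
  ultimately obtain d f where "form d f" "f v \<noteq> 0" "\<forall>u. u \<noteq> 0 \<longrightarrow> f u \<noteq> 0 \<longrightarrow> vec.span {u} \<in> T" by blast
  then show ?thesis using T W by (intro exI[of _ d] exI[of _ f]) (auto simp: punctured_cone_iff span_in_proj_space)
qed

section \<open>Regular functions\<close>

abbreviation reg :: "int \<Rightarrow> ('k::field^'n::finite) set set \<Rightarrow> ('k^'n \<Rightarrow> 'k) set" where
  "reg \<equiv> regular proj_space"

text \<open>Numerator and denominator are multiplied by a form that vanishes outside the given
  neighbourhood. The neighbourhood thus becomes the set where the denominator is nonzero, and only
  forms remain to be handled.\<close>

lemma regular_local:
  fixes v :: "'k::field^'n::finite"
  assumes f: "f \<in> reg d W" and W: "zopen W" and v: "v \<in> cone W"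
  shows "\<exists>a b g h. form a g \<and> form b h \<and> int a - int b = d \<and> h v \<noteq> 0 \<and>
    (\<forall>u. u \<noteq> 0 \<longrightarrow> h u \<noteq> 0 \<longrightarrow> u \<in> cone W \<and> f u = g u / h u)"
proof -
  have sW: "W \<subseteq> proj_space" using zar_subset W by blast
  have pW: "vec.span {v} \<in> W" "v \<noteq> 0" using v sW by (auto simp: punctured_cone_iff)
  then obtain W' a b g h where *: "zopen W'" "vec.span {v} \<in> W'" "W' \<subseteq> W"
    "form a g" "form b h" "int a - int b = d" "\<forall>v\<in>cone W'. h v \<noteq> 0 \<and> f v = g v / h v"
    using f unfolding regular_def by blast
  have v': "v \<in> cone W'" using * pW zar_subset by (subst punctured_cone_iff) blast+
  obtain e k where k: "form e k" "k v \<noteq> 0" "\<forall>u. u \<noteq> 0 \<longrightarrow> k u \<noteq> 0 \<longrightarrow> u \<in> cone W'"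
    using zar_basis[OF *(1) v'] by blast
  have "cone W' \<subseteq> cone W" using *(3) by (auto simp: punctured_cone_def)
  then show ?thesis
    using * k v'
    by (intro exI[of _ "a + e"] exI[of _ "b + e"] exI[of _ "\<lambda>u. g u * k u"] exI[of _ "\<lambda>u. h u * k u"])
      (auto intro: form_mult)
qed

lemma regularI:
  fixes f :: "'k::field^'n::finite \<Rightarrow> 'k"
  assumes W: "zopen W" and 0: "\<And>v. v \<notin> cone W \<Longrightarrow> f v = 0"
    and loc: "\<And>v. v \<in> cone W \<Longrightarrow> \<exists>a b g h. form a g \<and> form b h \<and> int a - int b = d \<and> h v \<noteq> 0 \<and>
      (\<forall>u\<in>cone W. h u \<noteq> 0 \<longrightarrow> f u = g u / h u)"
  shows "f \<in> reg d W"
  unfolding regular_def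
proof (intro CollectI conjI allI impI ballI)
  fix v assume "v \<notin> cone W" then show "f v = 0" by (rule 0)
next
  fix p assume p: "p \<in> W"
  have sW: "W \<subseteq> proj_space" using zar_subset W by blast
  then obtain v where v: "v \<noteq> 0" "p = vec.span {v}" using p by (auto simp: proj_space_def)
  then have "v \<in> cone W" using p sW by (simp add: punctured_cone_iff)
  then obtain a b g h where *: "form a g" "form b h" "int a - int b = d" "h v \<noteq> 0"
    "\<forall>u\<in>cone W. h u \<noteq> 0 \<longrightarrow> f u = g u / h u" using loc by blast
  let ?W = "W \<inter> basic_open h"
  have "zopen ?W" using W openin_basic_open[OF *(2)] by (rule openin_Int)
  moreover have "p \<in> ?W"
    using p v basic_open_cone[OF *(2), of v] *(4) by (auto simp: punctured_cone_iff basic_open_def)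
  moreover have "h u \<noteq> 0 \<and> f u = g u / h u" if "u \<in> cone ?W" for u
  proof -
    have "u \<in> cone W" "u \<in> cone (basic_open h)" using that by (auto simp: punctured_cone_def)
    then show ?thesis using * basic_open_cone[OF *(2), of u] by auto
  qed
  ultimately show "\<exists>W' a b g h. zopen W' \<and> p \<in> W' \<and> W' \<subseteq> W \<and> form a g \<and> form b h \<and>
      int a - int b = d \<and> (\<forall>v\<in>cone W'. h v \<noteq> 0 \<and> f v = g v / h v)"
    using *(1-3) by (intro exI[of _ ?W] exI[of _ a] exI[of _ b] exI[of _ g] exI[of _ h]) auto
qed

lemma regular_off: "f \<in> reg d W \<Longrightarrow> v \<notin> cone W \<Longrightarrow> f v = 0"
  by (simp add: regular_def)

lemma regular_add:
  assumes "zopen W" "f \<in> reg d W" "g \<in> reg d W"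
  shows "(\<lambda>v. f v + g v) \<in> reg d W"
proof (rule regularI[OF assms(1)])
  fix v assume v: "v \<in> cone W"
  obtain a b p q where 1: "form a p" "form b q" "int a - int b = d" "q v \<noteq> 0"
    "\<forall>u. u \<noteq> 0 \<longrightarrow> q u \<noteq> 0 \<longrightarrow> u \<in> cone W \<and> f u = p u / q u"
    using regular_local[OF assms(2,1) v] by blast
  obtain a' b' p' q' where 2: "form a' p'" "form b' q'" "int a' - int b' = d" "q' v \<noteq> 0"
    "\<forall>u. u \<noteq> 0 \<longrightarrow> q' u \<noteq> 0 \<longrightarrow> u \<in> cone W \<and> g u = p' u / q' u"
    using regular_local[OF assms(3,1) v] by blast
  have "form (a + b') (\<lambda>u. p u * q' u + p' u * q u)"
  proof -
    have "a + b' = a' + b" using 1 2 by linarith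
    then show ?thesis using form_mult[OF 1(1) 2(2)] form_mult[OF 2(1) 1(2)] by (intro form_add) simp_all
  qed
  moreover have "form (b + b') (\<lambda>u. q u * q' u)" using 1 2 by (intro form_mult)
  moreover have "f u + g u = (p u * q' u + p' u * q u) / (q u * q' u)"
    if "u \<in> cone W" "q u * q' u \<noteq> 0" for u
  proof -
    have "u \<noteq> 0" using that by (auto simp: punctured_cone_def)
    then show ?thesis using that 1 2 by (simp add: add_frac_eq)
  qed
  ultimately show "\<exists>a b g' h. form a g' \<and> form b h \<and> int a - int b = d \<and> h v \<noteq> 0 \<and>
      (\<forall>u\<in>cone W. h u \<noteq> 0 \<longrightarrow> f u + g u = g' u / h u)"
    using 1 2 by (intro exI[of _ "a + b'"] exI[of _ "b + b'"] exI[of _ "\<lambda>u. p u * q' u + p' u * q u"]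
        exI[of _ "\<lambda>u. q u * q' u"]) auto
qed (use assms in \<open>simp add: regular_off\<close>)

lemma regular_mult:
  assumes "zopen W" "f \<in> reg d W" "g \<in> reg e W"
  shows "(\<lambda>v. f v * g v) \<in> reg (d + e) W"
proof (rule regularI[OF assms(1)])
  fix v assume v: "v \<in> cone W"
  obtain a b p q where 1: "form a p" "form b q" "int a - int b = d" "q v \<noteq> 0"
    "\<forall>u. u \<noteq> 0 \<longrightarrow> q u \<noteq> 0 \<longrightarrow> u \<in> cone W \<and> f u = p u / q u"
    using regular_local[OF assms(2,1) v] by blast
  obtain a' b' p' q' where 2: "form a' p'" "form b' q'" "int a' - int b' = e" "q' v \<noteq> 0"
    "\<forall>u. u \<noteq> 0 \<longrightarrow> q' u \<noteq> 0 \<longrightarrow> u \<in> cone W \<and> g u = p' u / q' u"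
    using regular_local[OF assms(3,1) v] by blast
  have "f u * g u = (p u * p' u) / (q u * q' u)"
    if "u \<in> cone W" "q u * q' u \<noteq> 0" for u
  proof -
    have "u \<noteq> 0" using that by (auto simp: punctured_cone_def)
    then show ?thesis using that 1 2 by simp
  qed
  then show "\<exists>a b g' h. form a g' \<and> form b h \<and> int a - int b = d + e \<and> h v \<noteq> 0 \<and>
      (\<forall>u\<in>cone W. h u \<noteq> 0 \<longrightarrow> f u * g u = g' u / h u)"
    using 1 2 by (intro exI[of _ "a + a'"] exI[of _ "b + b'"] exI[of _ "\<lambda>u. p u * p' u"]
        exI[of _ "\<lambda>u. q u * q' u"]) (auto intro: form_mult)
qed (use assms in \<open>simp add: regular_off\<close>)

lemma regular_quotient:
  assumes "zopen W" "form a g" "form b h" "int a - int b = d"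
    and "\<And>v. v \<in> cone W \<Longrightarrow> h v \<noteq> 0"
  shows "(\<lambda>v. if v \<in> cone W then g v / h v else 0) \<in> reg d W"
proof (rule regularI[OF assms(1)])
  fix v assume "v \<in> cone W"
  then show "\<exists>a b g' h'. form a g' \<and> form b h' \<and> int a - int b = d \<and> h' v \<noteq> 0 \<and>
      (\<forall>u\<in>cone W. h' u \<noteq> 0 \<longrightarrow> (if u \<in> cone W then g u / h u else 0) = g' u / h' u)"
    using assms by (intro exI[of _ a] exI[of _ b] exI[of _ g] exI[of _ h]) auto
qed simp

lemma regular_const:
  fixes c :: "'k::field"
  assumes "zopen W"
  shows "(\<lambda>v :: 'k^'n::finite. if v \<in> cone W then c else 0) \<in> reg 0 W"
  using regular_quotient[OF assms form_const[of c] form_const[of 1], of 0] by (simp cong: if_cong)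

lemma regular_zero:
  assumes "zopen W"
  shows "(\<lambda>v :: 'k::field^'n::finite. 0) \<in> reg d W"
proof (rule regularI[OF assms])
  fix v :: "'k^'n" assume "v \<in> cone W"
  then obtain i where "v $ i \<noteq> 0" by (auto simp: punctured_cone_def vec_eq_iff)
  then show "\<exists>a b g h. form a g \<and> form b h \<and> int a - int b = d \<and> h v \<noteq> 0 \<and>
      (\<forall>u\<in>cone W. h u \<noteq> 0 \<longrightarrow> (0 :: 'k) = g u / h u)"
    \<comment> \<open>The zero function has to be a quotient of degree \<open>d\<close> also for
      negative \<open>d\<close>; the degrees \<open>nat d\<close> and \<open>nat (- d)\<close>
      differ by \<open>d\<close>.\<close>
    by (intro exI[of _ "nat d"] exI[of _ "nat (- d)"] exI[of _ "\<lambda>_. 0"] exI[of _ "\<lambda>v. v $ i ^ nat (- d)"])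
      (simp add: form_zero form_coord_power)
qed simp

lemma regular_sum:
  assumes "zopen W" "\<And>i. i \<in> S \<Longrightarrow> f i \<in> reg d W"
  shows "(\<lambda>v. \<Sum>i\<in>S. f i v) \<in> reg d W"
  using assms(2) by (induction S rule: infinite_finite_induct)
    (auto intro: regular_add regular_zero assms(1))

lemma regular_restrict:
  assumes f: "f \<in> reg d W" and W: "zopen W" "zopen W'" "W' \<subseteq> W"
  shows "(\<lambda>v. if v \<in> cone W' then f v else 0) \<in> reg d W'"
proof (rule regularI[OF W(2)])
  fix v assume v: "v \<in> cone W'"
  then have "v \<in> cone W" using W(3) by (auto simp: punctured_cone_def)
  from regular_local[OF f W(1) this]
  show "\<exists>a b g h. form a g \<and> form b h \<and> int a - int b = d \<and> h v \<noteq> 0 \<and>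
      (\<forall>u\<in>cone W'. h u \<noteq> 0 \<longrightarrow> (if u \<in> cone W' then f u else 0) = g u / h u)"
    by (fastforce simp: punctured_cone_def)
qed simp

lemma regular_homogeneous:
  assumes f: "f \<in> reg (int d) W" and W: "zopen W" and c: "c \<noteq> 0"
  shows "f (c *s v) = c ^ d * f v"
proof (cases "v \<in> cone W")
  case True
  obtain a b p q where *: "form a p" "form b q" "int a - int b = int d" "q v \<noteq> 0"
    "\<forall>u. u \<noteq> 0 \<longrightarrow> q u \<noteq> 0 \<longrightarrow> u \<in> cone W \<and> f u = p u / q u"
    using regular_local[OF f W True] by blast
  have "v \<noteq> 0" using True by (auto simp: punctured_cone_def)
  have "q (c *s v) \<noteq> 0" using * c form_homogeneous[OF *(2), of c v] by simp
  moreover have "c *s v \<noteq> 0" using c \<open>v \<noteq> 0\<close> by (simp add: vec_eq_iff)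
  ultimately have "f (c *s v) = p (c *s v) / q (c *s v)" using * by blast
  also have "\<dots> = (c ^ a * p v) / (c ^ b * q v)" by (simp only: form_homogeneous[OF *(1)] form_homogeneous[OF *(2)])
  also have "a = b + d" using *(3) by linarith
  then have "(c ^ a * p v) / (c ^ b * q v) = c ^ d * (p v / q v)" using c by (simp add: power_add)
  also have "p v / q v = f v" using * \<open>v \<noteq> 0\<close> by simp
  finally show ?thesis .
next
  case False
  have sW: "W \<subseteq> proj_space" using zar_subset W by blast
  have "c *s v \<notin> cone W"
    using False scale_punctured_cone[OF sW c] by blast
  then show ?thesis using False f by (simp add: regular_off)
qed

lemma regular_rational_along_line:
  fixes f :: "'k::field^'n::finite \<Rightarrow> 'k"
  assumes f: "f \<in> reg d W" and W: "zopen W" and t0: "v + t0 *s w \<in> cone W"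
    and nz: "\<And>t. v + t *s w \<noteq> 0"
  shows "\<exists>G H. poly H t0 \<noteq> 0 \<and> (\<forall>t. poly H t \<noteq> 0 \<longrightarrow> v + t *s w \<in> cone W \<and> f (v + t *s w) * poly H t = poly G t)"
proof -
  obtain a b p q where *: "form a p" "form b q" "q (v + t0 *s w) \<noteq> 0"
    "\<forall>u. u \<noteq> 0 \<longrightarrow> q u \<noteq> 0 \<longrightarrow> u \<in> cone W \<and> f u = p u / q u"
    using regular_local[OF f W t0] by blast
  obtain G H where G: "\<And>t. p (v + t *s w) = poly G t" and H: "\<And>t. q (v + t *s w) = poly H t"
    using form_along_line[OF *(1), of v w] form_along_line[OF *(2), of v w] by metis
  show ?thesis
  proof (rule exI[of _ G], rule exI[of _ H], intro conjI allI impI)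
    show "poly H t0 \<noteq> 0" using *(3) H by simp
    fix t assume t: "poly H t \<noteq> 0"
    then have "v + t *s w \<in> cone W \<and> f (v + t *s w) = p (v + t *s w) / q (v + t *s w)"
      using *(4) nz H by simp
    then show "v + t *s w \<in> cone W" "f (v + t *s w) * poly H t = poly G t"
      using t G H by simp_all
  qed
qed

text \<open>Multiplication by one more factor \<open>H\<close> makes the equation hold at the zeros
  of \<open>H\<close> too.\<close>

lemma rational_atI:
  assumes "poly H t0 \<noteq> 0" "\<And>t. poly H t \<noteq> 0 \<Longrightarrow> F t * poly H t = poly G t"
  shows "rational_at F t0"
  unfolding rational_at_def
  by (rule exI[of _ "G * H"], rule exI[of _ "H * H"]) (use assms in \<open>auto simp flip: mult.assoc\<close>)

text \<open>
  Global sections will be determined on lines, which avoids factoring polynomials in several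
  variables.
\<close>

lemma regular_near_line:
  fixes F :: "'k::{alg_closed_field,field_char_0}^'n::finite \<Rightarrow> 'k"
  assumes indep: "\<And>a b. a *s v + b *s w = 0 \<Longrightarrow> a = 0 \<and> b = 0"
    and loc: "\<And>a b. a \<noteq> 0 \<or> b \<noteq> 0 \<Longrightarrow> \<exists>W f. zopen W \<and> f \<in> reg (int d) W \<and>
      a *s v + b *s w \<in> cone W \<and>
      (\<forall>a b. a *s v + b *s w \<in> cone W \<longrightarrow> F (a *s v + b *s w) = f (a *s v + b *s w))"
  obtains p where "degree p \<le> d" "\<And>t. F (v + t *s w) = poly p t" "F w = Polynomial.coeff p d"
proof (rule homogeneous_on_line)
  have nz1: "v + t *s w \<noteq> 0" and nz2: "t *s v + w \<noteq> 0" for t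
    using indep[of 1 t] indep[of t 1] by auto
  show "rational_at (\<lambda>t. F (v + t *s w)) t0" for t0
  proof -
    obtain W f where Wf: "zopen W" "f \<in> reg (int d) W" "v + t0 *s w \<in> cone W"
      "\<And>a b. a *s v + b *s w \<in> cone W \<Longrightarrow> F (a *s v + b *s w) = f (a *s v + b *s w)"
      using loc[of 1 t0] by auto
    obtain G H where "poly H t0 \<noteq> 0"
      "\<And>t. poly H t \<noteq> 0 \<Longrightarrow> v + t *s w \<in> cone W \<and> f (v + t *s w) * poly H t = poly G t"
      using regular_rational_along_line[OF Wf(2,1,3) nz1] by blast
    then show ?thesis using Wf(4)[of 1] by (intro rational_atI[of H _ _ G]) auto
  qed
  show "rational_at (\<lambda>t. F (t *s v + w)) t0" for t0
  proof -
    obtain W f where Wf: "zopen W" "f \<in> reg (int d) W" "w + t0 *s v \<in> cone W"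
      "\<And>a b. a *s v + b *s w \<in> cone W \<Longrightarrow> F (a *s v + b *s w) = f (a *s v + b *s w)"
      using loc[of t0 1] by (auto simp: add.commute)
    have nz: "w + t *s v \<noteq> 0" for t using nz2[of t] by (simp add: add.commute)
    obtain G H where "poly H t0 \<noteq> 0"
      "\<And>t. poly H t \<noteq> 0 \<Longrightarrow> w + t *s v \<in> cone W \<and> f (w + t *s v) * poly H t = poly G t"
      using regular_rational_along_line[OF Wf(2,1,3) nz] by blast
    then show ?thesis using Wf(4)[of _ 1] by (intro rational_atI[of H _ _ G]) (auto simp: add.commute)
  qed
  fix s c :: 'k assume c: "c \<noteq> 0"
  obtain W f where Wf: "zopen W" "f \<in> reg (int d) W" "s *s v + w \<in> cone W"
    "\<And>a b. a *s v + b *s w \<in> cone W \<Longrightarrow> F (a *s v + b *s w) = f (a *s v + b *s w)"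
    using loc[of s 1] by auto
  have sW: "W \<subseteq> proj_space" using zar_subset Wf(1) by blast
  have "c *s (s *s v + w) \<in> cone W"
    using Wf(3) scale_punctured_cone[OF sW c] by blast
  then have "F (c *s (s *s v + w)) = f (c *s (s *s v + w))"
    using Wf(4)[of "c * s" c] by (simp add: vector_add_ldistrib vector_smult_assoc)
  also have "\<dots> = c ^ d * f (s *s v + w)" by (rule regular_homogeneous[OF Wf(2,1) c])
  also have "f (s *s v + w) = F (s *s v + w)" using Wf(3) Wf(4)[of s 1] by simp
  finally show "F (c *s (s *s v + w)) = c ^ d * F (s *s v + w)" .
qed (use that in blast)

section \<open>Global sections of O(1)\<close>

lemma openin_proj_space: "openin (zar (proj_space :: ('k::field^'n::finite) set set)) proj_space"
proof -
  have "basic_open (\<lambda>v :: 'k^'n. 1) = proj_space" by (simp add: basic_open_def)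
  then show ?thesis using openin_basic_open[OF form_const[of "1 :: 'k"]] by metis
qed

lemma punctured_cone_proj_space: "v \<in> cone proj_space \<longleftrightarrow> v \<noteq> 0"
  by (auto simp: punctured_cone_iff span_in_proj_space)

text \<open>For independent \<open>v\<close> and \<open>w\<close> the restriction to their line is a
  polynomial \<open>a + b t\<close> with \<open>F v = a\<close> and \<open>F w = b\<close>, and its
  value at 1 is additivity. For dependent vectors homogeneity suffices.\<close>

lemma global_linear:
  fixes F :: "'k::{alg_closed_field,field_char_0}^'n::finite \<Rightarrow> 'k"
  assumes F: "F \<in> reg 1 proj_space"
  shows "F (v + w) = F v + F w" "F (c *s v) = c * F v"
proof -
  have F0: "F 0 = 0" using regular_off[OF F] by (simp add: punctured_cone_proj_space)
  have sc: "F (c *s v) = c * F v" for c v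
    using regular_homogeneous[of F 1 proj_space c v] F openin_proj_space F0
    by (cases "c = 0") auto
  then show "F (c *s v) = c * F v" .
  show "F (v + w) = F v + F w"
  proof (cases "\<forall>a b. a *s v + b *s w = 0 \<longrightarrow> a = 0 \<and> b = 0")
    case True
    obtain p where p: "degree p \<le> 1" "\<And>t. F (v + t *s w) = poly p t" "F w = Polynomial.coeff p 1"
    proof (rule regular_near_line[of v w 1 F])
      show "a = 0 \<and> b = 0" if "a *s v + b *s w = 0" for a b using True that by blast
      show "\<exists>W f. zopen W \<and> f \<in> reg (int 1) W \<and> a *s v + b *s w \<in> cone W \<and>
        (\<forall>a b. a *s v + b *s w \<in> cone W \<longrightarrow> F (a *s v + b *s w) = f (a *s v + b *s w))"
        if "a \<noteq> 0 \<or> b \<noteq> 0" for a b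
        using True that F openin_proj_space
        by (intro exI[of _ proj_space] exI[of _ F]) (auto simp: punctured_cone_proj_space)
    qed (use that in blast)
    obtain a b where "p = [:a, b:]"
    proof -
      have "p = [:Polynomial.coeff p 0, Polynomial.coeff p 1:]"
      proof (rule poly_eqI)
        fix n show "Polynomial.coeff p n = Polynomial.coeff [:Polynomial.coeff p 0, Polynomial.coeff p 1:] n"
          using coeff_eq_0[of p n] p(1) by (cases n; cases "n - 1") auto
      qed
      then show ?thesis using that by blast
    qed
    then show ?thesis using p(2)[of 0] p(2)[of 1] p(3) by simp
  next
    case False
    then obtain a b where ab: "a *s v + b *s w = 0" "a \<noteq> 0 \<or> b \<noteq> 0" by blast
    have "\<exists>c. w = c *s v \<or> v = c *s w"
    proof (cases "a = 0")
      case True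
      then have "w = 0 *s v" using ab by (simp add: vec_eq_iff)
      then show ?thesis by blast
    next
      case False
      have "v = (1 / a) *s (a *s v + b *s w) + (- (b / a)) *s w"
        using False by (simp add: vec_eq_iff distrib_left)
      then have "v = (- (b / a)) *s w" using ab(1) by simp
      then show ?thesis by blast
    qed
    then obtain c where "w = c *s v \<or> v = c *s w" by blast
    then show ?thesis
    proof
      assume w: "w = c *s v"
      have "v + w = (1 + c) *s v" by (simp add: w vec_eq_iff algebra_simps)
      show ?thesis unfolding \<open>v + w = _\<close> sc by (simp add: w sc distrib_right)
    next
      assume w: "v = c *s w"
      have "v + w = (c + 1) *s w" by (simp add: w vec_eq_iff algebra_simps)
      show ?thesis unfolding \<open>v + w = _\<close> sc by (simp add: w sc distrib_right)
    qed
  qed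
qed

lemma global_linear_form:
  fixes F :: "'k::{alg_closed_field,field_char_0}^'n::finite \<Rightarrow> 'k"
  assumes F: "F \<in> reg 1 proj_space"
  shows "form 1 F"
proof -
  have sum: "F (\<Sum>k\<in>S. f k) = (\<Sum>k\<in>S. F (f k))" for f and S :: "'n set"
    by (induction S rule: infinite_finite_induct)
      (use global_linear(2)[OF F, of 0 0] in \<open>simp_all add: global_linear(1)[OF F]\<close>)
  have "F x = (\<Sum>k\<in>UNIV. F (axis k 1) * x $ k)" for x
  proof -
    have "F x = F (\<Sum>k\<in>UNIV. x $ k *s axis k 1)" by (simp only: basis_expansion)
    then show ?thesis by (simp add: sum global_linear(2)[OF F] mult.commute)
  qed
  then have "F = (\<lambda>x. \<Sum>k\<in>UNIV. F (axis k 1) * x $ k)" by blast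
  moreover have "form 1 (\<lambda>x. \<Sum>k\<in>UNIV. F (axis k 1) * x $ k)" by (intro form_sum form_cmult form_coord)
  ultimately show ?thesis by simp
qed

section \<open>Vectors of regular functions\<close>

text \<open>
  The sections of \<open>O(d)\<^sup>m\<close> are indexed by natural numbers; \<open>vals\<close> and \<open>of_vals\<close> convert them
  to functions with values in \<open>'k^'m\<close>.
\<close>

definition ix :: "'m::finite \<Rightarrow> nat" where
  "ix = (SOME h. bij_betw h UNIV {..<CARD('m)})"

lemma ix_bij: "bij_betw (ix :: 'm::finite \<Rightarrow> nat) UNIV {..<CARD('m)}"
proof -
  have "\<exists>h :: 'm \<Rightarrow> nat. bij_betw h UNIV {..<CARD('m)}"
    using finite_same_card_bij[of "UNIV :: 'm set" "{..<CARD('m)}"] by simp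
  then show ?thesis unfolding ix_def by (rule someI_ex)
qed

lemma ix_less: "ix (i :: 'm::finite) < CARD('m)"
  using bij_betwE[OF ix_bij] by blast

lemma ix_surj:
  assumes "n < CARD('m::finite)"
  shows "\<exists>i :: 'm::finite. ix i = n"
  using bij_betw_imp_surj_on[OF ix_bij[where 'm='m]] assms by (metis image_iff lessThan_iff)

lemma inv_ix: "inv_into UNIV ix (ix (i :: 'm::finite)) = i"
  by (rule inv_into_f_f[OF bij_betw_imp_inj_on[OF ix_bij]]) simp

definition vals :: "(nat \<Rightarrow> 'k^'n \<Rightarrow> 'k) \<Rightarrow> 'k^'n \<Rightarrow> 'k^'m::finite" where
  "vals s v = (\<chi> i. s (ix i) v)"

definition of_vals :: "('k^'n \<Rightarrow> 'k^'m::finite) \<Rightarrow> nat \<Rightarrow> 'k^'n \<Rightarrow> 'k" where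
  "of_vals f = (\<lambda>k\<in>{..<CARD('m)}. \<lambda>v. f v $ inv_into UNIV ix k)"

lemma vals_of_vals [simp]: "vals (of_vals f) = (f :: 'k^'n \<Rightarrow> 'k^'m::finite)"
  by (rule ext) (simp add: vals_def of_vals_def ix_less inv_ix vec_eq_iff)

lemma of_vals_vals: 
  assumes "s \<in> extensional {..<CARD('m::finite)}"
  shows "of_vals (vals s :: 'k^'n \<Rightarrow> 'k^'m::finite) = s"
proof
  fix k show "of_vals (vals s :: 'k^'n \<Rightarrow> 'k^'m) k = s k"
  proof (cases "k < CARD('m)")
    case True
    then obtain i :: 'm where "ix i = k" using ix_surj by blast
    then show ?thesis by (auto simp: of_vals_def vals_def ix_less inv_ix)
  next
    case False
    then show ?thesis using assms by (simp add: of_vals_def extensional_def)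
  qed
qed

definition regvec :: "int \<Rightarrow> ('k::field^'n::finite) set set \<Rightarrow> ('k^'n \<Rightarrow> 'k^'m::finite) set" where
  "regvec d W = {f. \<forall>i. (\<lambda>v. f v $ i) \<in> reg d W}"

lemma copies_carrier:
  "carrier (sec (copies CARD('m::finite) (twist proj_space d)) W) = {..<CARD('m)} \<rightarrow>\<^sub>E reg d W"
  by (simp add: copies_def twist_def)

lemma vals_regvec:
  assumes "s \<in> carrier (sec (copies CARD('m::finite) (twist proj_space d)) W)"
  shows "(vals s :: 'k::field^'n::finite \<Rightarrow> 'k^'m::finite) \<in> regvec d W"
proof -
  have "s (ix i) \<in> reg d W" for i :: 'm
    using assms ix_less[of i] unfolding copies_carrier by (auto intro: PiE_mem)
  then show ?thesis by (simp add: regvec_def vals_def)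
qed

lemma of_vals_carrier:
  assumes "(f :: 'k::field^'n::finite \<Rightarrow> 'k^'m::finite) \<in> regvec d W"
  shows "of_vals f \<in> carrier (sec (copies CARD('m) (twist proj_space d)) W)"
  using assms unfolding copies_carrier of_vals_def regvec_def by auto

lemma of_vals_add:
  "of_vals (f :: 'k::field^'n::finite \<Rightarrow> 'k^'m::finite) \<oplus>\<^bsub>sec (copies CARD('m) (twist X d)) W\<^esub> of_vals g
    = of_vals (\<lambda>v. f v + g v)"
  by (auto simp: copies_def twist_def of_vals_def restrict_def fun_eq_iff)

lemma of_vals_smult:
  "r \<odot>\<^bsub>sec (copies CARD('m) (twist X d)) W\<^esub> of_vals (f :: 'k::field^'n::finite \<Rightarrow> 'k^'m::finite)
    = of_vals (\<lambda>v. r v *s f v)"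
  by (auto simp: copies_def twist_def of_vals_def restrict_def fun_eq_iff)

lemma of_vals_res:
  "res (copies CARD('m) (twist X d)) U W (of_vals (f :: 'k::field^'n::finite \<Rightarrow> 'k^'m::finite))
    = of_vals (\<lambda>v. if v \<in> cone W then f v else 0)"
  by (auto simp: copies_def twist_def of_vals_def restrict_def fun_eq_iff)

lemma of_vals_zero: "\<zero>\<^bsub>sec (copies CARD('m) (twist X d)) W\<^esub> = of_vals (\<lambda>v. (0 :: 'k::field^'m::finite))"
  by (auto simp: copies_def twist_def of_vals_def restrict_def fun_eq_iff)

lemma carrier_of_valsE:
  assumes "s \<in> carrier (sec (copies CARD('m::finite) (twist proj_space d)) W)"
  obtains f :: "'k::field^'n::finite \<Rightarrow> 'k^'m" where "s = of_vals f" "f \<in> regvec d W"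
proof -
  have "s \<in> extensional {..<CARD('m)}" using assms unfolding copies_carrier by (auto simp: PiE_def)
  then have "s = of_vals (vals s :: 'k^'n \<Rightarrow> 'k^'m)" by (simp add: of_vals_vals)
  then show ?thesis using that vals_regvec[OF assms] by blast
qed

lemma of_vals_inject: "of_vals f = of_vals g \<longleftrightarrow> f = (g :: 'k^'n \<Rightarrow> 'k^'m::finite)"
  by (metis vals_of_vals)

lemma struct_ring_carrier: "carrier (struct_ring proj_space W) = reg 0 W"
  by (simp add: struct_ring_def)

lemma regvec_add: "zopen W \<Longrightarrow> f \<in> regvec d W \<Longrightarrow> g \<in> regvec d W \<Longrightarrow> (\<lambda>v. f v + g v) \<in> regvec d W"
  by (simp add: regvec_def regular_add)

lemma regvec_smult: "zopen W \<Longrightarrow> r \<in> reg e W \<Longrightarrow> f \<in> regvec d W \<Longrightarrow> (\<lambda>v. r v *s f v) \<in> regvec (e + d) W"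
  by (simp add: regvec_def regular_mult)

lemma regvec_zero: "zopen W \<Longrightarrow> (\<lambda>v. 0) \<in> regvec d W"
  by (simp add: regvec_def regular_zero)

lemma regvec_sum:
  "zopen W \<Longrightarrow> (\<And>j. j \<in> S \<Longrightarrow> f j \<in> regvec d W) \<Longrightarrow> (\<lambda>v. \<Sum>j\<in>S. f j v) \<in> regvec d W"
  by (simp add: regvec_def regular_sum)

lemma regvec_restrict:
  assumes "f \<in> regvec d W" "zopen W" "zopen W'" "W' \<subseteq> W"
  shows "(\<lambda>v. if v \<in> cone W' then f v else 0) \<in> regvec d W'"
proof -
  have "(\<lambda>v. (if v \<in> cone W' then f v else 0) $ i) = (\<lambda>v. if v \<in> cone W' then f v $ i else 0)" for i
    by auto
  then show ?thesis using assms regular_restrict[of "\<lambda>v. f v $ i" d W W' for i] by (simp add: regvec_def)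
qed

lemma regvec_off: "f \<in> regvec d W \<Longrightarrow> v \<notin> cone W \<Longrightarrow> f v = 0"
  using regular_off[of "\<lambda>v. f v $ i" d W v for i] by (simp add: regvec_def vec_eq_iff)

lemma sheaf_homD:
  assumes "sheaf_hom X U F G \<eta>" "openin (zar X) W" "W \<subseteq> U" "s \<in> carrier (sec F W)"
  shows "\<eta> W s \<in> carrier (sec G W)"
    and "t \<in> carrier (sec F W) \<Longrightarrow> \<eta> W (s \<oplus>\<^bsub>sec F W\<^esub> t) = \<eta> W s \<oplus>\<^bsub>sec G W\<^esub> \<eta> W t"
    and "r \<in> carrier (struct_ring X W) \<Longrightarrow> \<eta> W (r \<odot>\<^bsub>sec F W\<^esub> s) = r \<odot>\<^bsub>sec G W\<^esub> \<eta> W s"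
    and "openin (zar X) W' \<Longrightarrow> W' \<subseteq> W \<Longrightarrow> \<eta> W' (res F W W' s) = res G W W' (\<eta> W s)"
  using assms unfolding sheaf_hom_def by simp_all

lemma sheaf_homI:
  assumes "\<And>W s. openin (zar X) W \<Longrightarrow> W \<subseteq> U \<Longrightarrow> s \<in> carrier (sec F W) \<Longrightarrow> \<eta> W s \<in> carrier (sec G W)"
    and "\<And>W s t. openin (zar X) W \<Longrightarrow> W \<subseteq> U \<Longrightarrow> s \<in> carrier (sec F W) \<Longrightarrow> t \<in> carrier (sec F W) \<Longrightarrow>
      \<eta> W (s \<oplus>\<^bsub>sec F W\<^esub> t) = \<eta> W s \<oplus>\<^bsub>sec G W\<^esub> \<eta> W t"
    and "\<And>W s r. openin (zar X) W \<Longrightarrow> W \<subseteq> U \<Longrightarrow> s \<in> carrier (sec F W) \<Longrightarrow> r \<in> carrier (struct_ring X W) \<Longrightarrow>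
      \<eta> W (r \<odot>\<^bsub>sec F W\<^esub> s) = r \<odot>\<^bsub>sec G W\<^esub> \<eta> W s"
    and "\<And>W s V. openin (zar X) W \<Longrightarrow> W \<subseteq> U \<Longrightarrow> s \<in> carrier (sec F W) \<Longrightarrow> openin (zar X) V \<Longrightarrow> V \<subseteq> W \<Longrightarrow>
      \<eta> V (res F W V s) = res G W V (\<eta> W s)"
  shows "sheaf_hom X U F G \<eta>"
  unfolding sheaf_hom_def by (intro allI impI ballI conjI; (elim conjE)?) (rule assms; assumption)+

locale vec_hom =
  fixes \<eta> :: "('k::field, 'n::finite, nat \<Rightarrow> 'k^'n \<Rightarrow> 'k, nat \<Rightarrow> 'k^'n \<Rightarrow> 'k) homs"
    and d e :: int and tm :: "'m::finite itself" and tl :: "'l::finite itself"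
  assumes hom: "sheaf_hom proj_space proj_space (copies CARD('m) (twist proj_space d))
    (copies CARD('l) (twist proj_space e)) \<eta>"
begin

lemmas homD = sheaf_homD[OF hom _ zar_subset]

definition H :: "('k^'n) set set \<Rightarrow> ('k^'n \<Rightarrow> 'k^'m) \<Rightarrow> 'k^'n \<Rightarrow> 'k^'l" where
  "H W f = vals (\<eta> W (of_vals f))"

lemma \<eta>_of_vals:
  assumes "zopen W" "(f :: 'k^'n \<Rightarrow> 'k^'m) \<in> regvec d W"
  shows "\<eta> W (of_vals f) = of_vals (H W f)" "H W f \<in> regvec e W"
proof -
  have "\<eta> W (of_vals f) \<in> carrier (sec (copies CARD('l) (twist proj_space e)) W)"
    using assms of_vals_carrier[OF assms(2)] by (intro homD)
  then show "\<eta> W (of_vals f) = of_vals (H W f)" "H W f \<in> regvec e W"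
    unfolding H_def by (auto elim!: carrier_of_valsE)
qed

lemma H_add:
  assumes "zopen W" "f \<in> regvec d W" "g \<in> regvec d W"
  shows "H W (\<lambda>v. f v + g v) = (\<lambda>v. H W f v + H W g v)"
proof -
  have "\<eta> W (of_vals f \<oplus>\<^bsub>sec (copies CARD('m) (twist proj_space d)) W\<^esub> of_vals g)
    = \<eta> W (of_vals f) \<oplus>\<^bsub>sec (copies CARD('l) (twist proj_space e)) W\<^esub> \<eta> W (of_vals g)"
    using assms of_vals_carrier[OF assms(2)] of_vals_carrier[OF assms(3)] by (intro homD)
  then show ?thesis
    using assms by (simp add: of_vals_add \<eta>_of_vals regvec_add of_vals_inject)
qed

lemma H_smult:
  assumes "zopen W" "f \<in> regvec d W" "r \<in> reg 0 W"
  shows "H W (\<lambda>v. r v *s f v) = (\<lambda>v. r v *s H W f v)"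
proof -
  have "\<eta> W (r \<odot>\<^bsub>sec (copies CARD('m) (twist proj_space d)) W\<^esub> of_vals f)
    = r \<odot>\<^bsub>sec (copies CARD('l) (twist proj_space e)) W\<^esub> \<eta> W (of_vals f)"
    using assms of_vals_carrier[OF assms(2)] by (intro homD) (simp_all add: struct_ring_carrier)
  then show ?thesis
    using assms regvec_smult[OF assms(1,3,2)] by (simp add: of_vals_smult \<eta>_of_vals of_vals_inject)
qed

lemma H_restrict:
  assumes "zopen W" "f \<in> regvec d W" "zopen W'" "W' \<subseteq> W"
  shows "H W' (\<lambda>v. if v \<in> cone W' then f v else 0) = (\<lambda>v. if v \<in> cone W' then H W f v else 0)"
proof -
  have "\<eta> W' (res (copies CARD('m) (twist proj_space d)) W W' (of_vals f))
    = res (copies CARD('l) (twist proj_space e)) W W' (\<eta> W (of_vals f))"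
    using assms of_vals_carrier[OF assms(2)] by (intro homD)
  then show ?thesis
    using assms regvec_restrict[OF assms(2,1,3,4)] by (simp add: of_vals_res \<eta>_of_vals of_vals_inject)
qed

lemma H_zero: "zopen W \<Longrightarrow> H W (\<lambda>v. 0) = (\<lambda>v. 0)"
  using H_smult[of W "\<lambda>v. 0" "\<lambda>v. 0"] by (simp add: regvec_zero regular_zero)

lemma H_sum:
  assumes W: "zopen W" and f: "\<And>j. j \<in> S \<Longrightarrow> f j \<in> regvec d W"
  shows "H W (\<lambda>v. \<Sum>j\<in>S. f j v) = (\<lambda>v. \<Sum>j\<in>S. H W (f j) v)"
  using f
proof (induction S rule: infinite_finite_induct)
  case (insert x F)
  then show ?case using H_add[OF W, of "f x" "\<lambda>v. \<Sum>j\<in>F. f j v"] by (simp add: regvec_sum W)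
qed (simp_all add: H_zero W)

end

section \<open>Morphisms between sums of twists are matrices\<close>

text \<open>The integer power of one coordinate, one of the two exponents being zero; it generates
  O(d) over the chart.\<close>

definition coord_power :: "'n \<Rightarrow> int \<Rightarrow> 'k::field^'n \<Rightarrow> 'k" where
  "coord_power k d v = v $ k ^ nat d / v $ k ^ nat (- d)"

abbreviation chart :: "'n::finite \<Rightarrow> ('k::field^'n) set set" where
  "chart k \<equiv> basic_open (\<lambda>v. v $ k)"

lemma openin_chart: "zopen (chart k)"
  by (rule openin_basic_open[OF form_coord])

lemma cone_chart: "v \<in> cone (chart k) \<longleftrightarrow> v $ k \<noteq> 0"
  by (auto simp: basic_open_cone[OF form_coord])

lemma coord_power_regular: "(\<lambda>v :: 'k::field^'n::finite. if v $ k \<noteq> 0 then coord_power k d v else 0) \<in> reg d (chart k)"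
proof -
  have "(\<lambda>v :: 'k^'n. if v \<in> cone (chart k) then v $ k ^ nat d / v $ k ^ nat (- d) else 0) \<in> reg d (chart k)"
    by (rule regular_quotient[OF openin_chart form_coord_power form_coord_power]) (auto simp: cone_chart)
  then show ?thesis unfolding coord_power_def cone_chart .
qed

lemma coord_power_inverse: "v $ k \<noteq> 0 \<Longrightarrow> coord_power k d v * coord_power k (- d) v = 1"
  by (simp add: coord_power_def)

lemma cone_Int: "v \<in> cone (V \<inter> W) \<longleftrightarrow> v \<in> cone V \<and> v \<in> cone W"
  if "V \<subseteq> proj_space" "W \<subseteq> proj_space"
proof -
  have "V \<inter> W \<subseteq> proj_space" using that by blast
  then show ?thesis using that by (auto simp: punctured_cone_iff)
qed

context vec_hom begin

definition gen :: "'n \<Rightarrow> 'm \<Rightarrow> 'k^'n \<Rightarrow> 'k^'m" where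
  "gen k j v = (if v $ k \<noteq> 0 then axis j (coord_power k d v) else 0)"

lemma gen_regvec: "gen k j \<in> regvec d (chart k)"
proof -
  have "(\<lambda>v. gen k j v $ i) = (if i = j then (\<lambda>v. if v $ k \<noteq> 0 then coord_power k d v else 0) else (\<lambda>v. 0))" for i
    by (auto simp: gen_def axis_def)
  then show ?thesis by (simp add: regvec_def coord_power_regular regular_zero openin_chart del: not_not)
qed

text \<open>The image of a generator of O(d), divided by that generator; this quotient has degree
  \<open>e - d\<close>.\<close>

definition entry :: "'n \<Rightarrow> 'l \<Rightarrow> 'm \<Rightarrow> 'k^'n \<Rightarrow> 'k" where
  "entry k i j v = (if v $ k \<noteq> 0 then coord_power k (- d) v else 0) * H (chart k) (gen k j) v $ i"

lemma entry_regular: "entry k i j \<in> reg (e - d) (chart k)"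
proof -
  have "(\<lambda>v. H (chart k) (gen k j) v $ i) \<in> reg e (chart k)"
    using \<eta>_of_vals(2)[OF openin_chart gen_regvec] by (simp add: regvec_def)
  from regular_mult[OF openin_chart coord_power_regular[of k "- d"] this]
  show ?thesis unfolding entry_def by simp
qed

text \<open>Over the part of \<open>W\<close> in the chart, \<open>f\<close> is a combination of the
  generators with coefficients of degree zero. Linearity over the structure sheaf therefore
  determines the value of the morphism.\<close>

lemma H_entry:
  assumes W: "zopen W" and f: "f \<in> regvec d W" and v: "v \<in> cone W" "v $ k \<noteq> 0"
  shows "H W f v $ i = (\<Sum>j\<in>UNIV. entry k i j v * f v $ j)"
proof -
  let ?W = "W \<inter> chart k"
  have W': "zopen ?W" using W openin_chart by (rule openin_Int)
  have cone_iff: "u \<in> cone ?W \<longleftrightarrow> u \<in> cone W \<and> u $ k \<noteq> 0" for u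
    unfolding cone_Int[OF zar_subset[OF W] zar_subset[OF openin_chart]] cone_chart ..
  let ?r = "\<lambda>j u. if u \<in> cone ?W then coord_power k (- d) u * f u $ j else 0"
  let ?g = "\<lambda>j u. if u \<in> cone ?W then gen k j u else 0"
  have r: "?r j \<in> reg 0 ?W" for j
  proof -
    have 1: "(\<lambda>u. if u \<in> cone ?W then (if u $ k \<noteq> 0 then coord_power k (- d) u else 0) else 0) \<in> reg (- d) ?W"
      using regular_restrict[OF coord_power_regular openin_chart W'] by blast
    have 2: "(\<lambda>u. if u \<in> cone ?W then f u $ j else 0) \<in> reg d ?W"
      using regular_restrict[OF _ W W', of "\<lambda>u. f u $ j" d] f by (simp add: regvec_def)
    have "?r j = (\<lambda>u. (if u \<in> cone ?W then (if u $ k \<noteq> 0 then coord_power k (- d) u else 0) else 0)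
      * (if u \<in> cone ?W then f u $ j else 0))" by (auto simp: cone_iff)
    then show ?thesis using regular_mult[OF W' 1 2] by simp
  qed
  have g: "?g j \<in> regvec d ?W" for j
    using regvec_restrict[OF gen_regvec openin_chart W'] by blast
  have "(if u \<in> cone ?W then f u else 0) = (\<Sum>j\<in>UNIV. ?r j u *s ?g j u)" for u
  proof (cases "u \<in> cone ?W")
    case True
    then have "coord_power k (- d) u * f u $ j * coord_power k d u = f u $ j" for j
      using coord_power_inverse[of u k d] cone_iff by (simp add: mult_ac)
    then show ?thesis using True cone_iff
      by (simp add: vec_eq_iff sum_component gen_def axis_def if_distrib sum.delta cong: if_cong)
  qed simp
  then have "H ?W (\<lambda>u. if u \<in> cone ?W then f u else 0) = H ?W (\<lambda>u. \<Sum>j\<in>UNIV. ?r j u *s ?g j u)" by simp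
  also have "\<dots> = (\<lambda>u. \<Sum>j\<in>UNIV. ?r j u *s H ?W (?g j) u)"
    using H_sum[OF W', of UNIV "\<lambda>j u. ?r j u *s ?g j u"] regvec_smult[OF W' r g] H_smult[OF W' g r] by simp
  also have "\<dots> = (\<lambda>u. \<Sum>j\<in>UNIV. ?r j u *s (if u \<in> cone ?W then H (chart k) (gen k j) u else 0))"
    using H_restrict[OF openin_chart gen_regvec W'] by simp
  finally have "(\<lambda>u. if u \<in> cone ?W then H W f u else 0)
    = (\<lambda>u. \<Sum>j\<in>UNIV. ?r j u *s (if u \<in> cone ?W then H (chart k) (gen k j) u else 0))"
    using H_restrict[OF W f W'] by simp
  from fun_cong[OF this, of v] show ?thesis
    using v cone_iff[of v] by (simp add: entry_def sum_component mult_ac)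
qed

text \<open>The formula for chart \<open>k\<close> is applied to a generator of chart
  \<open>l\<close>. This makes the choice of a coordinate in \<open>Mat\<close> immaterial.\<close>

lemma entry_independent:
  assumes "v $ k \<noteq> 0" "v $ l \<noteq> 0"
  shows "entry k i j v = entry l i j v"
proof -
  have "H (chart l) (gen l j) v $ i = (\<Sum>j'\<in>UNIV. entry k i j' v * gen l j v $ j')"
    by (rule H_entry[OF openin_chart gen_regvec]) (use assms in \<open>simp_all add: cone_chart\<close>)
  also have "\<dots> = entry k i j v * coord_power l d v"
    using assms by (simp add: gen_def axis_def if_distrib sum.delta cong: if_cong)
  finally show ?thesis
    using assms coord_power_inverse[of v l d] by (simp add: entry_def) (metis mult.commute mult.left_commute mult_1)
qed

definition Mat :: "'k^'n \<Rightarrow> 'k^'m^'l" where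
  "Mat v = (\<chi> i j. if v = 0 then 0 else entry (SOME k. v $ k \<noteq> 0) i j v)"

lemma Mat_entry: "v $ k \<noteq> 0 \<Longrightarrow> Mat v $ i $ j = entry k i j v"
  unfolding Mat_def using entry_independent[of v k "SOME k. v $ k \<noteq> 0" i j] someI[of "\<lambda>k. v $ k \<noteq> 0" k]
  by auto

lemma H_Mat:
  assumes W: "zopen W" and f: "f \<in> regvec d W" and v: "v \<in> cone W"
  shows "H W f v = Mat v *v f v"
proof -
  obtain k where k: "v $ k \<noteq> 0" using v by (auto simp: punctured_cone_def vec_eq_iff)
  show ?thesis
    using H_entry[OF W f v k] Mat_entry[OF k] by (simp add: vec_eq_iff matrix_vector_mult_def)
qed

lemma Mat_regular: "(\<lambda>v. Mat v $ i $ j) \<in> reg (e - d) proj_space"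
proof (rule regularI[OF openin_proj_space])
  fix v :: "'k^'n" assume "v \<in> cone proj_space"
  then obtain k where k: "v $ k \<noteq> 0" by (auto simp: punctured_cone_def vec_eq_iff)
  then have "v \<in> cone (chart k)" by (simp add: cone_chart)
  from regular_local[OF entry_regular openin_chart this, of i j]
  obtain a b g h where *: "form a g" "form b h" "int a - int b = e - d" "h v \<noteq> 0"
    "\<forall>u. u \<noteq> 0 \<longrightarrow> h u \<noteq> 0 \<longrightarrow> u \<in> cone (chart k) \<and> entry k i j u = g u / h u" by blast
  have "Mat u $ i $ j = g u / h u" if "u \<in> cone proj_space" "h u \<noteq> 0" for u
    using that * Mat_entry[of u k i j] by (auto simp: punctured_cone_proj_space cone_chart)
  then show "\<exists>a b g h. form a g \<and> form b h \<and> int a - int b = e - d \<and> h v \<noteq> 0 \<and>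
      (\<forall>u\<in>cone proj_space. h u \<noteq> 0 \<longrightarrow> Mat u $ i $ j = g u / h u)"
    using * by blast
qed (simp add: punctured_cone_proj_space Mat_def)

end

lemma regular_uminus:
  assumes "zopen W" "f \<in> reg d W"
  shows "(\<lambda>v. - f v) \<in> reg d W"
proof -
  have "(\<lambda>v. - f v) = (\<lambda>v. (if v \<in> cone W then - 1 else 0) * f v)"
    using regular_off[OF assms(2)] by auto
  then show ?thesis using regular_mult[OF assms(1) regular_const[OF assms(1), of "- 1"] assms(2)] by simp
qed

lemma regvec_uminus: "zopen W \<Longrightarrow> f \<in> regvec d W \<Longrightarrow> (\<lambda>v. - f v) \<in> regvec d W"
  by (simp add: regvec_def regular_uminus)

lemma cone_mono: "W' \<subseteq> W \<Longrightarrow> v \<in> cone W' \<Longrightarrow> v \<in> cone W"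
  by (auto simp: punctured_cone_def)

lemma cone_span: "zopen W \<Longrightarrow> v \<in> cone W \<Longrightarrow> vec.span {v} \<in> W"
  using zar_subset[of proj_space W] punctured_cone_iff[of W v] by blast

section \<open>Monads of sheaves as pairs of matrices of linear forms\<close>

abbreviation "rst W f \<equiv> (\<lambda>v. if v \<in> cone W then f v else 0)"

text \<open>The ranks occur twice, as types for vector-valued functions and as the numbers
  \<open>nm\<close>, \<open>nc\<close>, so that concrete numerals can be matched with
  cardinalities.\<close>

locale sheaf_monad =
  va: vec_hom a "- 1" 0 tc tm +
  vb: vec_hom b 0 1 tm tc
  for a b :: "('k::field, 'n::finite, nat \<Rightarrow> 'k^'n \<Rightarrow> 'k, nat \<Rightarrow> 'k^'n \<Rightarrow> 'k) homs"
    and tc :: "'c::finite itself" and tm :: "'m::finite itself" and nm nc :: nat +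
  assumes dims: "nm = CARD('m)" "nc = CARD('c)"
    and ba: "zopen W \<Longrightarrow> s \<in> carrier (sec (copies nc (twist proj_space (- 1))) W) \<Longrightarrow>
      b W (a W s) = \<zero>\<^bsub>sec (copies nc (twist proj_space 1)) W\<^esub>"
    and inj: "sheaf_injective proj_space proj_space (copies nc (twist proj_space (- 1))) a"
    and surj: "sheaf_surjective proj_space proj_space (copies nm (struct_sheaf proj_space))
      (copies nc (twist proj_space 1)) b"
begin

abbreviation A :: "'k^'n \<Rightarrow> 'k^'c^'m" where "A \<equiv> va.Mat"
abbreviation B :: "'k^'n \<Rightarrow> 'k^'m^'c" where "B \<equiv> vb.Mat"
abbreviation "SA \<equiv> copies nc (twist proj_space (- 1)) :: ('k, 'n, nat \<Rightarrow> 'k^'n \<Rightarrow> 'k) omodule"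
abbreviation "SB \<equiv> copies nm (struct_sheaf proj_space) :: ('k, 'n, nat \<Rightarrow> 'k^'n \<Rightarrow> 'k) omodule"
abbreviation "SC \<equiv> copies nc (twist proj_space 1) :: ('k, 'n, nat \<Rightarrow> 'k^'n \<Rightarrow> 'k) omodule"

lemmas carrier_m = of_vals_carrier[where 'm='m, folded dims] carrier_of_valsE[where 'm='m, folded dims]
lemmas carrier_c = of_vals_carrier[where 'm='c, folded dims] carrier_of_valsE[where 'm='c, folded dims]
lemmas copies_zero = of_vals_zero[where 'm='m, folded dims] of_vals_zero[where 'm='c, folded dims]
lemmas copies_res = of_vals_res[where 'm='m, folded dims] of_vals_res[where 'm='c, folded dims]

text \<open>Local sections of the kernel of \<open>b\<close> as vector functions. The equation may
  be asked at all \<open>v\<close> because \<open>f\<close> is zero off the cone.\<close>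

definition N :: "('k^'n) set set \<Rightarrow> ('k^'n \<Rightarrow> 'k^'m) set" where
  "N W = {f \<in> regvec 0 W. \<forall>v. B v *v f v = 0}"

lemma N_regvec: "f \<in> N W \<Longrightarrow> f \<in> regvec 0 W" and N_ker: "f \<in> N W \<Longrightarrow> B v *v f v = 0"
  by (simp_all add: N_def)

lemma sheaf_ker_eq:
  assumes W: "zopen W"
  shows "sheaf_ker SB SC b W = of_vals ` N W"
proof -
  have *: "b W (of_vals f) = \<zero>\<^bsub>sec SC W\<^esub> \<longleftrightarrow> f \<in> N W" if f: "f \<in> regvec 0 W" for f :: "'k^'n \<Rightarrow> 'k^'m"
  proof -
    have "b W (of_vals f) = \<zero>\<^bsub>sec SC W\<^esub> \<longleftrightarrow> vb.H W f = (\<lambda>v. 0)"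
      by (simp add: vb.\<eta>_of_vals(1)[OF W f] copies_zero of_vals_inject)
    also have "\<dots> \<longleftrightarrow> (\<forall>v. B v *v f v = 0)"
    proof -
      have "vb.H W f v = B v *v f v" for v
        using vb.H_Mat[OF W f] regvec_off[OF f, of v] regvec_off[OF vb.\<eta>_of_vals(2)[OF W f], of v]
        by (cases "v \<in> cone W") auto
      then show ?thesis by (simp add: fun_eq_iff)
    qed
    finally show ?thesis using f by (simp add: N_def)
  qed
  show ?thesis
  proof (intro equalityI subsetI)
    fix s assume "s \<in> sheaf_ker SB SC b W"
    then have s: "s \<in> carrier (sec SB W)" "b W s = \<zero>\<^bsub>sec SC W\<^esub>" by (simp_all add: sheaf_ker_def)
    obtain f :: "'k^'n \<Rightarrow> 'k^'m" where "s = of_vals f" "f \<in> regvec 0 W" by (rule carrier_m(2)[OF s(1)])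
    then show "s \<in> of_vals ` N W" using * s(2) by blast
  next
    fix s assume "s \<in> of_vals ` N W"
    then obtain f where f: "s = of_vals f" "f \<in> N W" by blast
    have "of_vals f \<in> carrier (sec SB W)" using carrier_m(1)[OF N_regvec[OF f(2)]] .
    then show "s \<in> sheaf_ker SB SC b W" using * f N_regvec by (simp add: sheaf_ker_def)
  qed
qed

text \<open>Near \<open>v\<close> there is a section of O(-1)^c whose value at \<open>v\<close> is a
  nonzero multiple of \<open>u\<close>; the composite vanishes on it.\<close>

lemma B_A: "B v *v (A v *v u) = 0"
proof (cases "v = 0")
  case True
  then show ?thesis by (simp add: va.Mat_def matrix_vector_mult_def zero_vec_def)
next
  case False
  then obtain k where k: "v $ k \<noteq> 0" by (auto simp: vec_eq_iff)
  let ?f = "\<lambda>x. \<Sum>j\<in>UNIV. rst (chart k) (\<lambda>_. u $ j) x *s va.gen k j x"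
  note W = openin_chart[of k]
  have f: "?f \<in> regvec (- 1) (chart k)"
    by (intro regvec_sum[OF W]) (use regvec_smult[OF W regular_const[OF W] va.gen_regvec] in simp)
  have v: "v \<in> cone (chart k)" using k by (simp add: cone_chart)
  have "b (chart k) (a (chart k) (of_vals ?f)) = \<zero>\<^bsub>sec SC (chart k)\<^esub>"
    using ba[OF W carrier_c(1)[OF f]] .
  then have "vb.H (chart k) (va.H (chart k) ?f) = (\<lambda>v. 0)"
    using va.\<eta>_of_vals[OF W f] vb.\<eta>_of_vals[OF W va.\<eta>_of_vals(2)[OF W f]]
    by (simp add: copies_zero of_vals_inject)
  then have "B v *v (A v *v ?f v) = 0"
    using vb.H_Mat[OF W va.\<eta>_of_vals(2)[OF W f] v] va.H_Mat[OF W f v] by simp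
  moreover have "?f v = coord_power k (- 1) v *s u"
    using k by (simp add: vec_eq_iff va.gen_def cone_chart axis_def if_distrib sum.delta mult.commute cong: if_cong)
  ultimately have "coord_power k (- 1) v *s (B v *v (A v *v u)) = 0" by (simp add: vec.scale)
  moreover have "coord_power k (- 1) v \<noteq> 0" using k by (simp add: coord_power_def)
  ultimately show ?thesis by (simp add: vec_eq_iff)
qed

text \<open>The section of O(1)^c given by a coordinate times \<open>y\<close> lifts near
  \<open>v\<close>, and its value at \<open>v\<close> is a nonzero multiple of
  \<open>y\<close>.\<close>

lemma B_surj:
  assumes "v \<noteq> 0"
  shows "\<exists>n. B v *v n = y"
proof -
  obtain k where k: "v $ k \<noteq> 0" using assms by (auto simp: vec_eq_iff)
  let ?t = "\<lambda>x. rst (chart k) (\<lambda>x. x $ k) x"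
  note W = openin_chart[of k]
  have v: "v \<in> cone (chart k)" using k by (simp add: cone_chart)
  have t: "(\<lambda>x. ?t x *s y) \<in> regvec 1 (chart k)"
  proof -
    have "(\<lambda>x. rst (chart k) (\<lambda>x. x $ k / 1) x) \<in> reg 1 (chart k)"
      by (rule regular_quotient[OF W form_coord form_const]) auto
    then have t1: "?t \<in> reg 1 (chart k)" by (simp cong: if_cong)
    have "(\<lambda>x. ?t x * y $ i) \<in> reg 1 (chart k)" for i
    proof -
      have "(\<lambda>x. ?t x * y $ i) = (\<lambda>x. ?t x * rst (chart k) (\<lambda>_. y $ i) x)" by auto
      then show ?thesis using regular_mult[OF W t1 regular_const[OF W, of "y $ i"]] by simp
    qed
    then show ?thesis by (simp add: regvec_def)
  qed
  have "of_vals (\<lambda>x. ?t x *s y) \<in> sheaf_im proj_space SB SC b (chart k)"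
    using surj W zar_subset[OF W] carrier_c(1)[OF t] unfolding sheaf_surjective_def by blast
  then obtain W' s where W': "zopen W'" "vec.span {v} \<in> W'" "W' \<subseteq> chart k"
    and s: "s \<in> carrier (sec SB W')" "b W' s = res SC (chart k) W' (of_vals (\<lambda>x. ?t x *s y))"
    using cone_span[OF W v] unfolding sheaf_im_def by blast
  obtain f :: "'k^'n \<Rightarrow> 'k^'m" where f: "s = of_vals f" "f \<in> regvec 0 W'" by (rule carrier_m(2)[OF s(1)])
  have v': "v \<in> cone W'" using W' assms zar_subset[OF W'(1)] by (simp add: punctured_cone_iff)
  have "vb.H W' f = (\<lambda>x. rst W' (\<lambda>x. ?t x *s y) x)"
    using s(2) f vb.\<eta>_of_vals[OF W'(1) f(2)] by (simp add: copies_res of_vals_inject)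
  then have "B v *v f v = v $ k *s y" using vb.H_Mat[OF W'(1) f(2) v'] v' v by simp
  then have "B v *v ((1 / v $ k) *s f v) = y" using k by (simp add: vec.scale)
  then show ?thesis by blast
qed

text \<open>Equality of germs at \<open>p\<close> modulo the image of \<open>a\<close>.\<close>

definition eqv :: "('k^'n) set \<Rightarrow> ('k^'n \<Rightarrow> 'k^'m) \<Rightarrow> ('k^'n \<Rightarrow> 'k^'m) \<Rightarrow> bool" where
  "eqv p f g \<longleftrightarrow> (\<exists>W u. zopen W \<and> p \<in> W \<and> u \<in> regvec (- 1) W \<and>
     (\<forall>x\<in>cone W. f x - g x = A x *v u x))"

lemma eqv_local:
  assumes "zopen W" "p \<in> W" "\<And>x. x \<in> cone W \<Longrightarrow> f x = g x"
  shows "eqv p f g"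
  unfolding eqv_def using assms by (intro exI[of _ W] exI[of _ "\<lambda>_. 0"]) (simp add: regvec_zero)

lemma eqv_sym: "eqv p f g \<Longrightarrow> eqv p g f"
proof -
  assume "eqv p f g"
  then obtain W u where *: "zopen W" "p \<in> W" "u \<in> regvec (- 1) W"
    "\<forall>x\<in>cone W. f x - g x = A x *v u x" unfolding eqv_def by blast
  have "g x - f x = A x *v (- u x)" if "x \<in> cone W" for x
    using *(4) that by (simp add: vec.neg) (metis minus_diff_eq)
  then show ?thesis unfolding eqv_def
    using *(1-3) regvec_uminus[OF *(1,3)] by (intro exI[of _ W] exI[of _ "\<lambda>x. - u x"]) simp
qed

lemma eqv_add:
  assumes "eqv p f g" "eqv p f' g'"
  shows "eqv p (\<lambda>v. f v + f' v) (\<lambda>v. g v + g' v)"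
proof -
  obtain W u where *: "zopen W" "p \<in> W" "u \<in> regvec (- 1) W"
    "\<And>x. x \<in> cone W \<Longrightarrow> f x - g x = A x *v u x" using assms(1) unfolding eqv_def by blast
  obtain W' u' where **: "zopen W'" "p \<in> W'" "u' \<in> regvec (- 1) W'"
    "\<And>x. x \<in> cone W' \<Longrightarrow> f' x - g' x = A x *v u' x" using assms(2) unfolding eqv_def by blast
  let ?W = "W \<inter> W'"
  have W: "zopen ?W" using *(1) **(1) by (rule openin_Int)
  have "(\<lambda>x. rst ?W u x + rst ?W u' x) \<in> regvec (- 1) ?W"
    by (intro regvec_add W regvec_restrict[OF *(3,1) W] regvec_restrict[OF **(3,1) W]) auto
  moreover have "(f x + f' x) - (g x + g' x) = A x *v (rst ?W u x + rst ?W u' x)" if "x \<in> cone ?W" for x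
  proof -
    have "(f x + f' x) - (g x + g' x) = (f x - g x) + (f' x - g' x)" by simp
    then show ?thesis
      using that *(4)[of x] **(4)[of x] cone_mono[of ?W W x] cone_mono[of ?W W' x]
      by (simp add: matrix_vector_right_distrib)
  qed
  ultimately show ?thesis unfolding eqv_def using *(2) **(2) W
    by (intro exI[of _ ?W] exI[of _ "\<lambda>x. rst ?W u x + rst ?W u' x"]) simp
qed

lemma eqv_trans: 
  assumes "eqv p f g" "eqv p g h"
  shows "eqv p f h"
proof -
  \<comment> \<open>In the sum of the two relations the middle term \<open>g\<close>
    cancels.\<close>
  obtain W u where *: "zopen W" "p \<in> W" "u \<in> regvec (- 1) W"
    "\<forall>x\<in>cone W. (f x + g x) - (g x + h x) = A x *v u x"
    using eqv_add[OF assms] unfolding eqv_def by blast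
  then show ?thesis unfolding eqv_def by (intro exI[of _ W] exI[of _ u]) (simp add: algebra_simps)
qed

lemma eqv_smult:
  assumes "eqv p f g" "zopen V" "p \<in> V" "r \<in> reg 0 V"
    and "\<And>x. x \<in> cone V \<Longrightarrow> r x = r' x"
  shows "eqv p (\<lambda>v. r v *s f v) (\<lambda>v. r' v *s g v)"
proof -
  obtain W u where *: "zopen W" "p \<in> W" "u \<in> regvec (- 1) W"
    "\<And>x. x \<in> cone W \<Longrightarrow> f x - g x = A x *v u x" using assms(1) unfolding eqv_def by blast
  let ?W = "W \<inter> V"
  have W: "zopen ?W" using *(1) assms(2) by (rule openin_Int)
  have "(\<lambda>x. rst ?W r x *s rst ?W u x) \<in> regvec (0 + - 1) ?W"
    by (intro regvec_smult W regvec_restrict[OF *(3,1) W] regular_restrict[OF assms(4,2) W]) auto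
  moreover have "r x *s f x - r' x *s g x = A x *v (rst ?W r x *s rst ?W u x)" if x: "x \<in> cone ?W" for x
  proof -
    have "r' x = r x" using assms(5) cone_mono[OF _ x, of V] by auto
    then have "r x *s f x - r' x *s g x = r x *s (f x - g x)" by (simp add: vec_eq_iff algebra_simps)
    then show ?thesis using x *(4)[of x] cone_mono[of ?W W x] by (simp add: vec.scale)
  qed
  ultimately show ?thesis unfolding eqv_def using *(2) assms(3) W
    by (intro exI[of _ ?W] exI[of _ "\<lambda>x. rst ?W r x *s rst ?W u x"]) simp
qed

lemma eqv_value:
  assumes "eqv p f g" "v \<in> p" "v \<noteq> 0"
  shows "f v - g v \<in> range ((*v) (A v))"
  using assms unfolding eqv_def punctured_cone_def by fastforce

lemma N_add: "zopen W \<Longrightarrow> f \<in> N W \<Longrightarrow> g \<in> N W \<Longrightarrow> (\<lambda>v. f v + g v) \<in> N W"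
  by (simp add: N_def regvec_add matrix_vector_right_distrib)

lemma N_smult: "zopen W \<Longrightarrow> f \<in> N W \<Longrightarrow> r \<in> reg 0 W \<Longrightarrow> (\<lambda>v. r v *s f v) \<in> N W"
  using regvec_smult[of W r 0 f 0] by (simp add: N_def vec.scale)

lemma N_zero: "zopen W \<Longrightarrow> (\<lambda>v. 0) \<in> N W"
  by (simp add: N_def regvec_zero)

lemma N_uminus: "zopen W \<Longrightarrow> f \<in> N W \<Longrightarrow> (\<lambda>v. - f v) \<in> N W"
  by (simp add: N_def regvec_uminus vec.neg)

lemma N_restrict:
  "f \<in> N W \<Longrightarrow> zopen W \<Longrightarrow> zopen W' \<Longrightarrow> W' \<subseteq> W \<Longrightarrow> rst W' f \<in> N W'"
  using regvec_restrict[of f 0 W W'] by (simp add: N_def)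

section \<open>The cohomology sheaf of a monad\<close>

abbreviation "NN \<equiv> subsheaf SB (sheaf_ker SB SC b)"
abbreviation "IM \<equiv> sheaf_im proj_space SA SB a"
abbreviation "HH \<equiv> cohomology proj_space SA SB SC a b"
abbreviation "G p W f \<equiv> germ proj_space NN IM p W (of_vals f)"

lemma NN_carrier: "zopen W \<Longrightarrow> carrier (sec NN W) = of_vals ` N W"
  by (simp add: subsheaf_def sheaf_ker_eq)

lemma NN_add: "of_vals f \<oplus>\<^bsub>sec NN W\<^esub> of_vals g = of_vals (\<lambda>v. f v + g v :: 'k^'m)"
  using of_vals_add[where f=f and g=g and X=proj_space and d=0 and W=W, folded dims] by (simp add: subsheaf_def)

lemma NN_smult: "r \<odot>\<^bsub>sec NN W\<^esub> of_vals f = of_vals (\<lambda>v. r v *s f v :: 'k^'m)"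
  using of_vals_smult[where r=r and f=f and X=proj_space and d=0 and W=W, folded dims] by (simp add: subsheaf_def)

lemma NN_zero: "\<zero>\<^bsub>sec NN W\<^esub> = of_vals (\<lambda>v. (0 :: 'k^'m))"
  using copies_zero(1)[where X=proj_space and d=0 and W=W] by (simp add: subsheaf_def)

lemma NN_res: "res NN U W (of_vals f) = of_vals (rst W f :: 'k^'n \<Rightarrow> 'k^'m)"
  using copies_res(1)[where f=f and X=proj_space and d=0 and U=U and W=W] by (simp add: subsheaf_def)

text \<open>The additive inverse of a record is a definite description, so its existence and
  uniqueness are checked on representatives.\<close>

lemma NN_minus:
  assumes W: "zopen W" and g: "g \<in> N W"
  shows "of_vals f \<ominus>\<^bsub>sec NN W\<^esub> of_vals g = of_vals (\<lambda>v. f v - g v)"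
proof -
  have "\<ominus>\<^bsub>sec NN W\<^esub> of_vals g = of_vals (\<lambda>v. - g v)"
    unfolding a_inv_def m_inv_def
  proof (rule the_equality)
    show "of_vals (\<lambda>v. - g v) \<in> carrier (add_monoid (sec NN W)) \<and>
      of_vals g \<otimes>\<^bsub>add_monoid (sec NN W)\<^esub> of_vals (\<lambda>v. - g v) = \<one>\<^bsub>add_monoid (sec NN W)\<^esub> \<and>
      of_vals (\<lambda>v. - g v) \<otimes>\<^bsub>add_monoid (sec NN W)\<^esub> of_vals g = \<one>\<^bsub>add_monoid (sec NN W)\<^esub>"
      using N_uminus[OF W g] by (simp add: NN_carrier[OF W] NN_add NN_zero)
    fix y assume y: "y \<in> carrier (add_monoid (sec NN W)) \<and>
      of_vals g \<otimes>\<^bsub>add_monoid (sec NN W)\<^esub> y = \<one>\<^bsub>add_monoid (sec NN W)\<^esub> \<and>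
      y \<otimes>\<^bsub>add_monoid (sec NN W)\<^esub> of_vals g = \<one>\<^bsub>add_monoid (sec NN W)\<^esub>"
    then obtain h where h: "y = of_vals h" "h \<in> N W" using NN_carrier[OF W] by auto
    then have "of_vals (\<lambda>v. g v + h v) = of_vals (\<lambda>v. (0 :: 'k^'m))" using y by (simp add: NN_add NN_zero)
    then have "(\<lambda>v. g v + h v) = (\<lambda>v. 0)" unfolding of_vals_inject .
    then have "g v + h v = 0" for v by (rule fun_cong)
    then have "h = (\<lambda>v. - g v)" by (intro ext) (metis add_eq_0_iff)
    then show "y = of_vals (\<lambda>v. - g v)" using h by simp
  qed
  then show ?thesis by (simp add: a_minus_def NN_add)
qed

text \<open>A section of the image of \<open>a\<close> lifts through \<open>a\<close> near each of
  its points, and \<open>eqv\<close> asks for one lift near \<open>p\<close>. After shrinking the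
  neighbourhood the two conditions agree, and germs need not be unfolded again.\<close>

lemma germ_mem:
  assumes U: "zopen U" "p \<in> U" and f: "f \<in> N U"
  shows "(U', s) \<in> G p U f \<longleftrightarrow> zopen U' \<and> p \<in> U' \<and> (\<exists>g\<in>N U'. s = of_vals g \<and> eqv p f g)"
proof -
  have *: "(\<exists>W. zopen W \<and> p \<in> W \<and> W \<subseteq> U \<inter> U' \<and>
      res NN U W (of_vals f) \<ominus>\<^bsub>sec NN W\<^esub> res NN U' W (of_vals g) \<in> IM W) \<longleftrightarrow> eqv p f g" (is "?L \<longleftrightarrow> ?R")
    if U': "zopen U'" "p \<in> U'" and g: "g \<in> N U'" for g
  proof
    assume ?L
    then obtain W where W: "zopen W" "p \<in> W" "W \<subseteq> U \<inter> U'"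
      "res NN U W (of_vals f) \<ominus>\<^bsub>sec NN W\<^esub> res NN U' W (of_vals g) \<in> IM W" by blast
    have "rst W g \<in> N W" using N_restrict[OF g U'(1) W(1)] W(3) by blast
    then have "of_vals (\<lambda>v. rst W f v - rst W g v) \<in> IM W"
      using W(4) NN_minus[OF W(1), of "rst W g" "rst W f"] by (simp only: NN_res)
    then obtain W' s where W': "zopen W'" "p \<in> W'" "W' \<subseteq> W" "s \<in> carrier (sec SA W')"
      "a W' s = res SB W W' (of_vals (\<lambda>v. rst W f v - rst W g v))"
      using W(2) unfolding sheaf_im_def by blast
    obtain u :: "'k^'n \<Rightarrow> 'k^'c" where u: "s = of_vals u" "u \<in> regvec (- 1) W'" by (rule carrier_c(2)[OF W'(4)])
    have "va.H W' u = rst W' (\<lambda>v. rst W f v - rst W g v)"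
      using W'(5) u va.\<eta>_of_vals[OF W'(1) u(2)] by (simp add: copies_res of_vals_inject)
    then have "f x - g x = A x *v u x" if "x \<in> cone W'" for x
      using that va.H_Mat[OF W'(1) u(2) that] cone_mono[OF W'(3) that] by simp
    then show ?R unfolding eqv_def using W' u by blast
  next
    assume ?R
    then obtain V u where V: "zopen V" "p \<in> V" "u \<in> regvec (- 1) V"
      "\<And>x. x \<in> cone V \<Longrightarrow> f x - g x = A x *v u x" unfolding eqv_def by blast
    let ?W = "V \<inter> (U \<inter> U')"
    have W: "zopen ?W" using V(1) U(1) U'(1) by (intro openin_Int)
    have rg: "rst ?W g \<in> N ?W" and rf: "rst ?W f \<in> N ?W"
      using N_restrict[OF g U'(1) W] N_restrict[OF f U(1) W] by auto
    have u: "rst ?W u \<in> regvec (- 1) ?W" using regvec_restrict[OF V(3,1) W] by auto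
    have H: "va.H ?W (rst ?W u) = (\<lambda>v. rst ?W f v - rst ?W g v)"
    proof
      fix x show "va.H ?W (rst ?W u) x = rst ?W f x - rst ?W g x"
        using va.H_Mat[OF W u, of x] V(4)[of x] cone_mono[of ?W V x]
          regvec_off[OF va.\<eta>_of_vals(2)[OF W u], of x]
        by (cases "x \<in> cone ?W") auto
    qed
    have au: "a ?W (of_vals (rst ?W u)) = of_vals (\<lambda>v. rst ?W f v - rst ?W g v)"
      using va.\<eta>_of_vals(1)[OF W u] by (simp only: H)
    have rr: "res SB ?W ?W (of_vals (\<lambda>v. rst ?W f v - rst ?W g v)) = of_vals (\<lambda>v. rst ?W f v - rst ?W g v)"
      unfolding copies_res by (rule arg_cong[of _ _ of_vals]) auto
    have ar: "a ?W (of_vals (rst ?W u)) = res SB ?W ?W (of_vals (\<lambda>v. rst ?W f v - rst ?W g v))"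
      by (simp only: au rr)
    have "of_vals (\<lambda>v. rst ?W f v - rst ?W g v) \<in> carrier (sec SB ?W)"
      using carrier_m(1)[OF va.\<eta>_of_vals(2)[OF W u]] by (simp only: H)
    moreover have "\<exists>W'. zopen W' \<and> q \<in> W' \<and> W' \<subseteq> ?W \<and>
        (\<exists>s\<in>carrier (sec SA W'). a W' s = res SB ?W W' (of_vals (\<lambda>v. rst ?W f v - rst ?W g v)))" if "q \<in> ?W" for q
      by (intro exI[of _ ?W] conjI bexI[of _ "of_vals (rst ?W u)"] W that ar carrier_c(1)[OF u] order_refl)
    ultimately have "of_vals (\<lambda>v. rst ?W f v - rst ?W g v) \<in> IM ?W"
      unfolding sheaf_im_def by (intro CollectI conjI ballI)
    then have "res NN U ?W (of_vals f) \<ominus>\<^bsub>sec NN ?W\<^esub> res NN U' ?W (of_vals g) \<in> IM ?W"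
      by (simp only: NN_res NN_minus[OF W rg])
    then show ?L using W V(2) U(2) U'(2) by (intro exI[of _ ?W]) auto
  qed
  have iff: "(U', s) \<in> G p U f \<longleftrightarrow> zopen U' \<and> p \<in> U' \<and> s \<in> carrier (sec NN U') \<and>
      (\<exists>W. zopen W \<and> p \<in> W \<and> W \<subseteq> U \<inter> U' \<and>
        res NN U W (of_vals f) \<ominus>\<^bsub>sec NN W\<^esub> res NN U' W s \<in> IM W)"
    by (simp add: germ_def)
  show ?thesis
  proof (cases "zopen U' \<and> p \<in> U'")
    case True
    then have "s \<in> carrier (sec NN U') \<longleftrightarrow> (\<exists>g\<in>N U'. s = of_vals g)" by (auto simp: NN_carrier)
    then show ?thesis using iff * True by metis
  next
    case False
    then show ?thesis unfolding iff by blast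
  qed
qed

lemma germ_self:
  assumes U: "zopen U" "p \<in> U" and f: "f \<in> N U"
  shows "(U, of_vals f) \<in> G p U f"
  unfolding germ_mem[OF assms] using assms eqv_local[OF U, of f f] by auto

lemma germ_eq:
  assumes U: "zopen U" "p \<in> U" "f \<in> N U" and U': "zopen U'" "p \<in> U'" "g \<in> N U'"
  shows "G p U f = G p U' g \<longleftrightarrow> eqv p f g"
proof
  assume "G p U f = G p U' g"
  moreover have "(U', of_vals g) \<in> G p U' g"
    by (rule germ_self[OF U'])
  ultimately have "(U', of_vals g) \<in> G p U f" by simp
  then show "eqv p f g" by (auto simp: germ_mem[OF U] of_vals_inject)
next
  assume e: "eqv p f g"
  have "(V, s) \<in> G p U f \<longleftrightarrow> (V, s) \<in> G p U' g" for V s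
    unfolding germ_mem[OF U] germ_mem[OF U'] using eqv_trans e eqv_sym by blast
  then show "G p U f = G p U' g" by auto
qed

text \<open>The section of the cohomology sheaf represented by a vector function with values in the
  kernel.\<close>

definition br :: "('k^'n) set set \<Rightarrow> ('k^'n \<Rightarrow> 'k^'m) \<Rightarrow> ('k^'n) set \<Rightarrow> (('k^'n) set set \<times> (nat \<Rightarrow> 'k^'n \<Rightarrow> 'k)) set" where
  "br W f = (\<lambda>p\<in>W. G p W f)"

lemma HH_carrier: "carrier (sec HH V) = {\<sigma> \<in> extensional V. \<forall>p\<in>V. \<exists>U s. zopen U \<and> p \<in> U \<and>
   s \<in> carrier (sec NN U) \<and> (\<forall>q\<in>U \<inter> V. \<sigma> q = germ proj_space NN IM q U s)}"
  by (simp add: cohomology_def germ_sheaf_def)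

lemma br_carrier:
  assumes "zopen W" "f \<in> N W"
  shows "br W f \<in> carrier (sec HH W)"
  unfolding HH_carrier br_def using assms NN_carrier by fastforce

lemma br_eq:
  assumes "zopen W" "f \<in> N W" "g \<in> N W"
  shows "br W f = br W g \<longleftrightarrow> (\<forall>p\<in>W. eqv p f g)"
proof -
  have "br W f = br W g \<longleftrightarrow> (\<forall>p\<in>W. G p W f = G p W g)"
    unfolding br_def by (auto simp: fun_eq_iff restrict_def)
  then show ?thesis using germ_eq assms by blast
qed

text \<open>The union that defines addition of germs runs over a family with exactly one member, as
  \<open>eqv\<close> respects sums.\<close>

lemma br_add:
  assumes W: "zopen W" and f: "f \<in> N W" and g: "g \<in> N W"
  shows "br W f \<oplus>\<^bsub>sec HH W\<^esub> br W g = br W (\<lambda>v. f v + g v)"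
proof -
  have "(\<Union>{germ proj_space NN IM p U (s \<oplus>\<^bsub>sec NN U\<^esub> t) | U s t. (U, s) \<in> G p W f \<and> (U, t) \<in> G p W g})
    = G p W (\<lambda>v. f v + g v)" (is "\<Union>?S = _") if p: "p \<in> W" for p
  proof -
    have "X = G p W (\<lambda>v. f v + g v)" if XS: "X \<in> ?S" for X
    proof -
      obtain U s t where X: "X = germ proj_space NN IM p U (s \<oplus>\<^bsub>sec NN U\<^esub> t)" "(U, s) \<in> G p W f" "(U, t) \<in> G p W g"
        using XS by blast
      then obtain f' g' where U: "zopen U" "p \<in> U" and f': "f' \<in> N U" "s = of_vals f'" "eqv p f f'"
        and g': "g' \<in> N U" "t = of_vals g'" "eqv p g g'"
        using germ_mem[OF W p f] germ_mem[OF W p g] by blast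
      have "X = G p U (\<lambda>v. f' v + g' v)" using X f' g' by (simp only: NN_add)
      also have "\<dots> = G p W (\<lambda>v. f v + g v)"
        using germ_eq[OF U N_add[OF U(1) f'(1) g'(1)] W p N_add[OF W f g]] eqv_add[OF f'(3) g'(3)] eqv_sym by blast
      finally show ?thesis .
    qed
    moreover have "G p W (\<lambda>v. f v + g v) \<in> ?S"
    proof -
      have "(W, of_vals f) \<in> G p W f" "(W, of_vals g) \<in> G p W g"
        by (rule germ_self[OF W p f], rule germ_self[OF W p g])
      then show ?thesis by (intro CollectI exI[of _ W] exI[of _ "of_vals f"] exI[of _ "of_vals g"]) (simp add: NN_add)
    qed
    ultimately have "?S = {G p W (\<lambda>v. f v + g v)}" by blast
    then show ?thesis by (simp only: Union_insert Union_empty Un_empty_right)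
  qed
  then show ?thesis
    by (simp add: cohomology_def germ_sheaf_def br_def restrict_def fun_eq_iff)
qed

lemma br_smult:
  assumes W: "zopen W" and f: "f \<in> N W" and r: "r \<in> reg 0 W"
  shows "r \<odot>\<^bsub>sec HH W\<^esub> br W f = br W (\<lambda>v. r v *s f v)"
proof -
  have "(\<Union>{germ proj_space NN IM p U (h \<odot>\<^bsub>sec NN U\<^esub> s) | U h s. (U, s) \<in> G p W f \<and>
      h \<in> carrier (struct_ring proj_space U) \<and> (\<forall>v\<in>cone (U \<inter> W). h v = r v)})
    = G p W (\<lambda>v. r v *s f v)" (is "\<Union>?S = _") if p: "p \<in> W" for p
  proof -
    have "X = G p W (\<lambda>v. r v *s f v)" if XS: "X \<in> ?S" for X
    proof -
      obtain U h s where X: "X = germ proj_space NN IM p U (h \<odot>\<^bsub>sec NN U\<^esub> s)" "(U, s) \<in> G p W f"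
        "h \<in> carrier (struct_ring proj_space U)" "\<forall>v\<in>cone (U \<inter> W). h v = r v"
        using XS by blast
      then obtain f' where U: "zopen U" "p \<in> U" and f': "f' \<in> N U" "s = of_vals f'" "eqv p f f'"
        using germ_mem[OF W p f] by blast
      have h: "h \<in> reg 0 U" using X(3) by (simp add: struct_ring_carrier)
      have UW: "zopen (U \<inter> W)" using U(1) W by (rule openin_Int)
      have "eqv p (\<lambda>v. r v *s f v) (\<lambda>v. rst (U \<inter> W) r v *s f v)" 
        by (rule eqv_local[OF UW]) (use U p in auto)
      moreover have "eqv p (\<lambda>v. rst (U \<inter> W) r v *s f v) (\<lambda>v. h v *s f' v)"
        by (rule eqv_smult[OF f'(3) UW]) (use U p X(4) regular_restrict[OF r W UW] in auto)
      ultimately have e: "eqv p (\<lambda>v. h v *s f' v) (\<lambda>v. r v *s f v)" using eqv_trans eqv_sym by blast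
      have "X = G p U (\<lambda>v. h v *s f' v)" using X f' by (simp only: NN_smult)
      also have "\<dots> = G p W (\<lambda>v. r v *s f v)"
        using germ_eq[OF U N_smult[OF U(1) f'(1) h] W p N_smult[OF W f r]] e by blast
      finally show ?thesis .
    qed
    moreover have "G p W (\<lambda>v. r v *s f v) \<in> ?S"
    proof -
      have "(W, of_vals f) \<in> G p W f" by (rule germ_self[OF W p f])
      then show ?thesis using r
        by (intro CollectI exI[of _ W] exI[of _ r] exI[of _ "of_vals f"]) (simp add: NN_smult struct_ring_carrier)
    qed
    ultimately have "?S = {G p W (\<lambda>v. r v *s f v)}" by blast
    then show ?thesis by (simp only: Union_insert Union_empty Un_empty_right)
  qed
  then show ?thesis
    by (simp add: cohomology_def germ_sheaf_def br_def restrict_def fun_eq_iff)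
qed

lemma br_res:
  assumes "zopen W" "f \<in> N W" "zopen W'" "W' \<subseteq> W"
  shows "res HH W W' (br W f) = br W' (rst W' f)"
proof -
  have "G p W f = G p W' (rst W' f)" if "p \<in> W'" for p
    using germ_eq[OF assms(1) _ assms(2) assms(3) that N_restrict[OF assms(2,1,3,4)]] that assms(4)
      eqv_local[OF assms(3) that, of f "rst W' f"] by auto
  then show ?thesis using assms(4)
    by (auto simp: cohomology_def germ_sheaf_def br_def fun_eq_iff)
qed

lemma br_local:
  assumes V: "zopen V" and \<sigma>: "\<sigma> \<in> carrier (sec HH V)" and p: "p \<in> V"
  shows "\<exists>U f. zopen U \<and> p \<in> U \<and> U \<subseteq> V \<and> f \<in> N U \<and> res HH V U \<sigma> = br U f"
proof -
  obtain U s where U: "zopen U" "p \<in> U" "s \<in> carrier (sec NN U)"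
    "\<forall>q\<in>U \<inter> V. \<sigma> q = germ proj_space NN IM q U s" using \<sigma> p unfolding HH_carrier by blast
  then obtain f where f: "s = of_vals f" "f \<in> N U" using NN_carrier by blast
  let ?U = "U \<inter> V"
  have UV: "zopen ?U" using U(1) V by (rule openin_Int)
  have "res HH V ?U \<sigma> = restrict \<sigma> ?U" by (simp add: cohomology_def germ_sheaf_def)
  also have "\<dots> = br ?U (rst ?U f)"
  proof -
    have "\<sigma> q = G q ?U (rst ?U f)" if "q \<in> ?U" for q
      using U(4) f that germ_eq[OF U(1) _ f(2) UV that N_restrict[OF f(2) U(1) UV]]
        eqv_local[OF UV that, of f "rst ?U f"] by auto
    then show ?thesis by (auto simp: br_def fun_eq_iff restrict_def)
  qed
  finally show ?thesis using UV U(2) p N_restrict[OF f(2) U(1) UV]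
    by (intro exI[of _ ?U] exI[of _ "rst ?U f"]) auto
qed

end

locale sheaf_presentation = sheaf_monad a b tc tm nm nc
  for a b :: "('k::{alg_closed_field,field_char_0}, 'n::finite, nat \<Rightarrow> 'k^'n \<Rightarrow> 'k, nat \<Rightarrow> 'k^'n \<Rightarrow> 'k) homs"
    and tc :: "2 itself" and tm :: "'m::finite itself" and nm nc :: nat +
  fixes E :: "('k, 'n, 'a) omodule" and \<eta> :: "('k, 'n, 'a, ('k^'n) set \<Rightarrow> (('k^'n) set set \<times> (nat \<Rightarrow> 'k^'n \<Rightarrow> 'k)) set) homs"
  assumes E: "sheaf_of_modules proj_space E"
    and \<eta>: "sheaf_iso proj_space proj_space E (cohomology proj_space (copies nc (twist proj_space (- 1)))
      (copies nm (struct_sheaf proj_space)) (copies nc (twist proj_space 1)) a b) \<eta>"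
begin

lemma A_add: "A (v + w) *v u = A v *v u + A w *v u"
  and A_scale: "A (r *s v) *v u = r *s (A v *v u)"
  and B_add: "B (v + w) *v n = B v *v n + B w *v n"
  and B_scale: "B (r *s v) *v n = r *s (B v *v n)"
  using global_linear[OF va.Mat_regular[simplified]] global_linear[OF vb.Mat_regular[simplified]]
  by (simp_all add: vec_eq_iff matrix_vector_mult_def distrib_right sum.distrib sum_distrib_left mult.assoc)

lemma B_form: "form 1 (\<lambda>x. B x $ i $ j)"
  by (rule global_linear_form[OF vb.Mat_regular[simplified]])

section \<open>A local projection onto the kernel\<close>

text \<open>Where this is nonzero, the columns of the constant matrix \<open>C\<close> span a
  complement of the kernel of \<open>B x\<close>.\<close>

definition \<delta> :: "'k^2^'m \<Rightarrow> 'k^'n \<Rightarrow> 'k" where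
  "\<delta> C x = det (B x ** C)"

lemma form_mult_linear: "form 1 f \<Longrightarrow> form 1 g \<Longrightarrow> form 2 (\<lambda>v. f v * g v)"
  using form_mult[of 1 f 1 g] by (simp add: numeral_2_eq_2)

lemma BC_form: "form 1 (\<lambda>x. (B x ** C) $ i $ j)"
proof -
  have "form 1 (\<lambda>x. \<Sum>k\<in>UNIV. C $ k $ j * B x $ i $ k)" by (intro form_sum form_cmult B_form)
  then show ?thesis by (simp add: matrix_matrix_mult_def mult.commute)
qed

lemma form_diff: "form d f \<Longrightarrow> form d g \<Longrightarrow> form d (\<lambda>v. f v - g v)"
  using form_add[of d f "\<lambda>v. - 1 * g v"] form_cmult[of d g "- 1"] by simp

lemma \<delta>_form: "form 2 (\<delta> C)"
proof -
  have "form 2 (\<lambda>x. (B x ** C) $ 1 $ 1 * (B x ** C) $ 2 $ 2 - (B x ** C) $ 1 $ 2 * (B x ** C) $ 2 $ 1)"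
    by (intro form_diff form_mult_linear BC_form)
  then show ?thesis unfolding \<delta>_def[abs_def] det_2 .
qed

text \<open>\<open>\<delta> C x\<close> times the component of \<open>n\<close> along the columns of
  \<open>C\<close>. The adjugate in place of an inverse keeps it a quadratic form in
  \<open>x\<close>.\<close>

definition corr :: "'k^2^'m \<Rightarrow> 'k^'m \<Rightarrow> 'k^'n \<Rightarrow> 'k^'m" where
  "corr C n x = C *v (adj2 (B x ** C) *v (B x *v n))"

lemma corr_form: "form 2 (\<lambda>x. corr C n x $ i)"
proof -
  have Bn: "form 1 (\<lambda>x. (B x *v n) $ k)" for k
  proof -
    have "form 1 (\<lambda>x. \<Sum>j\<in>UNIV. n $ j * B x $ k $ j)" by (intro form_sum form_cmult B_form)
    then show ?thesis by (simp add: matrix_vector_mult_def mult.commute)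
  qed
  have m: "form 2 (\<lambda>x. (B x ** C) $ p $ q * (B x *v n) $ k)" for p q k
    by (intro form_mult_linear BC_form Bn)
  have "form 2 (\<lambda>x. C $ i $ 1 * ((B x ** C) $ 2 $ 2 * (B x *v n) $ 1 - (B x ** C) $ 1 $ 2 * (B x *v n) $ 2)
    + C $ i $ 2 * ((B x ** C) $ 1 $ 1 * (B x *v n) $ 2 - (B x ** C) $ 2 $ 1 * (B x *v n) $ 1))"
    by (intro form_add form_cmult form_diff m)
  moreover have "corr C n x $ i = C $ i $ 1 * ((B x ** C) $ 2 $ 2 * (B x *v n) $ 1 - (B x ** C) $ 1 $ 2 * (B x *v n) $ 2)
    + C $ i $ 2 * ((B x ** C) $ 1 $ 1 * (B x *v n) $ 2 - (B x ** C) $ 2 $ 1 * (B x *v n) $ 1)" for x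
  proof -
    have "(C *v y) $ i = C $ i $ 1 * y $ 1 + C $ i $ 2 * y $ 2" for y
      by (simp add: matrix_vector_mult_def sum_2)
    moreover have "(adj2 M *v y) $ 1 = M $ 2 $ 2 * y $ 1 - M $ 1 $ 2 * y $ 2"
      "(adj2 M *v y) $ 2 = M $ 1 $ 1 * y $ 2 - M $ 2 $ 1 * y $ 1" for M :: "'k^2^2" and y
      by (simp_all add: matrix_vector_mult_def sum_2 adj2_def)
    ultimately show ?thesis by (simp only: corr_def)
  qed
  ultimately show ?thesis by simp
qed

abbreviation "WC C \<equiv> basic_open (\<delta> C)"

lemma openin_WC: "zopen (WC C)"
  by (rule openin_basic_open[OF \<delta>_form])

lemma cone_WC: "x \<in> cone (WC C) \<longleftrightarrow> x \<noteq> 0 \<and> \<delta> C x \<noteq> 0"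
  by (rule basic_open_cone[OF \<delta>_form])

text \<open>The projection onto the kernel of \<open>B x\<close> along the columns of
  \<open>C\<close>. It extends a vector of one fibre to a local section of the kernel.\<close>

definition pr :: "'k^2^'m \<Rightarrow> 'k^'m \<Rightarrow> 'k^'n \<Rightarrow> 'k^'m" where
  "pr C n x = (if x \<in> cone (WC C) then n - (1 / \<delta> C x) *s corr C n x else 0)"

lemma pr_N: "pr C n \<in> N (WC C)"
proof -
  have "(\<lambda>x. pr C n x $ i) \<in> reg 0 (WC C)" for i
  proof -
    have "form 2 (\<lambda>x. n $ i * \<delta> C x - corr C n x $ i)" by (intro form_diff form_cmult \<delta>_form corr_form)
    from regular_quotient[OF openin_WC[of C] this \<delta>_form[of C]]
    have "(\<lambda>x. if x \<in> cone (WC C) then (n $ i * \<delta> C x - corr C n x $ i) / \<delta> C x else 0) \<in> reg 0 (WC C)"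
      by (simp add: cone_WC)
    moreover have "pr C n x $ i = (if x \<in> cone (WC C) then (n $ i * \<delta> C x - corr C n x $ i) / \<delta> C x else 0)" for x
      by (simp add: pr_def cone_WC diff_divide_distrib)
    ultimately show ?thesis by simp
  qed
  moreover have "B x *v pr C n x = 0" for x
  proof (cases "x \<in> cone (WC C)")
    case True
    have "B x *v corr C n x = \<delta> C x *s (B x *v n)"
      unfolding corr_def matrix_vector_mul_assoc[of "B x" C] adj2_mult_vec \<delta>_def ..
    then show ?thesis using True
      by (simp add: pr_def matrix_vector_mult_diff_distrib vec.scale cone_WC vector_smult_assoc)
  qed (simp add: pr_def)
  ultimately show ?thesis by (simp add: N_def regvec_def)
qed

lemma pr_fixed: "B x *v n = 0 \<Longrightarrow> x \<in> cone (WC C) \<Longrightarrow> pr C n x = n"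
  by (simp add: pr_def corr_def)

lemma pr_add: "pr C (m + n) x = pr C m x + pr C n x"
  by (simp add: pr_def corr_def matrix_vector_right_distrib vector_add_ldistrib)

lemma pr_scale: "pr C (r *s n) x = r *s pr C n x"
  by (simp add: pr_def corr_def vec.scale vector_ssub_ldistrib vector_smult_assoc mult.commute)

lemma pr_expand: "pr C n x = (\<Sum>i\<in>UNIV. n $ i *s pr C (axis i 1) x)"
proof -
  have "pr C 0 x = 0" using pr_scale[of C 0 0 x] by simp
  then have "pr C (\<Sum>i\<in>S. f i) x = (\<Sum>i\<in>S. pr C (f i) x)" for f and S :: "'m set"
    by (induction S rule: infinite_finite_induct) (simp_all add: pr_add)
  then have "pr C (\<Sum>i\<in>UNIV. n $ i *s axis i 1) x = (\<Sum>i\<in>UNIV. n $ i *s pr C (axis i 1) x)"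
    by (simp add: pr_scale)
  then show ?thesis by (simp only: basis_expansion)
qed

text \<open>The columns of \<open>C\<close> are preimages of the two basis vectors, which makes
  \<open>B v ** C\<close> the identity.\<close>

lemma exists_WC:
  assumes "v \<noteq> 0"
  obtains C where "v \<in> cone (WC C)"
proof -
  obtain x y where "B v *v x = axis 1 1" "B v *v y = axis 2 1" using B_surj[OF assms] by metis
  then have xy: "(B v *v x) $ k = axis 1 1 $ k" "(B v *v y) $ k = axis 2 1 $ k" for k by simp_all
  define C :: "'k^2^'m" where "C = (\<chi> i j. if j = 1 then x $ i else y $ i)"
  have C: "(B v ** C) $ k $ j = (if j = 1 then (B v *v x) $ k else (B v *v y) $ k)" for k and j :: 2
    by (simp add: C_def matrix_matrix_mult_def matrix_vector_mult_def)
  have "\<delta> C v = 1" unfolding \<delta>_def det_2 C xy by (simp add: axis_def)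
  then show ?thesis using that[of C] assms by (simp add: cone_WC)
qed

text \<open>A section over \<open>W\<close> of the dual of the cohomology sheaf, written on
  representatives: the last clause is invariance under a change of representative.\<close>

definition functional :: "('k^'n) set set \<Rightarrow> (('k^'n) set set \<Rightarrow> ('k^'n \<Rightarrow> 'k^'m) \<Rightarrow> 'k^'n \<Rightarrow> 'k) \<Rightarrow> bool" where
  "functional W L \<longleftrightarrow> (\<forall>U. zopen U \<and> U \<subseteq> W \<longrightarrow> (\<forall>f\<in>N U.
     L U f \<in> reg 0 U \<and>
     (\<forall>g\<in>N U. L U (\<lambda>v. f v + g v) = (\<lambda>v. L U f v + L U g v)) \<and>
     (\<forall>r\<in>reg 0 U. L U (\<lambda>v. r v *s f v) = (\<lambda>v. r v * L U f v)) \<and>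
     (\<forall>V. zopen V \<and> V \<subseteq> U \<longrightarrow> L V (rst V f) = rst V (L U f)) \<and>
     (\<forall>g\<in>N U. (\<forall>p\<in>U. eqv p f g) \<longrightarrow> L U f = L U g)))"

lemma functionalD:
  assumes "functional W L" "zopen U" "U \<subseteq> W" "f \<in> N U"
  shows "L U f \<in> reg 0 U"
    and "g \<in> N U \<Longrightarrow> L U (\<lambda>v. f v + g v) = (\<lambda>v. L U f v + L U g v)"
    and "r \<in> reg 0 U \<Longrightarrow> L U (\<lambda>v. r v *s f v) = (\<lambda>v. r v * L U f v)"
    and "zopen V \<Longrightarrow> V \<subseteq> U \<Longrightarrow> L V (rst V f) = rst V (L U f)"
    and "g \<in> N U \<Longrightarrow> (\<And>p. p \<in> U \<Longrightarrow> eqv p f g) \<Longrightarrow> L U f = L U g"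
  using assms unfolding functional_def by simp_all

lemma functional_sum:
  assumes L: "functional W L" "zopen U" "U \<subseteq> W" and f: "\<And>i. i \<in> S \<Longrightarrow> f i \<in> N U"
  shows "(\<lambda>v. \<Sum>i\<in>S. f i v) \<in> N U \<and> L U (\<lambda>v. \<Sum>i\<in>S. f i v) = (\<lambda>v. \<Sum>i\<in>S. L U (f i) v)"
proof -
  have 0: "L U (\<lambda>v. 0) = (\<lambda>v. 0)"
    using functionalD(3)[OF L N_zero[OF L(2)] regular_zero[OF L(2)]] by simp
  show ?thesis using f
    by (induction S rule: infinite_finite_induct)
      (simp_all add: N_zero[OF L(2)] 0 N_add[OF L(2)] functionalD(2)[OF L])
qed

text \<open>A section \<open>f\<close> of the kernel is the combination of the sections
  \<open>pr C (axis i 1)\<close> with the coordinates of \<open>f\<close> as coefficients. So the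
  values of \<open>L\<close> on these sections at \<open>v\<close> determine \<open>L\<close> there,
  which replaces a computation of stalks of the dual sheaf.\<close>

lemma functional_values:
  assumes L: "functional W L" and W: "zopen W" and v: "v \<in> cone W"
  obtains l :: "'k^'m" where
    "\<And>U f. zopen U \<Longrightarrow> U \<subseteq> W \<Longrightarrow> v \<in> cone U \<Longrightarrow> f \<in> N U \<Longrightarrow> L U f v = (\<Sum>i\<in>UNIV. f v $ i * l $ i)"
    "\<And>u. (\<Sum>i\<in>UNIV. (A v *v u) $ i * l $ i) = 0"
proof -
  have v0: "v \<noteq> 0" using v by (auto simp: punctured_cone_def)
  obtain C where C: "v \<in> cone (WC C)" by (rule exists_WC[OF v0])
  let ?V = "W \<inter> WC C"
  have V: "zopen ?V" using W openin_WC by (rule openin_Int)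
  have P: "rst ?V (pr C n) \<in> N ?V" for n by (rule N_restrict[OF pr_N openin_WC V]) simp
  define l where "l = (\<chi> i. L ?V (rst ?V (pr C (axis i 1))) v)"
  have val: "L U f v = (\<Sum>i\<in>UNIV. f v $ i * l $ i)"
    if U: "zopen U" "U \<subseteq> W" "v \<in> cone U" and f: "f \<in> N U" for U f
  proof -
    let ?U = "U \<inter> WC C"
    have U': "zopen ?U" using U(1) openin_WC by (rule openin_Int)
    have sub: "?U \<subseteq> ?V" "?U \<subseteq> W" using U(2) by auto
    have vU: "v \<in> cone ?U"
      using U(3) C cone_Int[OF zar_subset[OF U(1)] zar_subset[OF openin_WC[of C]]] by blast
    have fi: "(\<lambda>x. rst ?U (\<lambda>x. f x $ i) x) \<in> reg 0 ?U" for i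
      using regular_restrict[of "\<lambda>x. f x $ i", OF _ U(1) U'] N_regvec[OF f] by (simp add: regvec_def)
    have e: "rst ?U (pr C (axis i 1)) \<in> N ?U" for i by (rule N_restrict[OF pr_N openin_WC U']) simp
    have ex: "rst ?U f = (\<lambda>x. \<Sum>i\<in>UNIV. rst ?U (\<lambda>x. f x $ i) x *s rst ?U (pr C (axis i 1)) x)"
    proof
      fix x show "rst ?U f x = (\<Sum>i\<in>UNIV. rst ?U (\<lambda>x. f x $ i) x *s rst ?U (pr C (axis i 1)) x)"
      proof (cases "x \<in> cone ?U")
        case True
        then have "x \<in> cone (WC C)" using cone_mono by blast
        then have "f x = pr C (f x) x" using pr_fixed N_ker[OF f] by metis
        then show ?thesis using True pr_expand[of C "f x" x] by simp
      qed simp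
    qed
    have "rst ?U (L U f) v = L ?U (rst ?U f) v"
      using functionalD(4)[OF L U(1,2) f U'] by simp
    also have "\<dots> = (\<Sum>i\<in>UNIV. L ?U (\<lambda>x. rst ?U (\<lambda>x. f x $ i) x *s rst ?U (pr C (axis i 1)) x) v)"
      unfolding ex using functional_sum[OF L U' sub(2), of UNIV "\<lambda>i x. rst ?U (\<lambda>x. f x $ i) x *s rst ?U (pr C (axis i 1)) x"]
        N_smult[OF U' e fi] by simp
    also have "\<dots> = (\<Sum>i\<in>UNIV. f v $ i * L ?U (rst ?U (pr C (axis i 1))) v)"
      using functionalD(3)[OF L U' sub(2) e fi] vU by simp
    also have "\<dots> = (\<Sum>i\<in>UNIV. f v $ i * l $ i)"
    proof -
      have "rst ?U (rst ?V g) = rst ?U g" for g :: "'k^'n \<Rightarrow> 'k^'m" using cone_mono[OF sub(1)] by auto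
      then have "L ?U (rst ?U (pr C (axis i 1))) v = l $ i" for i
        using functionalD(4)[OF L V _ P U' sub(1), of "axis i 1"] vU by (simp add: l_def)
      then show ?thesis by simp
    qed
    finally show ?thesis using vU by simp
  qed
  moreover have "(\<Sum>i\<in>UNIV. (A v *v u) $ i * l $ i) = 0" for u
  proof -
    let ?f = "rst ?V (pr C (A v *v u))"
    obtain k where k: "v $ k \<noteq> 0" using v0 by (auto simp: vec_eq_iff)
    let ?V' = "?V \<inter> chart k"
    have V': "zopen ?V'" using V openin_chart by (rule openin_Int)
    have vV: "v \<in> cone ?V"
      using v C cone_Int[OF zar_subset[OF W] zar_subset[OF openin_WC[of C]]] by blast
    then have vV': "v \<in> cone ?V'"
      using k cone_Int[OF zar_subset[OF V] zar_subset[OF openin_chart[of k]]] cone_chart by blast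
    \<comment> \<open>The weight \<open>v $ k\<close> cancels the value of the generator of O(-1) at
      \<open>v\<close>, so that \<open>?u v = u\<close>. The section \<open>A x *v ?u x\<close>
      represents zero, hence \<open>L\<close> kills it.\<close>
    let ?u = "\<lambda>x. \<Sum>j\<in>UNIV. rst ?V' (\<lambda>_. v $ k * u $ j) x *s rst ?V' (va.gen k j) x"
    have u: "?u \<in> regvec (- 1) ?V'"
      by (intro regvec_sum[OF V'])
        (use regvec_smult[OF V' regular_const[OF V'] regvec_restrict[OF va.gen_regvec openin_chart V']] in simp)
    have uv: "?u v = u"
      using vV' k by (simp add: vec_eq_iff va.gen_def axis_def if_distrib sum.delta coord_power_def cong: if_cong)
    let ?g = "\<lambda>x. A x *v ?u x"
    have g: "?g \<in> N ?V'"
    proof -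
      have "va.H ?V' ?u = ?g"
      proof
        fix x show "va.H ?V' ?u x = ?g x"
          using va.H_Mat[OF V' u, of x] regvec_off[OF u, of x] regvec_off[OF va.\<eta>_of_vals(2)[OF V' u], of x]
          by (cases "x \<in> cone ?V'") auto
      qed
      then show ?thesis using va.\<eta>_of_vals(2)[OF V' u] by (simp add: N_def B_A)
    qed
    have "eqv p ?g (\<lambda>_. 0)" if "p \<in> ?V'" for p
      unfolding eqv_def using V' that u by (intro exI[of _ ?V'] exI[of _ ?u]) simp
    then have "L ?V' ?g = L ?V' (\<lambda>_. 0)"
      using functionalD(5)[OF L V' _ g N_zero[OF V']] by blast
    moreover have "L ?V' (\<lambda>_. 0) v = 0" using val[OF V' _ vV' N_zero[OF V']] by auto
    moreover have "L ?V' ?g v = (\<Sum>i\<in>UNIV. ?g v $ i * l $ i)" using val[OF V' _ vV' g] by auto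
    ultimately show ?thesis by (simp only: uv)
  qed
  ultimately show ?thesis using that by blast
qed

lemma functional_mod:
  assumes L: "functional W L" and W: "zopen W" 
    and U: "zopen U" "U \<subseteq> W" "v \<in> cone U" "f \<in> N U"
    and U': "zopen U'" "U' \<subseteq> W" "v \<in> cone U'" "g \<in> N U'"
    and fg: "f v - g v \<in> range ((*v) (A v))"
  shows "L U f v = L U' g v"
proof -
  have v: "v \<in> cone W" using cone_mono[OF U(2,3)] .
  obtain u where u: "f v = g v + A v *v u" using fg by (metis add.commute diff_add_cancel imageE)
  show ?thesis
    by (rule functional_values[OF L W v])
      (simp add: U U' u distrib_right sum.distrib)
qed

end

lemma copies_carrier_nat:
  "carrier (sec (copies d (twist proj_space e)) W) = {..<d} \<rightarrow>\<^sub>E reg e W"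
  by (simp add: copies_def twist_def)

section \<open>Sections of E represented by vector functions\<close>

context sheaf_presentation begin

lemma E_module: "zopen U \<Longrightarrow> Module.module (struct_ring proj_space U) (sec E U)"
  by (rule E[unfolded sheaf_of_modules_def, THEN conjunct1, rule_format])

lemma E_res:
  assumes "zopen U" "zopen W" "W \<subseteq> U" "s \<in> carrier (sec E U)"
  shows "res E U W s \<in> carrier (sec E W)"
  by (rule E[unfolded sheaf_of_modules_def, THEN conjunct2, THEN conjunct1, rule_format, THEN conjunct1])
    (use assms in simp_all)

lemma E_res_self: "zopen U \<Longrightarrow> s \<in> carrier (sec E U) \<Longrightarrow> res E U U s = s"
  by (rule E[unfolded sheaf_of_modules_def, THEN conjunct2, THEN conjunct2, THEN conjunct1, rule_format])

lemma E_res_res: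
  assumes "zopen U" "zopen V" "zopen W" "W \<subseteq> V" "V \<subseteq> U"
    "s \<in> carrier (sec E U)"
  shows "res E V W (res E U V s) = res E U W s"
  by (rule E[unfolded sheaf_of_modules_def, THEN conjunct2, THEN conjunct2, THEN conjunct2, THEN conjunct1, rule_format])
    (use assms in simp_all)

lemma E_add: "zopen U \<Longrightarrow> s \<in> carrier (sec E U) \<Longrightarrow> t \<in> carrier (sec E U) \<Longrightarrow>
    s \<oplus>\<^bsub>sec E U\<^esub> t \<in> carrier (sec E U)"
  by (rule abelian_monoid.a_closed[OF abelian_group.axioms(1)[OF Module.module.axioms(2)[OF E_module]]])

lemma E_smult: "zopen U \<Longrightarrow> r \<in> reg 0 U \<Longrightarrow> s \<in> carrier (sec E U) \<Longrightarrow>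
    r \<odot>\<^bsub>sec E U\<^esub> s \<in> carrier (sec E U)"
  using Module.module.smult_closed[OF E_module, of U r s] by (simp add: struct_ring_carrier)

lemma \<eta>_hom: "sheaf_hom proj_space proj_space E HH \<eta>"
  and \<eta>_bij: "zopen W \<Longrightarrow> bij_betw (\<eta> W) (carrier (sec E W)) (carrier (sec HH W))"
  using \<eta> zar_subset[of proj_space W] unfolding sheaf_iso_def by simp_all

lemmas \<eta>D = sheaf_homD[OF \<eta>_hom _ zar_subset]

text \<open>The section of \<open>E\<close> represented by \<open>f\<close>; by
  \<open>\<kappa>_local\<close> every section is locally of this kind.\<close>

definition \<kappa> :: "('k^'n) set set \<Rightarrow> ('k^'n \<Rightarrow> 'k^'m) \<Rightarrow> 'a" where
  "\<kappa> W f = inv_into (carrier (sec E W)) (\<eta> W) (br W f)"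

lemma \<kappa>:
  assumes "zopen W" "f \<in> N W"
  shows "\<kappa> W f \<in> carrier (sec E W)" "\<eta> W (\<kappa> W f) = br W f"
proof -
  have "br W f \<in> \<eta> W ` carrier (sec E W)"
    using br_carrier[OF assms] \<eta>_bij[OF assms(1)] by (simp add: bij_betw_def)
  then show "\<kappa> W f \<in> carrier (sec E W)" "\<eta> W (\<kappa> W f) = br W f"
    unfolding \<kappa>_def by (rule inv_into_into, rule f_inv_into_f)
qed

lemma \<kappa>_eqI:
  assumes "zopen W" "f \<in> N W" "s \<in> carrier (sec E W)" "\<eta> W s = br W f"
  shows "s = \<kappa> W f"
  using \<eta>_bij[OF assms(1)] \<kappa>[OF assms(1,2)] assms(3,4) by (auto simp: bij_betw_def inj_on_def)

lemma \<kappa>_eq: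
  assumes "zopen W" "f \<in> N W" "g \<in> N W"
  shows "\<kappa> W f = \<kappa> W g \<longleftrightarrow> (\<forall>p\<in>W. eqv p f g)"
  using br_eq[OF assms] \<kappa>[OF assms(1,2)] \<kappa>[OF assms(1,3)] by (metis \<kappa>_def)

lemma \<kappa>_add:
  assumes W: "zopen W" and f: "f \<in> N W" and g: "g \<in> N W"
  shows "\<kappa> W (\<lambda>v. f v + g v) = \<kappa> W f \<oplus>\<^bsub>sec E W\<^esub> \<kappa> W g"
proof (rule \<kappa>_eqI[symmetric, OF W N_add[OF W f g]])
  show "\<kappa> W f \<oplus>\<^bsub>sec E W\<^esub> \<kappa> W g \<in> carrier (sec E W)" by (intro E_add W \<kappa> f g)
  show "\<eta> W (\<kappa> W f \<oplus>\<^bsub>sec E W\<^esub> \<kappa> W g) = br W (\<lambda>v. f v + g v)"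
    using \<eta>D(2)[OF W W \<kappa>(1)[OF W f] \<kappa>(1)[OF W g]] by (simp only: \<kappa>[OF W f] \<kappa>[OF W g] br_add[OF W f g])
qed

lemma \<kappa>_smult:
  assumes W: "zopen W" and f: "f \<in> N W" and r: "r \<in> reg 0 W"
  shows "\<kappa> W (\<lambda>v. r v *s f v) = r \<odot>\<^bsub>sec E W\<^esub> \<kappa> W f"
proof (rule \<kappa>_eqI[symmetric, OF W N_smult[OF W f r]])
  show "r \<odot>\<^bsub>sec E W\<^esub> \<kappa> W f \<in> carrier (sec E W)" by (intro E_smult W \<kappa> f r)
  show "\<eta> W (r \<odot>\<^bsub>sec E W\<^esub> \<kappa> W f) = br W (\<lambda>v. r v *s f v)"
    using \<eta>D(3)[OF W W \<kappa>(1)[OF W f]] r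
    by (simp only: \<kappa>[OF W f] br_smult[OF W f r] struct_ring_carrier)
qed

lemma \<kappa>_res:
  assumes W: "zopen W" and f: "f \<in> N W" and W': "zopen W'" "W' \<subseteq> W"
  shows "res E W W' (\<kappa> W f) = \<kappa> W' (rst W' f)"
proof (rule \<kappa>_eqI[OF W'(1) N_restrict[OF f W W']])
  show "res E W W' (\<kappa> W f) \<in> carrier (sec E W')" by (intro E_res W W' \<kappa> f)
  show "\<eta> W' (res E W W' (\<kappa> W f)) = br W' (rst W' f)"
    using \<eta>D(4)[OF W W \<kappa>(1)[OF W f] W'] by (simp only: \<kappa>[OF W f] br_res[OF W f W'])
qed

lemma \<kappa>_local:
  assumes V: "zopen V" and s: "s \<in> carrier (sec E V)" and p: "p \<in> V"
  shows "\<exists>U f. zopen U \<and> p \<in> U \<and> U \<subseteq> V \<and> f \<in> N U \<and> res E V U s = \<kappa> U f"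
proof -
  obtain U f where U: "zopen U" "p \<in> U" "U \<subseteq> V" "f \<in> N U" "res HH V U (\<eta> V s) = br U f"
    using br_local[OF V \<eta>D(1)[OF V V s] p] by blast
  have "\<eta> U (res E V U s) = br U f" using \<eta>D(4)[OF V V s U(1,3)] U(5) by simp
  then have "res E V U s = \<kappa> U f" by (intro \<kappa>_eqI U(1,4) E_res V U(3) s)
  then show ?thesis using U by blast
qed

lemma functional_hom:
  assumes W: "zopen W" and \<psi>: "sheaf_hom proj_space W E (struct_sheaf proj_space) \<psi>"
  shows "functional W (\<lambda>U f. \<psi> U (\<kappa> U f))"
  unfolding functional_def
proof (intro allI impI ballI, elim conjE)
  fix U f assume U: "zopen U" "U \<subseteq> W" and f: "f \<in> N U"
  note D = sheaf_homD[OF \<psi> U \<kappa>(1)[OF U(1) f]]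
  have "\<psi> U (\<kappa> U f) \<in> reg 0 U" using D(1) by (simp add: twist_def)
  moreover have "\<psi> U (\<kappa> U (\<lambda>v. f v + g v)) = (\<lambda>v. \<psi> U (\<kappa> U f) v + \<psi> U (\<kappa> U g) v)" if "g \<in> N U" for g
    using D(2)[OF \<kappa>(1)[OF U(1) that]] by (simp add: twist_def \<kappa>_add[OF U(1) f that])
  moreover have "\<psi> U (\<kappa> U (\<lambda>v. r v *s f v)) = (\<lambda>v. r v * \<psi> U (\<kappa> U f) v)" if "r \<in> reg 0 U" for r
    using D(3)[of r] that by (simp add: twist_def \<kappa>_smult[OF U(1) f that] struct_ring_carrier)
  moreover have "\<psi> V (\<kappa> V (rst V f)) = rst V (\<psi> U (\<kappa> U f))" if "zopen V" "V \<subseteq> U" for V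
    using D(4)[OF that] by (simp add: twist_def \<kappa>_res[OF U(1) f that])
  moreover have "\<psi> U (\<kappa> U f) = \<psi> U (\<kappa> U g)" if "g \<in> N U" "\<forall>p\<in>U. eqv p f g" for g
    using \<kappa>_eq[OF U(1) f that(1)] that(2) by simp
  ultimately show "\<psi> U (\<kappa> U f) \<in> reg 0 U \<and>
     (\<forall>g\<in>N U. \<psi> U (\<kappa> U (\<lambda>v. f v + g v)) = (\<lambda>v. \<psi> U (\<kappa> U f) v + \<psi> U (\<kappa> U g) v)) \<and>
     (\<forall>r\<in>reg 0 U. \<psi> U (\<kappa> U (\<lambda>v. r v *s f v)) = (\<lambda>v. r v * \<psi> U (\<kappa> U f) v)) \<and>
     (\<forall>V. zopen V \<and> V \<subseteq> U \<longrightarrow> \<psi> V (\<kappa> V (rst V f)) = rst V (\<psi> U (\<kappa> U f))) \<and>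
     (\<forall>g\<in>N U. (\<forall>p\<in>U. eqv p f g) \<longrightarrow> \<psi> U (\<kappa> U f) = \<psi> U (\<kappa> U g))" by blast
qed

section \<open>Local trivialisations\<close>

definition unit_section :: "('k^'n) set set \<Rightarrow> nat \<Rightarrow> nat \<Rightarrow> nat \<Rightarrow> 'k^'n \<Rightarrow> 'k" where
  "unit_section W d j = (\<lambda>i\<in>{..<d}. \<lambda>v. if i = j \<and> v \<in> cone W then 1 else 0)"

lemma trivialisation_component:
  assumes W: "zopen W" and \<theta>: "sheaf_hom proj_space W E (copies d (struct_sheaf proj_space)) \<theta>" and i: "i < d"
  shows "sheaf_hom proj_space W E (struct_sheaf proj_space) (\<lambda>U s. \<theta> U s i)"
proof (rule sheaf_homI)
  fix U s assume U: "zopen U" "U \<subseteq> W" and s: "s \<in> carrier (sec E U)"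
  note D = sheaf_homD[OF \<theta> U s]
  show "\<theta> U s i \<in> carrier (sec (struct_sheaf proj_space) U)"
    using D(1) i by (auto simp: copies_def)
  show "\<theta> U (s \<oplus>\<^bsub>sec E U\<^esub> t) i = \<theta> U s i \<oplus>\<^bsub>sec (struct_sheaf proj_space) U\<^esub> \<theta> U t i" if "t \<in> carrier (sec E U)" for t
    using D(2)[OF that] i by (simp add: copies_def)
  show "\<theta> U (r \<odot>\<^bsub>sec E U\<^esub> s) i = r \<odot>\<^bsub>sec (struct_sheaf proj_space) U\<^esub> \<theta> U s i"
    if "r \<in> carrier (struct_ring proj_space U)" for r
    using D(3)[OF that] i by (simp add: copies_def)
  show "\<theta> V (res E U V s) i = res (struct_sheaf proj_space) U V (\<theta> U s i)"
    if "zopen V" "V \<subseteq> U" for V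
    using D(4)[OF that] i by (simp add: copies_def)
qed

text \<open>A single unit section lifts to a representative only near \<open>p\<close>; the
  induction shrinks the neighbourhood until it serves all of them.\<close>

lemma local_generators:
  assumes W: "zopen W" and p: "p \<in> W"
    and \<theta>: "sheaf_iso proj_space W E (copies d (struct_sheaf proj_space)) \<theta>"
  obtains V n where "zopen V" "p \<in> V" "V \<subseteq> W"
    "\<And>j. j < d \<Longrightarrow> n j \<in> N V" "\<And>j. j < d \<Longrightarrow> \<theta> V (\<kappa> V (n j)) = unit_section V d j"
proof -
  have hom: "sheaf_hom proj_space W E (copies d (struct_sheaf proj_space)) \<theta>"
    and bij: "\<And>U. zopen U \<Longrightarrow> U \<subseteq> W \<Longrightarrow>
      bij_betw (\<theta> U) (carrier (sec E U)) (carrier (sec (copies d (struct_sheaf proj_space)) U))"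
    using \<theta> unfolding sheaf_iso_def by blast+
  have "(\<lambda>v. if i = j \<and> v \<in> cone W then 1 else 0) \<in> reg 0 W" for i j :: nat
    using regular_const[OF W, of 1] regular_zero[OF W, of 0] by (cases "i = j") simp_all
  then have unit: "unit_section W d j \<in> carrier (sec (copies d (struct_sheaf proj_space)) W)" for j
    by (simp add: copies_carrier_nat unit_section_def)
  have unit_res: "res (copies d (struct_sheaf proj_space)) W V (unit_section W d j) = unit_section V d j"
    if "V \<subseteq> W" for V j
    using cone_mono[OF that] by (auto simp: copies_def twist_def unit_section_def restrict_def fun_eq_iff)
  have one: "\<exists>V f. zopen V \<and> p \<in> V \<and> V \<subseteq> W \<and> f \<in> N V \<and> \<theta> V (\<kappa> V f) = unit_section V d j" for j
  proof -
    obtain s where s: "s \<in> carrier (sec E W)" "\<theta> W s = unit_section W d j"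
      using bij[OF W order_refl] unit[of j] by (metis bij_betw_imp_surj_on imageE)
    obtain V f where V: "zopen V" "p \<in> V" "V \<subseteq> W" "f \<in> N V" "res E W V s = \<kappa> V f"
      using \<kappa>_local[OF W s(1) p] by blast
    have "\<theta> V (\<kappa> V f) = unit_section V d j"
      using sheaf_homD(4)[OF hom W order_refl s(1) V(1,3)] s(2) unit_res[OF V(3)] V(5) by simp
    then show ?thesis using V by blast
  qed
  have "\<exists>V n. zopen V \<and> p \<in> V \<and> V \<subseteq> W \<and>
      (\<forall>j<k. n j \<in> N V \<and> \<theta> V (\<kappa> V (n j)) = unit_section V d j)" for k
  proof (induction k)
    case 0
    show ?case using W p by blast
  next
    case (Suc k)
    then obtain V n where V: "zopen V" "p \<in> V" "V \<subseteq> W"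
      and n: "\<And>j. j < k \<Longrightarrow> n j \<in> N V" "\<And>j. j < k \<Longrightarrow> \<theta> V (\<kappa> V (n j)) = unit_section V d j" by blast
    obtain V' f where V': "zopen V'" "p \<in> V'" "V' \<subseteq> W"
      and f: "f \<in> N V'" "\<theta> V' (\<kappa> V' f) = unit_section V' d k" using one by blast
    let ?V = "V \<inter> V'"
    have o: "zopen ?V" using V(1) V'(1) by (rule openin_Int)
    have shrink: "rst ?V g \<in> N ?V \<and> \<theta> ?V (\<kappa> ?V (rst ?V g)) = unit_section ?V d j"
      if U: "zopen U" "U \<subseteq> W" "?V \<subseteq> U" "g \<in> N U" "\<theta> U (\<kappa> U g) = unit_section U d j" for U g j
    proof
      show "rst ?V g \<in> N ?V" by (rule N_restrict[OF U(4,1) o U(3)])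
      have "\<theta> ?V (\<kappa> ?V (rst ?V g)) = res (copies d (struct_sheaf proj_space)) U ?V (unit_section U d j)"
        using sheaf_homD(4)[OF hom U(1,2) \<kappa>(1)[OF U(1,4)] o U(3)] \<kappa>_res[OF U(1,4) o U(3)] U(5) by simp
      also have "\<dots> = unit_section ?V d j"
        using cone_mono[OF U(3)] by (auto simp: copies_def twist_def unit_section_def restrict_def fun_eq_iff)
      finally show "\<theta> ?V (\<kappa> ?V (rst ?V g)) = unit_section ?V d j" .
    qed
    let ?n = "\<lambda>j. rst ?V (if j = k then f else n j)"
    have "?n j \<in> N ?V \<and> \<theta> ?V (\<kappa> ?V (?n j)) = unit_section ?V d j" if "j < Suc k" for j
    proof (cases "j = k")
      case True
      then show ?thesis using shrink[OF V'(1,3) _ f] by simp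
    next
      case False
      then have "j < k" using that by simp
      then show ?thesis using shrink[OF V(1,3) _ n] False by simp
    qed
    then show ?case using o V(2,3) V'(2) by (intro exI[of _ ?V] exI[of _ ?n]) blast
  qed
  from this[of d] obtain V n where "zopen V" "p \<in> V" "V \<subseteq> W"
    "\<forall>j<d. n j \<in> N V \<and> \<theta> V (\<kappa> V (n j)) = unit_section V d j" by blast
  then show ?thesis using that by blast
qed

text \<open>
  A trivialisation of \<open>E\<close> near \<open>p\<close> gives functions \<open>n j\<close> representing a basis of every nearby
  fibre \<open>ker B v / im A v\<close>.
\<close>

lemma fibre_basis:
  assumes W: "zopen W" and p: "p \<in> W"
    and \<theta>: "sheaf_iso proj_space W E (copies d (struct_sheaf proj_space)) \<theta>"
  obtains V n where "zopen V" "p \<in> V" "V \<subseteq> W" "\<And>j. j < d \<Longrightarrow> n j \<in> N V"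
    "\<And>U f v. zopen U \<Longrightarrow> U \<subseteq> V \<Longrightarrow> v \<in> cone U \<Longrightarrow> f \<in> N U \<Longrightarrow>
      f v - (\<Sum>j<d. \<theta> U (\<kappa> U f) j v *s n j v) \<in> range ((*v) (A v))"
    "\<And>v x. v \<in> cone V \<Longrightarrow> (\<Sum>j<d. x j *s n j v) \<in> range ((*v) (A v)) \<Longrightarrow> (\<forall>j<d. x j = 0)"
proof -
  obtain V n where V: "zopen V" "p \<in> V" "V \<subseteq> W"
    and n: "\<And>j. j < d \<Longrightarrow> n j \<in> N V" "\<And>j. j < d \<Longrightarrow> \<theta> V (\<kappa> V (n j)) = unit_section V d j"
    using local_generators[OF assms] by blast
  have hom: "sheaf_hom proj_space W E (copies d (struct_sheaf proj_space)) \<theta>"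
    and bij: "\<And>U. zopen U \<Longrightarrow> U \<subseteq> W \<Longrightarrow>
      bij_betw (\<theta> U) (carrier (sec E U)) (carrier (sec (copies d (struct_sheaf proj_space)) U))"
    using \<theta> unfolding sheaf_iso_def by blast+
  have L: "functional W (\<lambda>U f. \<theta> U (\<kappa> U f) i)" if "i < d" for i
    by (rule functional_hom[OF W trivialisation_component[OF W hom that]])
  have exten: "\<theta> U (\<kappa> U f) \<in> extensional {..<d}" if "zopen U" "U \<subseteq> W" "f \<in> N U" for U f
    using sheaf_homD(1)[OF hom that(1,2) \<kappa>(1)[OF that(1,3)]] by (simp add: copies_carrier_nat PiE_def)
  have gen: "f v - (\<Sum>j<d. \<theta> U (\<kappa> U f) j v *s n j v) \<in> range ((*v) (A v))"
    if U: "zopen U" "U \<subseteq> V" "v \<in> cone U" and f: "f \<in> N U" for U f v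
  proof -
    have UW: "U \<subseteq> W" using U(2) V(3) by blast
    let ?c = "\<lambda>j. \<theta> U (\<kappa> U f) j"
    have c: "?c j \<in> reg 0 U" if "j < d" for j using functionalD(1)[OF L[OF that] U(1) UW f] .
    have nU: "rst U (n j) \<in> N U" if "j < d" for j by (rule N_restrict[OF n(1)[OF that] V(1) U(1,2)])
    have cn: "(\<lambda>x. ?c j x *s rst U (n j) x) \<in> N U" if "j < d" for j by (rule N_smult[OF U(1) nU[OF that] c[OF that]])
    let ?g = "\<lambda>x. \<Sum>j<d. ?c j x *s rst U (n j) x"
    \<comment> \<open>\<open>functional_sum\<close> is instantiated with the coordinate 0, which
      exists only for nonzero \<open>d\<close>; for \<open>d = 0\<close> the sum is empty.\<close>
    have g: "?g \<in> N U" if "d \<noteq> 0"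
      using functional_sum[OF L U(1) UW, of 0 "{..<d}" "\<lambda>j x. ?c j x *s rst U (n j) x"] cn that by simp
    have g: "?g \<in> N U" using g by (cases "d = 0") (simp_all add: N_zero[OF U(1)])
    \<comment> \<open>\<open>?g\<close> has the same coordinates as \<open>f\<close> in the
      trivialisation, so both represent the same section and agree at \<open>v\<close> modulo the
      image of \<open>A v\<close>.\<close>
    have "\<theta> U (\<kappa> U ?g) i = \<theta> U (\<kappa> U f) i" if i: "i < d" for i
    proof -
      have "\<theta> U (\<kappa> U ?g) i = (\<lambda>x. \<Sum>j<d. \<theta> U (\<kappa> U (\<lambda>x. ?c j x *s rst U (n j) x)) i x)"
        using functional_sum[OF L[OF i] U(1) UW, of "{..<d}" "\<lambda>j x. ?c j x *s rst U (n j) x"] cn by simp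
      also have "\<dots> = (\<lambda>x. \<Sum>j<d. ?c j x * (if i = j \<and> x \<in> cone U then 1 else 0))"
      proof (rule ext, rule sum.cong[OF refl])
        fix x j assume j: "j \<in> {..<d}"
        have "\<theta> U (\<kappa> U (rst U (n j))) i = rst U (\<theta> V (\<kappa> V (n j)) i)"
          using functionalD(4)[OF L[OF i] V(1,3) n(1) U(1,2)] j by simp
        also have "\<dots> = (\<lambda>x. if i = j \<and> x \<in> cone U then 1 else 0)"
          using n(2)[of j] j i cone_mono[OF U(2)] by (auto simp: unit_section_def)
        finally show "\<theta> U (\<kappa> U (\<lambda>x. ?c j x *s rst U (n j) x)) i x
            = ?c j x * (if i = j \<and> x \<in> cone U then 1 else 0)"
          using functionalD(3)[OF L[OF i] U(1) UW nU c] j by simp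
      qed
      also have "\<dots> = ?c i"
      proof
        fix x
        have "(\<Sum>j<d. ?c j x * (if i = j \<and> x \<in> cone U then 1 else 0))
          = (\<Sum>j<d. if i = j then (if x \<in> cone U then ?c j x else 0) else 0)"
          by (intro sum.cong) auto
        also have "\<dots> = (if x \<in> cone U then ?c i x else 0)" using i by (subst sum.delta') auto
        also have "\<dots> = ?c i x" using regular_off[OF c[OF i], of x] by auto
        finally show "(\<Sum>j<d. ?c j x * (if i = j \<and> x \<in> cone U then 1 else 0)) = ?c i x" .
      qed
      finally show ?thesis .
    qed
    then have "\<theta> U (\<kappa> U ?g) = \<theta> U (\<kappa> U f)"
      by (intro extensionalityI[OF exten[OF U(1) UW g] exten[OF U(1) UW f]]) auto
    then have "\<kappa> U ?g = \<kappa> U f"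
      using bij[OF U(1) UW] \<kappa>(1)[OF U(1) g] \<kappa>(1)[OF U(1) f] by (auto simp: bij_betw_def inj_on_def)
    then have e: "eqv (vec.span {v}) ?g f" using \<kappa>_eq[OF U(1) g f] cone_span[OF U(1,3)] by blast
    have "v \<in> vec.span {v}" "v \<noteq> 0" using U(3) by (auto simp: punctured_cone_def intro: vec.span_base)
    then have "f v - ?g v \<in> range ((*v) (A v))" by (rule eqv_value[OF eqv_sym[OF e]])
    then show ?thesis using U(3) by simp
  qed
  have indep: "\<forall>j<d. x j = 0" if v: "v \<in> cone V" and x: "(\<Sum>j<d. x j *s n j v) \<in> range ((*v) (A v))" for v x
  proof (intro allI impI)
    fix i assume i: "i < d"
    obtain u where u: "(\<Sum>j<d. x j *s n j v) = A v *v u" using x by blast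
    have vW: "v \<in> cone W" using cone_mono[OF V(3) v] .
    show "x i = 0"
    proof (rule functional_values[OF L[OF i] W vW])
      fix l :: "'k^'m" assume l: "\<And>U f. zopen U \<Longrightarrow> U \<subseteq> W \<Longrightarrow> v \<in> cone U \<Longrightarrow> f \<in> N U \<Longrightarrow>
          \<theta> U (\<kappa> U f) i v = (\<Sum>k\<in>UNIV. f v $ k * l $ k)" "\<And>u. (\<Sum>k\<in>UNIV. (A v *v u) $ k * l $ k) = 0"
      have "(\<Sum>k\<in>UNIV. n j v $ k * l $ k) = (if i = j then 1 else 0)" if "j < d" for j
        using l(1)[OF V(1,3) v n(1)[OF that]] n(2)[OF that] i v by (simp add: unit_section_def)
      \<comment> \<open>The coordinate functional \<open>i\<close> is dual to the \<open>n j\<close>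
        and kills the image of \<open>A v\<close>, so evaluating it on the combination yields both
        \<open>x i\<close> and zero.\<close>
      then have "(\<Sum>j<d. x j * (\<Sum>k\<in>UNIV. n j v $ k * l $ k)) = (\<Sum>j<d. if i = j then x j else 0)"
        by (intro sum.cong) auto
      also have "\<dots> = x i" using i by (subst sum.delta') auto
      finally have "x i = (\<Sum>j<d. x j * (\<Sum>k\<in>UNIV. n j v $ k * l $ k))" ..
      also have "\<dots> = (\<Sum>k\<in>UNIV. (\<Sum>j<d. x j *s n j v) $ k * l $ k)"
        by (simp add: sum_distrib_left sum_distrib_right sum_component mult.assoc) (rule sum.swap)
      also have "\<dots> = 0" unfolding u by (rule l(2))
      finally show "x i = 0" .
    qed
  qed
  show ?thesis by (rule that[OF V], erule n(1), rule gen, assumption+, rule indep, assumption+)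
qed

end

section \<open>Injectivity of A on every fibre\<close>

lemma vec_dim_kernel:
  fixes M :: "'k::field^'n^'m"
  assumes "\<And>y. \<exists>x. M *v x = y"
  shows "vec.dim {x. M *v x = 0} + CARD('m) = CARD('n)"
proof -
  obtain R where R: "M ** R = mat 1"
    using assms matrix_right_invertible_surjective[of M] by (metis surjI surj_def)
  then have MR: "M *v (R *v y) = y" for y by (simp add: matrix_vector_mul_assoc)
  let ?K = "{x. M *v x = 0}" and ?R = "range ((*v) R)"
  have K: "vec.subspace ?K"
    by (rule vec.subspaceI) (simp_all add: matrix_vector_right_distrib vec.scale)
  have R': "vec.subspace ?R" by (simp add: vec.subspace_image)
  have "R *v y = 0 \<Longrightarrow> y = 0" for y using MR[of y] by simp
  then have dR: "vec.dim ?R = CARD('m)" by (rule vec_dim_range)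
  have "?K \<inter> ?R \<subseteq> {0}"
  proof
    fix x assume "x \<in> ?K \<inter> ?R"
    then obtain y where y: "x = R *v y" "M *v x = 0" by blast
    then have "y = 0" using MR[of y] by simp
    then show "x \<in> {0}" using y by simp
  qed
  then have d0: "vec.dim (?K \<inter> ?R) = 0" by (simp add: vec.dim_eq_0)
  have "{x + y | x y. x \<in> ?K \<and> y \<in> ?R} = UNIV"
  proof (intro equalityI subsetI)
    fix x :: "'k^'n" assume "x \<in> UNIV"
    have "x - R *v (M *v x) \<in> ?K" by (simp add: matrix_vector_mult_diff_distrib MR)
    moreover have "x = (x - R *v (M *v x)) + R *v (M *v x)" by simp
    ultimately show "x \<in> {x + y | x y. x \<in> ?K \<and> y \<in> ?R}" by blast
  qed simp
  then show ?thesis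
    using vec.dim_sums_Int[OF K R'] dR d0 by (simp add: vec_dim_card card_cart_basis)
qed

lemma injective_iff_minor:
  fixes M :: "'k::field^2^'m"
  shows "(\<forall>u. M *v u = 0 \<longrightarrow> u = 0) \<longleftrightarrow> (\<exists>i j. M$i$1 * M$j$2 - M$i$2 * M$j$1 \<noteq> 0)"
proof (intro iffI)
  assume inj: "\<forall>u. M *v u = 0 \<longrightarrow> u = 0"
  show "\<exists>i j. M$i$1 * M$j$2 - M$i$2 * M$j$1 \<noteq> 0"
  proof (rule ccontr)
    assume "\<not> ?thesis"
    then have m: "M$i$1 * M$j$2 = M$i$2 * M$j$1" for i j by simp
    have ker: "M *v u = 0" if "\<And>j. M$j$1 * u$1 + M$j$2 * u$2 = 0" for u
      using that by (simp add: vec_eq_iff matrix_vector_mult_def sum_2)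
    have "M$i$1 = 0 \<and> M$i$2 = 0" for i
    proof -
      have "M *v vector [M$i$2, - M$i$1] = 0"
        by (rule ker) (use m[of i] in \<open>simp add: mult.commute\<close>)
      then have "(vector [M$i$2, - M$i$1] :: 'k^2) = 0" using inj by blast
      then show ?thesis by (simp add: vec_eq_iff forall_2)
    qed
    then have "M *v vector [1, 0] = 0" by (intro ker) simp
    then have "(vector [1, 0] :: 'k^2) = 0" using inj by blast
    then show False by (simp add: vec_eq_iff forall_2)
  qed
next
  assume "\<exists>i j. M$i$1 * M$j$2 - M$i$2 * M$j$1 \<noteq> 0"
  then obtain i j where m: "M$i$1 * M$j$2 - M$i$2 * M$j$1 \<noteq> 0" by blast
  show "\<forall>u. M *v u = 0 \<longrightarrow> u = 0"
  proof (intro allI impI)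
    fix u assume "M *v u = 0"
    then have r: "M$r$1 * u$1 + M$r$2 * u$2 = 0" for r
      by (simp add: vec_eq_iff matrix_vector_mult_def sum_2)
    have "(M$i$1 * M$j$2 - M$i$2 * M$j$1) * u$1
        = M$j$2 * (M$i$1 * u$1 + M$i$2 * u$2) - M$i$2 * (M$j$1 * u$1 + M$j$2 * u$2)"
      "(M$i$1 * M$j$2 - M$i$2 * M$j$1) * u$2
        = M$i$1 * (M$j$1 * u$1 + M$j$2 * u$2) - M$j$1 * (M$i$1 * u$1 + M$i$2 * u$2)"
      by (simp_all add: algebra_simps)
    then show "u = 0" using m by (simp only: r) (simp add: vec_eq_iff forall_2)
  qed
qed

text \<open>On the line joining \<open>v\<close> and \<open>w\<close> both forms restrict to nonzero
  polynomials, and the product of these has a nonzero value because the field is infinite.\<close>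

lemma forms_common_nonzero:
  fixes f g :: "'k::field_char_0^'n::finite \<Rightarrow> 'k"
  assumes "form d f" "f v \<noteq> 0" "form e g" "g w \<noteq> 0"
  obtains x where "f x \<noteq> 0" "g x \<noteq> 0"
proof -
  obtain p where p: "\<And>t. f (v + t *s (w - v)) = poly p t" using form_along_line[OF assms(1)] by blast
  obtain r where r: "\<And>t. g (v + t *s (w - v)) = poly r t" using form_along_line[OF assms(3)] by blast
  have "poly p 0 \<noteq> 0" "poly r 1 \<noteq> 0" using p[of 0] r[of 1] assms by auto
  then have "p * r \<noteq> 0" by auto
  then have "\<not> (\<forall>t. poly (p * r) t = 0)" using poly_all_0_iff_0 by blast
  then obtain t where "poly p t \<noteq> 0" "poly r t \<noteq> 0" by auto
  then show ?thesis using that[of "v + t *s (w - v)"] p r by simp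
qed

context sheaf_presentation begin

lemma A_form: "form 1 (\<lambda>x. A x $ i $ j)"
  by (rule global_linear_form[OF va.Mat_regular[simplified]])

lemma A_section_zero:
  assumes W: "zopen W" and s: "s \<in> regvec (- 1) W" and 0: "\<And>x. x \<in> cone W \<Longrightarrow> A x *v s x = 0"
  shows "s = (\<lambda>x. 0)"
proof -
  have z: "(\<lambda>x. 0) \<in> regvec (- 1) W" by (rule regvec_zero[OF W])
  have "va.H W s = (\<lambda>x. 0)"
  proof
    fix x show "va.H W s x = 0"
      using va.H_Mat[OF W s, of x] 0[of x] regvec_off[OF va.\<eta>_of_vals(2)[OF W s], of x]
      by (cases "x \<in> cone W") auto
  qed
  then have "a W (of_vals s) = a W (of_vals (\<lambda>x. 0 :: 'k^2))"
    using va.\<eta>_of_vals(1)[OF W s] va.\<eta>_of_vals(1)[OF W z] va.H_zero[OF W] by simp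
  moreover have "inj_on (a W) (carrier (sec SA W))"
    using inj W zar_subset[OF W] unfolding sheaf_injective_def by blast
  ultimately have "of_vals s = of_vals (\<lambda>x. 0 :: 'k^2)"
    using carrier_c(1)[OF s] carrier_c(1)[OF z] by (blast dest: inj_onD)
  then show ?thesis by (simp only: of_vals_inject)
qed

text \<open>If all minors vanish identically, each row of \<open>A\<close>, turned by a quarter,
  gives a section of O(-1)^2 that \<open>a\<close> kills. It is zero by injectivity of the sheaf
  map, so \<open>A\<close> is zero, and then \<open>a\<close> kills the generators too.\<close>

lemma generically_injective: "\<exists>v i j. A v $ i $ 1 * A v $ j $ 2 - A v $ i $ 2 * A v $ j $ 1 \<noteq> 0"
proof (rule ccontr)
  assume "\<not> ?thesis"
  then have m: "A v $ i $ 1 * A v $ j $ 2 = A v $ i $ 2 * A v $ j $ 1" for v i j by simp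
  have A0: "A x $ i $ 1 = 0 \<and> A x $ i $ 2 = 0" for x i
  proof (cases "x = 0")
    case False
    then obtain k where k: "x $ k \<noteq> 0" by (auto simp: vec_eq_iff)
    \<comment> \<open>The exponent 2 brings the linear entries down to degree -1.\<close>
    let ?e = "\<lambda>l v. rst (chart k) (\<lambda>v. A v $ i $ l / v $ k ^ 2) v"
    let ?s = "\<lambda>v. vector [?e 2 v, - ?e 1 v] :: 'k^2"
    have e: "?e l \<in> reg (- 1) (chart k)" for l
      by (rule regular_quotient[OF openin_chart A_form form_coord_power]) (auto simp: cone_chart)
    have "(\<lambda>v. ?s v $ l) \<in> reg (- 1) (chart k)" for l
      using e[of 2] regular_uminus[OF openin_chart e[of 1]] exhaust_2[of l] by auto
    then have s: "?s \<in> regvec (- 1) (chart k)" by (simp add: regvec_def)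
    have "A v *v ?s v = 0" if "v \<in> cone (chart k)" for v
      using m[of v i] by (simp add: vec_eq_iff matrix_vector_mult_def sum_2 mult.commute)
    then have "?s = (\<lambda>x. 0)" by (rule A_section_zero[OF openin_chart s])
    then have "?s x $ 1 = 0" "?s x $ 2 = 0" by (simp_all add: fun_eq_iff)
    then show ?thesis using k by (simp add: cone_chart)
  next
    case True
    then show ?thesis by (simp add: va.Mat_def)
  qed
  fix k :: 'n
  have "A v *v va.gen k 1 v = 0" for v using A0[of v] by (simp add: vec_eq_iff matrix_vector_mult_def sum_2)
  then have "va.gen k 1 = (\<lambda>x. 0)" by (intro A_section_zero[OF openin_chart va.gen_regvec])
  then have "va.gen k 1 (axis k 1) $ 1 = 0" by (simp add: fun_eq_iff)
  then show False by (simp add: va.gen_def coord_power_def)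
qed

text \<open>Local freeness of rank \<open>d\<close> is played against a drop of rank. If
  \<open>A v\<close> has a kernel, the fibre at \<open>v\<close> gives a middle term of rank at most
  \<open>d + 3\<close>; a nearby point where \<open>A\<close> is injective gives at least
  \<open>d + 4\<close>.\<close>

lemma A_inj:
  assumes lf: "locally_free proj_space E" and v: "v \<noteq> 0" and Au: "A v *v u = 0"
  shows "u = 0"
proof (rule ccontr)
  assume u: "u \<noteq> 0"
  obtain W d \<theta> where W: "zopen W" "vec.span {v} \<in> W"
    and \<theta>: "sheaf_iso proj_space W E (copies d (struct_sheaf proj_space)) \<theta>"
    using lf span_in_proj_space[OF v] unfolding locally_free_def by blast
  show False
  proof (rule fibre_basis[OF W \<theta>])
    fix V n
    assume V: "zopen V" "vec.span {v} \<in> V" "V \<subseteq> W"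
      and n: "\<And>j. j < d \<Longrightarrow> n j \<in> N V"
      and gen: "\<And>U f v. zopen U \<Longrightarrow> U \<subseteq> V \<Longrightarrow> v \<in> cone U \<Longrightarrow> f \<in> N U \<Longrightarrow>
        f v - (\<Sum>j<d. \<theta> U (\<kappa> U f) j v *s n j v) \<in> range ((*v) (A v))"
      and indep: "\<And>v x. v \<in> cone V \<Longrightarrow> (\<Sum>j<d. x j *s n j v) \<in> range ((*v) (A v)) \<Longrightarrow> (\<forall>j<d. x j = 0)"
    have vV: "v \<in> cone V" using V v zar_subset[OF V(1)] by (simp add: punctured_cone_iff)
    have ker_dim: "vec.dim {m. B x *v m = 0} + 2 = CARD('m)" if "x \<noteq> 0" for x
      using vec_dim_kernel[of "B x"] B_surj[OF that] by simp
    \<comment> \<open>At \<open>v\<close> the fibre is spanned by too few vectors.\<close>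
    define y :: "'k^2" where "y = (if u $ 1 \<noteq> 0 then axis 2 1 else axis 1 1)"
    have rng: "\<exists>c. A v *v x = c *s (A v *v y)" for x
    proof -
      obtain r c where "x = r *s u + c *s y"
      proof (cases "u $ 1 = 0")
        case True
        then have "u $ 2 \<noteq> 0" using u by (simp add: vec_eq_iff forall_2)
        then show ?thesis using that[of "x $ 2 / u $ 2" "x $ 1"] True
          by (simp add: vec_eq_iff forall_2 y_def axis_def)
      next
        case False
        then show ?thesis using that[of "x $ 1 / u $ 1" "x $ 2 - x $ 1 / u $ 1 * u $ 2"]
          by (simp add: vec_eq_iff forall_2 y_def axis_def)
      qed
      then show ?thesis using Au by (auto simp: matrix_vector_right_distrib vec.scale)
    qed
    let ?S = "insert (A v *v y) ((\<lambda>j. n j v) ` {..<d})"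
    have "{m. B v *v m = 0} \<subseteq> vec.span ?S"
    proof
      fix m assume "m \<in> {m. B v *v m = 0}"
      then have m: "B v *v m = 0" by simp
      obtain C where C: "v \<in> cone (WC C)" by (rule exists_WC[OF v])
      let ?U = "V \<inter> WC C"
      have U: "zopen ?U" using V(1) openin_WC by (rule openin_Int)
      have vU: "v \<in> cone ?U" using vV C cone_Int[OF zar_subset[OF V(1)] zar_subset[OF openin_WC[of C]]] by blast
      have f: "rst ?U (pr C m) \<in> N ?U" by (rule N_restrict[OF pr_N openin_WC U]) simp
      have "rst ?U (pr C m) v = m" using vU pr_fixed[OF m C] by simp
      moreover define s where "s = (\<Sum>j<d. \<theta> ?U (\<kappa> ?U (rst ?U (pr C m))) j v *s n j v)"
      ultimately have "m - s \<in> range ((*v) (A v))" using gen[OF U _ vU f] by simp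
      then obtain x where "m - s = A v *v x" by blast
      then obtain c where "m - s = c *s (A v *v y)" using rng[of x] by auto
      then have "m = s + c *s (A v *v y)" by (simp add: algebra_simps)
      moreover have "s + c *s (A v *v y) \<in> vec.span ?S"
        unfolding s_def by (intro vec.span_add vec.span_sum vec.span_scale vec.span_base) auto
      ultimately show "m \<in> vec.span ?S" by simp
    qed
    then have "vec.dim {m. B v *v m = 0} \<le> card ?S" by (intro vec.dim_le_card) auto
    also have "\<dots> \<le> d + 1"
      using card_insert_le_m1[of "d + 1" "(\<lambda>j. n j v) ` {..<d}" "A v *v y"] card_image_le[of "{..<d}" "\<lambda>j. n j v"] by simp
    finally have le: "CARD('m) \<le> d + 3" using ker_dim[OF v] by simp
    \<comment> \<open>At a nearby point where \<open>A\<close> is injective it contains too many independent ones.\<close>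
    obtain e f where f: "form e f" "f v \<noteq> 0" "\<forall>x. x \<noteq> 0 \<longrightarrow> f x \<noteq> 0 \<longrightarrow> x \<in> cone V"
      using zar_basis[OF V(1) vV] by blast
    obtain v1 i j where v1: "A v1 $ i $ 1 * A v1 $ j $ 2 - A v1 $ i $ 2 * A v1 $ j $ 1 \<noteq> 0"
      using generically_injective by blast
    define g where "g = (\<lambda>x. A x $ i $ 1 * A x $ j $ 2 - A x $ i $ 2 * A x $ j $ 1)"
    have g: "form 2 g" unfolding g_def by (intro form_diff form_mult_linear A_form)
    have "g v1 \<noteq> 0" unfolding g_def by (rule v1)
    obtain x where "f x \<noteq> 0" "g x \<noteq> 0" by (rule forms_common_nonzero[OF f(1,2) g \<open>g v1 \<noteq> 0\<close>])
    then have x: "f x \<noteq> 0" "A x $ i $ 1 * A x $ j $ 2 - A x $ i $ 2 * A x $ j $ 1 \<noteq> 0"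
      unfolding g_def by blast+
    have x0: "x \<noteq> 0" using x(2) by (auto simp: va.Mat_def)
    then have xV: "x \<in> cone V" using f x by blast
    have Ax: "A x *v u = 0 \<Longrightarrow> u = 0" for u using x(2) injective_iff_minor[of "A x"] by blast
    let ?T = "(\<lambda>j. n j x) ` {..<d}"
    have injT: "inj_on (\<lambda>j. n j x) {..<d}"
    proof (rule inj_onI, rule ccontr)
      fix i j assume ij: "i \<in> {..<d}" "j \<in> {..<d}" "n i x = n j x" "i \<noteq> j"
      let ?x = "\<lambda>k. if k = i then 1 else if k = j then - 1 else (0 :: 'k)"
      have "(\<Sum>k<d. ?x k *s n k x) = (\<Sum>k<d. (if k = i then n k x else 0) - (if k = j then n k x else 0))"
        using ij(4) by (intro sum.cong) (auto simp: vec_eq_iff)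
      also have "\<dots> = 0" using ij by (simp add: sum_subtractf)
      also have "0 \<in> range ((*v) (A x))" using rangeI[of "(*v) (A x)" 0] by simp
      finally have "\<forall>k<d. ?x k = 0" by (rule indep[OF xV])
      then show False using ij(1) by auto
    qed
    have indT: "vec.independent ?T"
    proof
      assume "vec.dependent ?T"
      then obtain c where c: "\<exists>m\<in>?T. c m \<noteq> 0" "(\<Sum>m\<in>?T. c m *s m) = 0" by (auto simp: vec.dependent_finite)
      have "(\<Sum>j<d. c (n j x) *s n j x) = 0" using c(2) by (simp add: sum.reindex[OF injT])
      also have "0 \<in> range ((*v) (A x))" using rangeI[of "(*v) (A x)" 0] by simp
      finally have "\<forall>j<d. c (n j x) = 0" using indep[OF xV, of "\<lambda>j. c (n j x)"] by simp
      then show False using c(1) by auto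
    qed
    let ?R = "range ((*v) (A x))"
    have "vec.span ?T \<inter> ?R \<subseteq> {0}"
    proof
      fix m assume m: "m \<in> vec.span ?T \<inter> ?R"
      then obtain c where c: "m = (\<Sum>m\<in>?T. c m *s m)" by (auto simp: vec.span_finite)
      then have c': "m = (\<Sum>j<d. c (n j x) *s n j x)" by (simp add: sum.reindex[OF injT])
      have "(\<Sum>j<d. c (n j x) *s n j x) \<in> ?R" unfolding c'[symmetric] by (rule IntD2[OF m])
      then have "\<forall>j<d. c (n j x) = 0" by (rule indep[OF xV])
      then have "(\<Sum>j<d. c (n j x) *s n j x) = 0" by simp
      then show "m \<in> {0}" unfolding c'[symmetric] by simp
    qed
    then have d0: "vec.dim (vec.span ?T \<inter> ?R) = 0" by (simp only: vec.dim_eq_0)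
    have dT: "vec.dim (vec.span ?T) = d"
      using vec.dim_span_eq_card_independent[OF indT] card_image[OF injT] by simp
    have dR: "vec.dim ?R = 2" using vec_dim_range[of "A x"] Ax by simp
    have ks: "vec.subspace {m. B x *v m = 0}"
      by (rule vec.subspaceI) (simp_all add: matrix_vector_right_distrib vec.scale)
    have "?T \<subseteq> {m. B x *v m = 0}" using N_ker[OF n] by auto
    then have "vec.span ?T \<subseteq> {m. B x *v m = 0}" by (rule vec.span_minimal[OF _ ks])
    moreover have "?R \<subseteq> {m. B x *v m = 0}" using B_A by auto
    ultimately have "{p + r | p r. p \<in> vec.span ?T \<and> r \<in> ?R} \<subseteq> {m. B x *v m = 0}"
      using vec.subspace_add[OF ks] by blast
    then have "vec.dim {p + r | p r. p \<in> vec.span ?T \<and> r \<in> ?R} \<le> vec.dim {m. B x *v m = 0}" by (rule vec.dim_subset)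
    moreover have "vec.subspace ?R" by (simp add: vec.subspace_image)
    ultimately have "d + 2 \<le> vec.dim {m. B x *v m = 0}"
      using vec.dim_sums_Int[OF vec.subspace_span[of ?T], of ?R] d0 dT dR by linarith
    then show False using ker_dim[OF x0] le by linarith
  qed
qed

end

section \<open>The bilinear form on the fibres\<close>

locale orthogonal_presentation = sheaf_presentation a b tc tm nm nc E \<eta>
  for a b :: "('k::{alg_closed_field,field_char_0}, 'n::finite, nat \<Rightarrow> 'k^'n \<Rightarrow> 'k, nat \<Rightarrow> 'k^'n \<Rightarrow> 'k) homs"
    and tc :: "2 itself" and tm :: "'m::finite itself" and nm nc :: nat
    and E :: "('k, 'n, 'a) omodule" and \<eta> +
  fixes \<phi> :: "('k, 'n, 'a, ('k, 'n, 'a, 'k^'n \<Rightarrow> 'k) homs) homs"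
  assumes \<phi>: "sheaf_iso proj_space proj_space E (dual proj_space E) \<phi>"
    and \<phi>_sym: "zopen U \<Longrightarrow> s \<in> carrier (sec E U) \<Longrightarrow>
      transpose_hom proj_space E \<phi> U (bidual_map proj_space E U s) = \<phi> U s"
    and lf: "locally_free proj_space E"
begin

lemma \<phi>_hom: "sheaf_hom proj_space proj_space E (dual proj_space E) \<phi>"
  and \<phi>_bij: "zopen W \<Longrightarrow> bij_betw (\<phi> W) (carrier (sec E W)) (carrier (sec (dual proj_space E) W))"
  using \<phi> zar_subset[of proj_space W] unfolding sheaf_iso_def by simp_all

lemma \<phi>_surj:
  assumes "zopen W" "\<psi> \<in> carrier (sec (dual proj_space E) W)"
  shows "\<exists>s\<in>carrier (sec E W). \<phi> W s = \<psi>"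
proof -
  have "\<psi> \<in> \<phi> W ` carrier (sec E W)"
    using assms(2) by (simp only: bij_betw_imp_surj_on[OF \<phi>_bij[OF assms(1)]])
  then obtain s where "s \<in> carrier (sec E W)" "\<psi> = \<phi> W s" by (rule imageE)
  then show ?thesis by (intro bexI[of _ s]) simp_all
qed

lemmas \<phi>D = sheaf_homD[OF \<phi>_hom _ zar_subset]

lemma \<phi>_value_hom:
  assumes "zopen W" "s \<in> carrier (sec E W)"
  shows "sheaf_hom proj_space W E (struct_sheaf proj_space) (\<phi> W s)"
  using \<phi>D(1)[OF assms(1) assms(1) assms(2)] by (simp add: dual_def)

text \<open>Evaluated at \<open>t\<close>, the transpose of \<open>\<phi>\<close> on the bidual
  image of \<open>s\<close> is the pairing of \<open>t\<close> with \<open>s\<close>.\<close>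

lemma \<phi>_swap:
  assumes U: "zopen U" and s: "s \<in> carrier (sec E U)" and t: "t \<in> carrier (sec E U)"
  shows "\<phi> U s U t = \<phi> U t U s"
proof -
  have "\<phi> U s U t = transpose_hom proj_space E \<phi> U (bidual_map proj_space E U s) U t"
    by (simp only: \<phi>_sym[OF U s])
  also have "\<dots> = bidual_map proj_space E U s U (\<phi> U t)"
    using U t by (simp add: transpose_hom_def hom_ext_def)
  also have "\<dots> = \<phi> U t U s"
    using U \<phi>D(1)[OF U U t] by (simp add: bidual_map_def hom_ext_def E_res_self[OF U s])
  finally show ?thesis .
qed

lemma \<phi>_res:
  assumes W: "zopen W" "s \<in> carrier (sec E W)" and U: "zopen U" "U \<subseteq> W" "t \<in> carrier (sec E U)"
  shows "\<phi> U (res E W U s) U t = \<phi> W s U t"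
proof -
  have "\<phi> U (res E W U s) = hom_ext proj_space U E (\<phi> W s)"
    using \<phi>D(4)[OF W(1,1,2) U(1,2)] by (simp add: dual_def)
  then show ?thesis using U by (simp add: hom_ext_def)
qed

definition \<Phi> :: "('k^'n) set set \<Rightarrow> ('k^'n \<Rightarrow> 'k^'m) \<Rightarrow> ('k^'n \<Rightarrow> 'k^'m) \<Rightarrow> 'k^'n \<Rightarrow> 'k" where
  "\<Phi> W f g = \<phi> W (\<kappa> W f) W (\<kappa> W g)"

lemma \<Phi>_functional:
  assumes W: "zopen W" and f: "f \<in> N W"
  shows "functional W (\<lambda>U g. \<phi> W (\<kappa> W f) U (\<kappa> U g))"
  by (rule functional_hom[OF W \<phi>_value_hom[OF W \<kappa>(1)[OF W f]]])

lemma \<Phi>_swap: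
  assumes "zopen W" "f \<in> N W" "g \<in> N W"
  shows "\<Phi> W f g = \<Phi> W g f"
  unfolding \<Phi>_def by (intro \<phi>_swap assms \<kappa>)

lemma \<Phi>_restrict:
  assumes W: "zopen W" and f: "f \<in> N W"
    and U: "zopen U" "U \<subseteq> W" and g: "g \<in> N U"
  shows "\<phi> W (\<kappa> W f) U (\<kappa> U g) = \<Phi> U (rst U f) g"
  unfolding \<Phi>_def \<kappa>_res[OF W f U, symmetric]
  by (rule \<phi>_res[OF W \<kappa>(1)[OF W f] U \<kappa>(1)[OF U(1) g], symmetric])

lemma \<Phi>_mod_snd:
  assumes W: "zopen W" and f: "f \<in> N W" and g: "g \<in> N W"
    and U: "zopen U" "U \<subseteq> W" "v \<in> cone U" and g': "g' \<in> N U"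
    and e: "g v - g' v \<in> range ((*v) (A v))"
  shows "\<Phi> W f g v = \<Phi> U (rst U f) g' v"
  using functional_mod[OF \<Phi>_functional[OF W f] W W order_refl cone_mono[OF U(2,3)] g U g' e]
    \<Phi>_restrict[OF W f U(1,2) g'] by (simp add: \<Phi>_def)

text \<open>Invariance is known in the second argument, where the pairing is a functional; symmetry
  carries it to the first.\<close>

lemma \<Phi>_mod:
  assumes W: "zopen W" "v \<in> cone W" and f: "f \<in> N W" and g: "g \<in> N W"
    and W': "zopen W'" "v \<in> cone W'" and f': "f' \<in> N W'" and g': "g' \<in> N W'"
    and ef: "f v - f' v \<in> range ((*v) (A v))" and eg: "g v - g' v \<in> range ((*v) (A v))"
  shows "\<Phi> W f g v = \<Phi> W' f' g' v"
proof -
  let ?U = "W \<inter> W'"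
  have U: "zopen ?U" using W(1) W'(1) by (rule openin_Int)
  have vU: "v \<in> cone ?U" using W(2) W'(2) cone_Int[OF zar_subset[OF W(1)] zar_subset[OF W'(1)]] by blast
  have r: "rst ?U f \<in> N ?U" "rst ?U f' \<in> N ?U" "rst ?U g' \<in> N ?U"
    using N_restrict[OF f W(1) U] N_restrict[OF f' W'(1) U] N_restrict[OF g' W'(1) U] by auto
  have z: "0 \<in> range ((*v) (A v))" using rangeI[of "(*v) (A v)" 0] by simp
  have rr: "rst ?U (rst ?U h) = rst ?U h" for h :: "'k^'n \<Rightarrow> 'k^'m" by auto
  have "\<Phi> W f g v = \<Phi> ?U (rst ?U f) (rst ?U g') v"
    by (rule \<Phi>_mod_snd[OF W(1) f g U _ vU r(3)]) (use eg vU in auto)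
  also have "\<dots> = \<Phi> ?U (rst ?U g') (rst ?U f) v" by (simp only: \<Phi>_swap[OF U r(1,3)])
  also have "\<dots> = \<Phi> ?U (rst ?U (rst ?U g')) (rst ?U f') v"
    by (rule \<Phi>_mod_snd[OF U r(3,1) U order_refl vU r(2)]) (use ef vU in auto)
  also have "\<dots> = \<Phi> ?U (rst ?U f') (rst ?U g') v" by (simp only: rr \<Phi>_swap[OF U r(3,2)])
  also have "\<dots> = \<Phi> W' f' g' v"
    by (rule \<Phi>_mod_snd[OF W'(1) f' g' U _ vU r(3), symmetric]) (use z vU in auto)
  finally show ?thesis .
qed

text \<open>The pairing of local extensions of \<open>m\<close> and \<open>n\<close>, evaluated at
  \<open>v\<close>. It is meaningful on the kernel of \<open>B v\<close>, where by
  \<open>q_eq\<close> every admissible \<open>C\<close> gives the same value.\<close>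

definition q :: "'k^'n \<Rightarrow> 'k^'m \<Rightarrow> 'k^'m \<Rightarrow> 'k" where
  "q v m n = (let C = SOME C. v \<in> cone (WC C) in \<Phi> (WC C) (pr C m) (pr C n) v)"

lemma \<Phi>_q:
  assumes W: "zopen W" "v \<in> cone W" and f: "f \<in> N W" and g: "g \<in> N W"
  shows "\<Phi> W f g v = q v (f v) (g v)"
proof -
  define C :: "'k^2^'m" where "C = (SOME C. v \<in> cone (WC C))"
  have "v \<noteq> 0" using W(2) by (auto simp: punctured_cone_def)
  then have "\<exists>C. v \<in> cone (WC C)" using exists_WC by metis
  then have C: "v \<in> cone (WC C)" unfolding C_def by (rule someI_ex)
  have z: "0 \<in> range ((*v) (A v))" using rangeI[of "(*v) (A v)" 0] by simp
  have "\<Phi> W f g v = \<Phi> (WC C) (pr C (f v)) (pr C (g v)) v"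
    by (rule \<Phi>_mod[OF W f g openin_WC C pr_N pr_N])
      (simp_all add: pr_fixed[OF N_ker[OF f] C] pr_fixed[OF N_ker[OF g] C] z)
  then show ?thesis by (simp add: q_def C_def Let_def)
qed

lemma q_eq:
  assumes "v \<in> cone (WC C)" "B v *v m = 0" "B v *v n = 0"
  shows "q v m n = \<Phi> (WC C) (pr C m) (pr C n) v"
  using \<Phi>_q[OF openin_WC assms(1) pr_N pr_N, of m n] pr_fixed[OF assms(2,1)] pr_fixed[OF assms(3,1)] by simp

lemma \<Phi>_regular:
  assumes "zopen W" "f \<in> N W" "g \<in> N W"
  shows "\<Phi> W f g \<in> reg 0 W"
  using functionalD(1)[OF \<Phi>_functional[OF assms(1,2)] assms(1) order_refl assms(3)] by (simp add: \<Phi>_def)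

lemma q_sym:
  assumes "v \<noteq> 0" "B v *v m = 0" "B v *v n = 0"
  shows "q v m n = q v n m"
proof -
  obtain C where C: "v \<in> cone (WC C)" by (rule exists_WC[OF assms(1)])
  show ?thesis
    unfolding q_eq[OF C assms(2,3)] q_eq[OF C assms(3,2)] by (simp only: \<Phi>_swap[OF openin_WC pr_N pr_N])
qed

lemma q_add:
  assumes "v \<noteq> 0" "B v *v m = 0" "B v *v n = 0" "B v *v l = 0"
  shows "q v (m + n) l = q v m l + q v n l"
proof -
  obtain C where C: "v \<in> cone (WC C)" by (rule exists_WC[OF assms(1)])
  have "B v *v (m + n) = 0" using assms by (simp add: matrix_vector_right_distrib)
  then have "q v l (m + n) = \<Phi> (WC C) (pr C l) (\<lambda>x. pr C m x + pr C n x) v"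
    using q_eq[OF C assms(4)] by (simp add: pr_add[abs_def])
  also have "\<dots> = \<Phi> (WC C) (pr C l) (pr C m) v + \<Phi> (WC C) (pr C l) (pr C n) v"
    using functionalD(2)[OF \<Phi>_functional[OF openin_WC pr_N[of C l]] openin_WC order_refl pr_N[of C m] pr_N[of C n]] by (simp add: \<Phi>_def)
  also have "\<dots> = q v l m + q v l n" using q_eq[OF C assms(4)] assms by simp
  finally show ?thesis using q_sym[OF assms(1)] assms \<open>B v *v (m + n) = 0\<close> by simp
qed

lemma q_scale:
  assumes "v \<noteq> 0" "B v *v m = 0" "B v *v l = 0"
  shows "q v (r *s m) l = r * q v m l"
proof -
  obtain C where C: "v \<in> cone (WC C)" by (rule exists_WC[OF assms(1)])
  have rm: "B v *v (r *s m) = 0" using assms by (simp add: vec.scale)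
  let ?r = "\<lambda>x. rst (WC C) (\<lambda>_. r) x"
  have "pr C (r *s m) = (\<lambda>x. ?r x *s pr C m x)"
  proof
    fix x show "pr C (r *s m) x = ?r x *s pr C m x"
      by (cases "x \<in> cone (WC C)") (simp add: pr_scale, simp add: pr_def)
  qed
  then have "q v l (r *s m) = \<Phi> (WC C) (pr C l) (\<lambda>x. ?r x *s pr C m x) v"
    using q_eq[OF C assms(3) rm] by simp
  also have "\<dots> = r * \<Phi> (WC C) (pr C l) (pr C m) v"
    using fun_cong[OF functionalD(3)[OF \<Phi>_functional[OF openin_WC pr_N[of C l]] openin_WC order_refl pr_N[of C m]
      regular_const[where c=r, OF openin_WC[of C]]], of v] C
    by (simp add: \<Phi>_def)
  also have "\<dots> = r * q v l m" using q_eq[OF C assms(3,2)] by simp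
  finally show ?thesis using q_sym[OF assms(1)] assms rm by simp
qed

lemma q_A:
  assumes "v \<noteq> 0" "B v *v n = 0"
  shows "q v (A v *v u) n = 0"
proof -
  obtain C where C: "v \<in> cone (WC C)" by (rule exists_WC[OF assms(1)])
  have z: "0 \<in> range ((*v) (A v))" using rangeI[of "(*v) (A v)" 0] by simp
  have "q v (A v *v u) n = \<Phi> (WC C) (pr C (A v *v u)) (pr C n) v" by (rule q_eq[OF C B_A assms(2)])
  also have "\<dots> = \<Phi> (WC C) (\<lambda>x. 0) (pr C n) v"
    by (rule \<Phi>_mod[OF openin_WC C pr_N pr_N openin_WC C N_zero[OF openin_WC] pr_N])
      (simp_all add: pr_fixed[OF B_A C] z)
  also have "\<dots> = q v 0 n" using \<Phi>_q[OF openin_WC C N_zero[OF openin_WC] pr_N] pr_fixed[OF assms(2) C] by simp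
  also have "\<dots> = 0" using q_scale[OF assms(1) _ assms(2), of 0 0] by simp
  finally show ?thesis .
qed

text \<open>Each coordinate of a trivialisation is a section of the dual, hence of the form
  \<open>\<phi> W s\<close>. At \<open>v\<close> it pairs \<open>m\<close> with a vector of the
  kernel of \<open>B v\<close>, so it vanishes on \<open>m\<close>. A vector with zero coordinates
  lies in the image of \<open>A v\<close>.\<close>

lemma q_nondegenerate:
  assumes v: "v \<noteq> 0" and m: "B v *v m = 0" and 0: "\<And>n. B v *v n = 0 \<Longrightarrow> q v m n = 0"
  shows "m \<in> range ((*v) (A v))"
proof -
  obtain W d \<theta> where W: "zopen W" "vec.span {v} \<in> W"
    and \<theta>: "sheaf_iso proj_space W E (copies d (struct_sheaf proj_space)) \<theta>"
    using lf span_in_proj_space[OF v] unfolding locally_free_def by blast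
  have \<theta>h: "sheaf_hom proj_space W E (copies d (struct_sheaf proj_space)) \<theta>" using \<theta> by (simp add: sheaf_iso_def)
  have vW: "v \<in> cone W" using W v zar_subset[OF W(1)] by (simp add: punctured_cone_iff)
  show ?thesis
  proof (rule fibre_basis[OF W \<theta>])
    fix V n
    assume V: "zopen V" "vec.span {v} \<in> V" "V \<subseteq> W"
      and gen: "\<And>U f v. zopen U \<Longrightarrow> U \<subseteq> V \<Longrightarrow> v \<in> cone U \<Longrightarrow> f \<in> N U \<Longrightarrow>
        f v - (\<Sum>j<d. \<theta> U (\<kappa> U f) j v *s n j v) \<in> range ((*v) (A v))"
    have vV: "v \<in> cone V" using V v zar_subset[OF V(1)] by (simp add: punctured_cone_iff)
    obtain C where C: "v \<in> cone (WC C)" by (rule exists_WC[OF v])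
    let ?U = "V \<inter> WC C"
    have U: "zopen ?U" using V(1) openin_WC by (rule openin_Int)
    have UW: "?U \<subseteq> W" using V(3) by blast
    have vU: "v \<in> cone ?U" using vV C cone_Int[OF zar_subset[OF V(1)] zar_subset[OF openin_WC[of C]]] by blast
    let ?f = "rst ?U (pr C m)"
    have f: "?f \<in> N ?U" by (rule N_restrict[OF pr_N openin_WC U]) simp
    have fv: "?f v = m" using vU pr_fixed[OF m C] by simp
    have "\<theta> ?U (\<kappa> ?U ?f) j v = 0" if j: "j < d" for j
    proof -
      \<comment> \<open>Membership in the carrier of the dual demands the normal form given by
        \<open>hom_ext\<close>.\<close>
      define \<psi> where "\<psi> = hom_ext proj_space W E (\<lambda>U s. \<theta> U s j)"
      have h: "sheaf_hom proj_space W E (struct_sheaf proj_space) (\<lambda>U s. \<theta> U s j)"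
        by (rule trivialisation_component[OF W(1) \<theta>h j])
      have ext: "\<psi> U s = \<theta> U s j" if "zopen U" "U \<subseteq> W" "s \<in> carrier (sec E U)" for U s
        using that by (simp add: \<psi>_def hom_ext_def)
      have "sheaf_hom proj_space W E (struct_sheaf proj_space) \<psi>"
      proof (rule sheaf_homI)
        fix U s assume U: "zopen U" "U \<subseteq> W" and s: "s \<in> carrier (sec E U)"
        note D = sheaf_homD[OF h U s]
        show "\<psi> U s \<in> carrier (sec (struct_sheaf proj_space) U)" using D(1) ext[OF U s] by simp
        show "\<psi> U (s \<oplus>\<^bsub>sec E U\<^esub> t) = \<psi> U s \<oplus>\<^bsub>sec (struct_sheaf proj_space) U\<^esub> \<psi> U t" if "t \<in> carrier (sec E U)" for t
          using D(2)[OF that] ext[OF U s] ext[OF U that] ext[OF U E_add[OF U(1) s that]] by simp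
        show "\<psi> U (r \<odot>\<^bsub>sec E U\<^esub> s) = r \<odot>\<^bsub>sec (struct_sheaf proj_space) U\<^esub> \<psi> U s"
          if "r \<in> carrier (struct_ring proj_space U)" for r
          using D(3)[OF that] ext[OF U s] ext[OF U E_smult[OF U(1) _ s]] that by (simp add: struct_ring_carrier)
        show "\<psi> V (res E U V s) = res (struct_sheaf proj_space) U V (\<psi> U s)"
          if "zopen V" "V \<subseteq> U" for V
          using D(4)[OF that] ext[OF U s] ext[OF that(1) _ E_res[OF U(1) that s]] that U(2) by simp
      qed
      moreover have "hom_ext proj_space W E \<psi> = \<psi>" unfolding \<psi>_def by (simp add: hom_ext_def fun_eq_iff)
      ultimately have "\<psi> \<in> carrier (sec (dual proj_space E) W)" by (simp add: dual_def)
      then obtain s where s: "s \<in> carrier (sec E W)" "\<phi> W s = \<psi>"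
        using \<phi>_surj[OF W(1)] by blast
      obtain U' g where U': "zopen U'" "vec.span {v} \<in> U'" "U' \<subseteq> W" "g \<in> N U'" "res E W U' s = \<kappa> U' g"
        using \<kappa>_local[OF W(1) s(1) W(2)] by blast
      let ?V = "?U \<inter> U'"
      have V': "zopen ?V" using U U'(1) by (rule openin_Int)
      have VW: "?V \<subseteq> W" and VU': "?V \<subseteq> U'" using U'(3) by auto
      have vU': "v \<in> cone U'" using U'(1,2) v zar_subset[OF U'(1)] by (simp add: punctured_cone_iff)
      have vV': "v \<in> cone ?V" using vU vU' cone_Int[OF zar_subset[OF U] zar_subset[OF U'(1)]] by blast
      have rg: "rst ?V g \<in> N ?V" by (rule N_restrict[OF U'(4,1) V' VU'])
      have rf: "rst ?V ?f \<in> N ?V" by (rule N_restrict[OF f U V' Int_lower1])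
      have "rst ?V (\<theta> ?U (\<kappa> ?U ?f) j) v = \<theta> ?V (\<kappa> ?V (rst ?V ?f)) j v"
        by (rule fun_cong[OF functionalD(4)[OF functional_hom[OF W(1) h] U UW f V' Int_lower1, symmetric]])
      also have "\<dots> = \<psi> ?V (\<kappa> ?V (rst ?V ?f)) v" by (simp only: ext[OF V' VW \<kappa>(1)[OF V' rf]])
      also have "\<dots> = \<phi> ?V (res E W ?V s) ?V (\<kappa> ?V (rst ?V ?f)) v"
        by (simp only: \<phi>_res[OF W(1) s(1) V' VW \<kappa>(1)[OF V' rf]] s(2))
      also have "res E W ?V s = \<kappa> ?V (rst ?V g)"
        using E_res_res[OF W(1) U'(1) V' VU' U'(3) s(1)] \<kappa>_res[OF U'(1,4) V' VU'] U'(5) by simp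
      also have "\<phi> ?V (\<kappa> ?V (rst ?V g)) ?V (\<kappa> ?V (rst ?V ?f)) v = q v (g v) m"
        using \<Phi>_q[OF V' vV' rg rf] vV' fv by (simp add: \<Phi>_def)
      also have "\<dots> = 0" using q_sym[OF v _ m] 0 N_ker[OF U'(4)] by metis
      finally show ?thesis using vV' by simp
    qed
    then have "?f v - 0 \<in> range ((*v) (A v))" using gen[OF U _ vU f] by simp
    then show "m \<in> range ((*v) (A v))" using fv by simp
  qed
qed

text \<open>The vectors \<open>m\<close> and \<open>n\<close> lie in the kernel of
  \<open>B x\<close> for all \<open>x\<close> on the line, where \<open>pr C\<close> fixes them. So
  \<open>q x m n\<close> agrees along the line with local regular functions of degree zero, and
  \<open>regular_near_line\<close> bounds the degree of the resulting polynomial by zero. If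
  \<open>v\<close> and \<open>w\<close> are proportional, homogeneity of degree zero
  suffices.\<close>

lemma q_const:
  assumes v: "v \<noteq> 0" and w: "w \<noteq> 0" and m: "B v *v m = 0" "B w *v m = 0" and n: "B v *v n = 0" "B w *v n = 0"
  shows "q v m n = q w m n"
proof -
  have mx: "B (r *s v + t *s w) *v m = 0" and nx: "B (r *s v + t *s w) *v n = 0" for r t
    using m n by (simp_all add: B_add B_scale)
  have loc: "\<exists>W f. zopen W \<and> f \<in> reg 0 W \<and> r *s v + t *s w \<in> cone W \<and>
      (\<forall>a b. a *s v + b *s w \<in> cone W \<longrightarrow> q (a *s v + b *s w) m n = f (a *s v + b *s w))"
    if nz: "r *s v + t *s w \<noteq> 0" for r t
  proof -
    obtain C where C: "r *s v + t *s w \<in> cone (WC C)" by (rule exists_WC[OF nz])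
    then show ?thesis
      using openin_WC \<Phi>_regular[OF openin_WC pr_N pr_N] q_eq[OF _ mx nx]
      by (intro exI[of _ "WC C"] exI[of _ "\<Phi> (WC C) (pr C m) (pr C n)"]) simp
  qed
  show ?thesis
  proof (cases "\<forall>r t. r *s v + t *s w = 0 \<longrightarrow> r = 0 \<and> t = 0")
    case True
    show ?thesis
    proof (rule regular_near_line[of v w 0 "\<lambda>x. q x m n"])
      show "r = 0 \<and> t = 0" if "r *s v + t *s w = 0" for r t using True that by blast
      show "\<exists>W f. zopen W \<and> f \<in> reg (int 0) W \<and> r *s v + t *s w \<in> cone W \<and>
        (\<forall>a b. a *s v + b *s w \<in> cone W \<longrightarrow> q (a *s v + b *s w) m n = f (a *s v + b *s w))"
        if "r \<noteq> 0 \<or> t \<noteq> 0" for r t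
        using loc[of r t] True that by auto
      fix p assume p: "degree p \<le> 0" "\<And>t. q (v + t *s w) m n = poly p t" "q w m n = Polynomial.coeff p 0"
      then show ?thesis using p(2)[of 0] by (simp add: poly_0_coeff_0)
    qed
  next
    case False
    then obtain r t where rt: "r *s v + t *s w = 0" "r \<noteq> 0 \<or> t \<noteq> 0" by blast
    have "t \<noteq> 0"
    proof
      assume "t = 0"
      then show False using rt v by (simp add: vec_eq_iff)
    qed
    have "w = (1 / t) *s (r *s v + t *s w) + (- (r / t)) *s v"
      using \<open>t \<noteq> 0\<close> by (simp add: vec_eq_iff distrib_left)
    then have wv: "w = (- (r / t)) *s v" using rt(1) by simp
    then have c: "- (r / t) \<noteq> 0" using w by (auto simp: vec_eq_iff)
    obtain C where C: "v \<in> cone (WC C)" by (rule exists_WC[OF v])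
    have "w \<in> cone (WC C)"
      using C scale_punctured_cone[OF zar_subset[OF openin_WC] c] wv by metis
    then have "q w m n = \<Phi> (WC C) (pr C m) (pr C n) w" using q_eq m n by blast
    also have "\<dots> = \<Phi> (WC C) (pr C m) (pr C n) v"
    proof -
      have "\<Phi> (WC C) (pr C m) (pr C n) \<in> reg (int 0) (WC C)"
        using \<Phi>_regular[OF openin_WC pr_N pr_N] by simp
      from regular_homogeneous[OF this openin_WC c, of v] show ?thesis unfolding wv by simp
    qed
    also have "\<dots> = q v m n" using q_eq[OF C] m n by simp
    finally show ?thesis ..
  qed
qed

end

section \<open>The contradiction for instanton bundles of rank 2 and charge 2\<close>

lemma no_orthogonal_presentation:
  assumes "orthogonal_presentation TYPE(6) a b nm nc
    (E :: ('k::{alg_closed_field,field_char_0}, 3, 'a) omodule) \<eta> \<phi>"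
  shows False
proof -
  interpret orthogonal_presentation a b "TYPE(2)" "TYPE(6)" nm nc E \<eta> \<phi> by fact
  interpret orthogonal_monad A B q
  proof
    show "A (v + w) *v u = A v *v u + A w *v u" for v w u by (rule A_add)
    show "A (c *s v) *v u = c *s (A v *v u)" for c v u by (rule A_scale)
    show "B (v + w) *v n = B v *v n + B w *v n" for v w n by (rule B_add)
    show "B (c *s v) *v n = c *s (B v *v n)" for c v n by (rule B_scale)
    show "B v *v (A v *v u) = 0" for v u by (rule B_A)
    show "\<exists>n. B v *v n = y" if "v \<noteq> 0" for v y by (rule B_surj[OF that])
    show "u = 0" if "v \<noteq> 0" "A v *v u = 0" for v u by (rule A_inj[OF lf that])
    show "q v (m + n) k = q v m k + q v n k" if "v \<noteq> 0" "B v *v m = 0" "B v *v n = 0" "B v *v k = 0" for v m n k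
      by (rule q_add[OF that])
    show "q v (c *s m) k = c * q v m k" if "v \<noteq> 0" "B v *v m = 0" "B v *v k = 0" for v c m k
      by (rule q_scale[OF that])
    show "q v m n = q v n m" if "v \<noteq> 0" "B v *v m = 0" "B v *v n = 0" for v m n by (rule q_sym[OF that])
    show "q v (A v *v u) n = 0" if "v \<noteq> 0" "B v *v n = 0" for v u n by (rule q_A[OF that])
    show "m \<in> range ((*v) (A v))" if "v \<noteq> 0" "B v *v m = 0" "\<And>n. B v *v n = 0 \<Longrightarrow> q v m n = 0" for v m
      by (rule q_nondegenerate[OF that])
    show "q v m n = q w m n" if "v \<noteq> 0" "w \<noteq> 0" "B v *v m = 0" "B w *v m = 0" "B v *v n = 0" "B w *v n = 0" for v w m n
      by (rule q_const[OF that])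
  qed
  show False by (rule no_orthogonal_monad)
qed

lemma no_orthogonal_instanton_bundle:
  fixes E :: "('k::{alg_closed_field,field_char_0}, 3, 'a) omodule"
  shows "\<not> orthogonal_instanton_bundle 2 2 E \<phi>"
proof
  assume o: "orthogonal_instanton_bundle 2 2 E \<phi>"
  then have i: "instanton_sheaf 2 2 E" and lf: "locally_free proj_space E"
    by (simp_all add: orthogonal_instanton_bundle_def instanton_bundle_def)
  from i have E: "sheaf_of_modules proj_space E" by (simp add: instanton_sheaf_def coherent_def)
  obtain a b \<eta> where ab: "monad 2 2 a b"
    and \<eta>: "sheaf_iso proj_space proj_space E (cohomology proj_space (copies 2 (twist proj_space (- 1)))
      (copies (2 + 2 * 2) (struct_sheaf proj_space)) (copies 2 (twist proj_space 1)) a b) \<eta>"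
    using i unfolding instanton_sheaf_def by blast
  have "orthogonal_presentation TYPE(6) a b 6 2 E \<eta> \<phi>"
  proof
    show "sheaf_hom proj_space proj_space (copies CARD(2) (twist proj_space (- 1))) (copies CARD(6) (struct_sheaf proj_space)) a"
      "sheaf_hom proj_space proj_space (copies CARD(6) (struct_sheaf proj_space)) (copies CARD(2) (twist proj_space 1)) b"
      using ab by (simp_all add: monad_def Let_def)
    show "b W (a W s) = \<zero>\<^bsub>sec (copies 2 (twist proj_space 1)) W\<^esub>"
      if "zopen W" "s \<in> carrier (sec (copies 2 (twist proj_space (- 1))) W)" for W s
      using ab that by (simp add: monad_def Let_def)
    show "sheaf_injective proj_space proj_space (copies 2 (twist proj_space (- 1))) a"
      "sheaf_surjective proj_space proj_space (copies 6 (struct_sheaf proj_space)) (copies 2 (twist proj_space 1)) b"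
      using ab by (simp_all add: monad_def Let_def)
    show "sheaf_iso proj_space proj_space E (cohomology proj_space (copies 2 (twist proj_space (- 1)))
      (copies 6 (struct_sheaf proj_space)) (copies 2 (twist proj_space 1)) a b) \<eta>" using \<eta> by simp
    show "sheaf_iso proj_space proj_space E (dual proj_space E) \<phi>"
      using o by (simp add: orthogonal_instanton_bundle_def)
    show "transpose_hom proj_space E \<phi> U (bidual_map proj_space E U s) = \<phi> U s"
      if "zopen U" "s \<in> carrier (sec E U)" for U s
      using o that by (simp add: orthogonal_instanton_bundle_def)
  qed (simp_all add: E lf)
  then show False by (rule no_orthogonal_presentation)
qed

theorem theorem4p4:
  shows "(\<nexists>(E :: ('k::{alg_closed_field,field_char_0}, 3, 'a) omodule) \<phi> l \<Phi>.
            framed_orthogonal_instanton_bundle 2 2 E \<phi> l \<Phi>) \<and>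
         (orthogonal_moduli 2 2 ::
            (('k, 3, 'a) omodule \<times> ('k, 3, 'a, ('k, 3, 'a, 'k ^ 3 \<Rightarrow> 'k) homs) homs) set set) = {}"
  by (simp add: framed_orthogonal_instanton_bundle_def orthogonal_moduli_def
      no_orthogonal_instanton_bundle quotient_def Let_def)

end
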